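(* Let $p$ be an odd prime, $D$ a discriminant form of type $p^{\epsilon n}$, and $\gamma\in I$. If $n$ is even, then \[\operatorname{inv}_D(e^{\gamma})=\epsilon\left(\frac{-1}{p}\right)^{n/2}\frac{1}{p^2-1}\frac{1}{p^{(n-2)/2}}\Bigg\{\sum_{\mu\in\gamma^{\perp}\cap I}p\,e^{\mu}-\sum_{\mu\in I}e^{\mu}\Bigg\}+\frac{1}{p^2-1}\sum_{a\in(\mathbb Z/p\mathbb Z)^*}e^{a\gamma}.\] If $n$ is odd, then \[\operatorname{inv}_D(e^{\gamma})=\epsilon\left(\frac{-1}{p}\right)^{(n+1)/2}\left(\frac{2}{p}\right)\frac{1}{p^2-1}\frac{1}{p^{(n-3)/2}}\sum_{\mu\in I}\left(\frac{p(\mu,\gamma)}{p}\right)e^{\mu}+\frac{1}{p^2-1}\sum_{a\in(\mathbb Z/p\mathbb Z)^*}\left(\frac{a}{p}\right)e^{a\gamma}.\]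
   Context: A discriminant form is a finite abelian group $D$ with a quadratic form $\operatorname{q}:D\to\mathbb Q/\mathbb Z$ whose associated bilinear form $(\beta,\gamma)=\operatorname{q}(\beta+\gamma)-\operatorname{q}(\beta)-\operatorname{q}(\gamma)$ is nondegenerate. For odd $p$, $p^{\epsilon n}$ is the orthogonal sum of $n$ cyclic forms of order $p$, each generated by $\gamma$ with $\operatorname{q}(\gamma)=a/p$, $p\nmid a$, with $\epsilon=\pm1$ the product of the Legendre symbols $(\frac{2a}{p})$; such forms have level $p$ and even signature $\operatorname{sign}(D)\in\mathbb Z/8\mathbb Z$ (signature mod 8 of an even lattice with discriminant form $D$). $e(x)=e^{2\pi ix}$, $\Gamma=\operatorname{SL}_2(\mathbb Z)$. The Weil representation on $\mathbb C[D]$: $\rho_D(T)e^\gamma=e(-\operatorname{q}(\gamma))e^\gamma$, $\rho_D(S)e^\gamma=\frac{e(\operatorname{sign}(D)/8)}{\sqrt{|D|}}\sum_\beta e((\gamma,\beta))e^\beta$; $\Gamma(p)$ acts trivially and $\operatorname{inv}_D(e^\gamma)=\frac{1}{|\Gamma/\Gamma(p)|}\sum_{M\in\Gamma/\Gamma(p)}\rho_D(M)e^\gamma$. $I$ is the set of isotropic elements ($\operatorname{q}(\mu)=0$), $\gamma^\perp=\{\mu:(\mu,\gamma)=0\}$. In the odd case $(\mu,\gamma)\in\frac1p\mathbb Z/\mathbb Z$, so $p(\mu,\gamma)\in\mathbb Z/p\mathbb Z$ and $\left(\frac{p(\mu,\gamma)}{p}\right)$ is its Legendre symbol (zero if it vanishes).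 *)

theory Defs
  imports "HOL-Analysis.Analysis" "HOL-Number_Theory.Residues"
begin

section \<open>The group \<open>\<rat>/\<int>\<close>\<close>

quotient_type qmodz = rat / "\<lambda>x y :: rat. x - y \<in> \<int>"
proof (rule equivpI)
  show "reflp (\<lambda>x y :: rat. x - y \<in> \<int>)"
    by (rule reflpI) simp
  show "symp (\<lambda>x y :: rat. x - y \<in> \<int>)"
    by (rule sympI) (metis Ints_minus minus_diff_eq)
  show "transp (\<lambda>x y :: rat. x - y \<in> \<int>)"
    by (rule transpI) (metis Ints_add add_diff_eq diff_add_cancel)
qed

instantiation qmodz :: ab_group_add
begin

lift_definition zero_qmodz :: qmodz is 0 .

lift_definition plus_qmodz :: "qmodz \<Rightarrow> qmodz \<Rightarrow> qmodz" is "(+)"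
  by (metis Ints_add add_diff_add)

lift_definition uminus_qmodz :: "qmodz \<Rightarrow> qmodz" is uminus
  by (metis Ints_minus minus_diff_minus)

lift_definition minus_qmodz :: "qmodz \<Rightarrow> qmodz \<Rightarrow> qmodz" is "(-)"
  by (metis Ints_diff diff_diff_eq2 diff_add_eq add_diff_eq diff_diff_eq add.commute)

instance
  by standard (transfer; simp add: algebra_simps)+

end

lift_definition qmodz_of_rat :: "rat \<Rightarrow> qmodz" is "\<lambda>x. x" .

lift_definition e_qmodz :: "qmodz \<Rightarrow> complex" is "\<lambda>x. exp (2 * of_real pi * \<i> * of_rat x)"
proof -
  fix x y :: rat
  assume "x - y \<in> \<int>"
  then obtain k where "x - y = of_int k"
    by (auto elim: Ints_cases)
  then have "x = y + of_int k"
    by simp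
  then have "2 * of_real pi * \<i> * of_rat x =
      2 * of_real pi * \<i> * of_rat y + of_int (2 * k) * of_real pi * \<i>"
    by (simp add: of_rat_add algebra_simps)
  then show "exp (2 * of_real pi * \<i> * of_rat x) = exp (2 * of_real pi * \<i> * of_rat y)"
    by (auto simp: exp_eq)
qed


section \<open>Discriminant forms\<close>

definition zmul :: "int \<Rightarrow> 'a::ab_group_add \<Rightarrow> 'a" where
  "zmul k x = (if k \<ge> 0 then (\<Sum>i<nat k. x) else - (\<Sum>i<nat (- k). x))"

definition bil :: "('a::ab_group_add \<Rightarrow> qmodz) \<Rightarrow> 'a \<Rightarrow> 'a \<Rightarrow> qmodz" where
  "bil q \<beta> \<gamma> = q (\<beta> + \<gamma>) - q \<beta> - q \<gamma>"

definition quadratic_form :: "('a::ab_group_add \<Rightarrow> qmodz) \<Rightarrow> bool" where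
  "quadratic_form q \<longleftrightarrow>
     (\<forall>k \<gamma>. q (zmul k \<gamma>) = zmul (k\<^sup>2) (q \<gamma>)) \<and>
     (\<forall>\<alpha> \<beta> \<gamma>. bil q (\<alpha> + \<beta>) \<gamma> = bil q \<alpha> \<gamma> + bil q \<beta> \<gamma>)"

definition discriminant_form :: "('a::{finite,ab_group_add} \<Rightarrow> qmodz) \<Rightarrow> bool" where
  "discriminant_form q \<longleftrightarrow>
     quadratic_form q \<and> (\<forall>\<gamma>. (\<forall>\<beta>. bil q \<gamma> \<beta> = 0) \<longrightarrow> \<gamma> = 0)"

text \<open>
  The form has type \<open>p\<^bsup>\<epsilon>n\<^esup>\<close>: the group is the internal orthogonal direct sum of cyclic
  subgroups of order \<open>p\<close> generated by \<open>g 0, \<dots>, g (n - 1)\<close>. That \<open>g i\<close> has order exactly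
  \<open>p\<close> is part of the bijectivity condition.
\<close>

definition disc_type :: "('a::{finite,ab_group_add} \<Rightarrow> qmodz) \<Rightarrow> nat \<Rightarrow> int \<Rightarrow> nat \<Rightarrow> bool" where
  "disc_type q p \<epsilon> n \<longleftrightarrow>
     (\<exists>(g :: nat \<Rightarrow> 'a) (a :: nat \<Rightarrow> int).
        (\<forall>i<n. zmul (int p) (g i) = 0 \<and> \<not> int p dvd a i \<and>
               q (g i) = qmodz_of_rat (of_int (a i) / of_nat p)) \<and>
        (\<forall>i<n. \<forall>j<n. i \<noteq> j \<longrightarrow> bil q (g i) (g j) = 0) \<and>
        bij_betw (\<lambda>c. \<Sum>i<n. zmul (c i) (g i)) ({..<n} \<rightarrow>\<^sub>E {0..<int p}) UNIV \<and>
        \<epsilon> = (\<Prod>i<n. Legendre (2 * a i) (int p)))"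

definition isotropic :: "('a::ab_group_add \<Rightarrow> qmodz) \<Rightarrow> 'a set" where
  "isotropic q = {\<mu>. q \<mu> = 0}"

definition perp :: "('a::ab_group_add \<Rightarrow> qmodz) \<Rightarrow> 'a \<Rightarrow> 'a set" where
  "perp q \<gamma> = {\<mu>. bil q \<mu> \<gamma> = 0}"

text \<open>For \<open>x \<in> (1/p)\<int>/\<int>\<close>, the representative in \<open>{0..<p}\<close> of \<open>p x \<in> \<int>/p\<int>\<close>.\<close>

definition p_times :: "nat \<Rightarrow> qmodz \<Rightarrow> int" where
  "p_times p x = (THE k. 0 \<le> k \<and> k < int p \<and> x = qmodz_of_rat (of_int k / of_nat p))"


section \<open>Even lattices and the signature of a discriminant form\<close>

text \<open>
  A lattice of rank \<open>m\<close> is \<open>\<int>\<^sup>m\<close> with an integral Gram matrix \<open>G\<close>; vectors are functions on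
  \<open>nat\<close> vanishing from index \<open>m\<close> on, and only the entries \<open>G i j\<close> with \<open>i, j < m\<close> matter.
\<close>

definition gram :: "nat \<Rightarrow> (nat \<Rightarrow> nat \<Rightarrow> int) \<Rightarrow> (nat \<Rightarrow> 'b::field_char_0) \<Rightarrow> (nat \<Rightarrow> 'b) \<Rightarrow> 'b" where
  "gram m G x y = (\<Sum>i<m. \<Sum>j<m. x i * of_int (G i j) * y j)"

definition lattice_vecs :: "nat \<Rightarrow> (nat \<Rightarrow> rat) set" where
  "lattice_vecs m = {x. (\<forall>i<m. x i \<in> \<int>) \<and> (\<forall>i\<ge>m. x i = 0)}"

definition dual_vecs :: "nat \<Rightarrow> (nat \<Rightarrow> nat \<Rightarrow> int) \<Rightarrow> (nat \<Rightarrow> rat) set" where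
  "dual_vecs m G = {x. (\<forall>i\<ge>m. x i = 0) \<and> (\<forall>y\<in>lattice_vecs m. gram m G x y \<in> \<int>)}"

definition even_lattice :: "nat \<Rightarrow> (nat \<Rightarrow> nat \<Rightarrow> int) \<Rightarrow> bool" where
  "even_lattice m G \<longleftrightarrow>
     (\<forall>i<m. \<forall>j<m. G i j = G j i) \<and>
     (\<forall>x\<in>lattice_vecs m. \<exists>k::int. gram m G x x = 2 * of_int k) \<and>
     (\<forall>x::nat \<Rightarrow> rat. (\<forall>y. gram m G x y = 0) \<longrightarrow> (\<forall>i<m. x i = 0))"

text \<open>
  Signature \<open>(b\<^sup>+, b\<^sup>-)\<close>: the real quadratic space has an orthogonal basis of \<open>b\<^sup>+\<close> vectors of
  norm \<open>1\<close> and \<open>b\<^sup>-\<close> vectors of norm \<open>-1\<close>. Independence of the \<open>m\<close> vectors follows from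
  orthogonality.
\<close>

definition lattice_signature :: "nat \<Rightarrow> (nat \<Rightarrow> nat \<Rightarrow> int) \<Rightarrow> nat \<Rightarrow> nat \<Rightarrow> bool" where
  "lattice_signature m G bp bm \<longleftrightarrow> bp + bm = m \<and>
     (\<exists>v :: nat \<Rightarrow> nat \<Rightarrow> real. \<forall>i<m. \<forall>j<m.
        gram m G (v i) (v j) = (if i \<noteq> j then 0 else if i < bp then 1 else - 1))"

text \<open>
  An isomorphism from \<open>L'/L\<close> with \<open>x + L \<mapsto> x\<^sup>2/2 + \<int>\<close> to the given form, expressed as a
  surjective homomorphism on \<open>L'\<close> with kernel \<open>L\<close>.
\<close>

definition has_discriminant_form ::
    "nat \<Rightarrow> (nat \<Rightarrow> nat \<Rightarrow> int) \<Rightarrow> ('a::{finite,ab_group_add} \<Rightarrow> qmodz) \<Rightarrow> bool" where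
  "has_discriminant_form m G q \<longleftrightarrow>
     (\<exists>\<phi> :: (nat \<Rightarrow> rat) \<Rightarrow> 'a.
        (\<forall>x\<in>dual_vecs m G. \<forall>y\<in>dual_vecs m G. \<phi> (\<lambda>i. x i + y i) = \<phi> x + \<phi> y) \<and>
        \<phi> ` dual_vecs m G = UNIV \<and>
        (\<forall>x\<in>dual_vecs m G. \<phi> x = 0 \<longleftrightarrow> x \<in> lattice_vecs m) \<and>
        (\<forall>x\<in>dual_vecs m G. q (\<phi> x) = qmodz_of_rat (gram m G x x / 2)))"

text \<open>The element of \<open>\<int>/8\<int>\<close> is given by its representative in \<open>{0..<8}\<close>.\<close>

definition disc_sign :: "('a::{finite,ab_group_add} \<Rightarrow> qmodz) \<Rightarrow> int" where
  "disc_sign q = (THE s. 0 \<le> s \<and> s < 8 \<and>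
     (\<exists>m G bp bm. even_lattice m G \<and> has_discriminant_form m G q \<and>
        lattice_signature m G bp bm \<and> [int bp - int bm = s] (mod 8)))"


section \<open>The Weil representation\<close>

definition SL2Z :: "(int^2^2) set" where
  "SL2Z = {M. det M = 1}"

definition matS :: "int^2^2" where
  "matS = vector [vector [0, -1], vector [1, 0]]"

definition matT :: "int^2^2" where
  "matT = vector [vector [1, 1], vector [0, 1]]"

definition principal_congruence :: "nat \<Rightarrow> (int^2^2) set" where
  "principal_congruence N = {M \<in> SL2Z. \<forall>i j. [M $ i $ j = mat 1 $ i $ j] (mod int N)}"

definition SL2Z_cosets :: "nat \<Rightarrow> (int^2^2) set set" where
  "SL2Z_cosets N = (\<lambda>M. (\<lambda>K. M ** K) ` principal_congruence N) ` SL2Z"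

text \<open>The group algebra \<open>\<complex>[D]\<close> is \<^typ>\<open>complex^'a\<close>.\<close>

abbreviation basis_vec :: "'a::finite \<Rightarrow> complex^'a" where
  "basis_vec \<gamma> \<equiv> axis \<gamma> 1"

definition is_weil_rep ::
    "('a::{finite,ab_group_add} \<Rightarrow> qmodz) \<Rightarrow> (int^2^2 \<Rightarrow> ((complex, 'a) vec, 'a) vec) \<Rightarrow> bool" where
  "is_weil_rep q \<rho> \<longleftrightarrow>
     \<rho> (mat 1) = mat 1 \<and>
     (\<forall>M\<in>SL2Z. \<forall>N\<in>SL2Z. \<rho> (M ** N) = \<rho> M ** \<rho> N) \<and>
     (\<forall>\<gamma>. \<rho> matT *v basis_vec \<gamma> = e_qmodz (- q \<gamma>) *s basis_vec \<gamma>) \<and>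
     (\<forall>\<gamma>. \<rho> matS *v basis_vec \<gamma> =
        (exp (2 * of_real pi * \<i> * of_int (disc_sign q) / 8) / of_real (sqrt (real CARD('a)))) *s
          (\<Sum>\<beta>\<in>UNIV. e_qmodz (bil q \<gamma> \<beta>) *s basis_vec \<beta>))"

text \<open>
  As \<open>S\<close> and \<open>T\<close> generate \<open>SL\<^sub>2(\<int>)\<close>, the conditions determine the representation on
  \<open>SL\<^sub>2(\<int>)\<close>; extensionality only fixes the irrelevant values elsewhere.
\<close>

definition weil_rep ::
    "('a::{finite,ab_group_add} \<Rightarrow> qmodz) \<Rightarrow> int^2^2 \<Rightarrow> ((complex, 'a) vec, 'a) vec" where
  "weil_rep q = (THE \<rho>. \<rho> \<in> extensional SL2Z \<and> is_weil_rep q \<rho>)"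

definition inv_D ::
    "('a::{finite,ab_group_add} \<Rightarrow> qmodz) \<Rightarrow> nat \<Rightarrow> (complex, 'a) vec \<Rightarrow> (complex, 'a) vec" where
  "inv_D q p v =
     (1 / of_nat (card (SL2Z_cosets p))) *s
       (\<Sum>C\<in>SL2Z_cosets p. weil_rep q (SOME M. M \<in> C) *v v)"

end

theory Submission
  imports Defs "HOL-Number_Theory.Number_Theory"
begin

text \<open>
  For a form of level \<open>p\<close> the operator of a matrix depends only on its reduction modulo \<open>p\<close> and is
  explicit: a monomial operator if the lower left entry \<open>c\<close> vanishes modulo \<open>p\<close>, and an oscillatory
  kernel with phase \<open>-(a q(\<beta>) - (\<beta>,\<gamma>) + d q(\<gamma>))/c\<close> otherwise. Multiplicativity need only be
  checked for right multiplication by \<open>S\<close> and \<open>T\<close>, where it is a Gauss sum computation, and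
  averaging the kernels over \<open>SL\<^sub>2(\<int>/p\<int>)\<close> yields the stated formulas.

  The constant of the kernel is the Gauss sum \<open>\<Sum> e(q(x))\<close> divided by \<open>|D|\<close>. That it agrees with the constant
  of \<open>\<rho>\<^sub>D(S)\<close>, which is defined through the signature of a lattice, is Milgram's formula. Passing to an
  orthogonal sublattice reduces it to \<open>\<Sum> e(y\<^sup>2/4a) = (2a)\<^bsup>1/2\<^esup> e(1/8)\<close> (sum over \<open>y\<close> modulo \<open>2a\<close>). The
  normalised value of this sum does not change when \<open>a\<close> is multiplied by a square, and for large \<open>a\<close>
  it approximates a Fresnel integral; hence it does not depend on \<open>a\<close>, and \<open>a = 1\<close> gives the value.
  An even lattice with the given discriminant form is built from continued fractions with even
  partial quotients.
\<close>

section \<open>Integer multiples and the character of \<open>\<rat>/\<int>\<close>\<close>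

text \<open>Both \<open>disc_sign\<close> and \<open>weil_rep\<close> are definite descriptions, so
  nothing can be computed from them before existence and uniqueness are known. For the signature,
  existence needs an actual lattice for the given form, and uniqueness needs Milgram's formula: the
  Gauss sum depends only on the form and determines the signature modulo 8. For the representation,
  existence needs the explicit operators and uniqueness the generation by S and T. The modulus of
  the Gauss sum is elementary, so only its argument has to come from lattices. Positive factors are
  therefore ignored there, which permits summation over a convenient large box instead of
  representatives of the discriminant group. In the average, the diagonal entries of a matrix whose
  lower left entry r is a unit modulo p are free. For isotropic \<gamma> the sum over the upper left
  entry forces q(\<mu>) = 0, and what remains is the sum of (r/p)^n e(r^-1 (\<mu>,\<gamma>)) over r.
  It is a Ramanujan sum for even n and a Gauss sum for odd n, whence the two shapes of the
  result.\<close>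

lemma zmul_0_left [simp]: "zmul 0 x = 0"
  by (simp add: zmul_def)

lemma zmul_add_one: "zmul (k + 1) x = zmul k x + x"
proof (cases "k \<ge> 0")
  case True
  then have "nat (k + 1) = Suc (nat k)" by simp
  with True show ?thesis by (simp add: zmul_def add.commute)
next
  case False
  then have "nat (- k) = Suc (nat (- (k + 1)))" by simp
  with False show ?thesis
    by (cases "k = -1") (auto simp: zmul_def algebra_simps)
qed

lemma zmul_diff_one: "zmul (k - 1) x = zmul k x - x"
  using zmul_add_one[of "k - 1" x] by (simp add: algebra_simps)

lemma zmul_1_left [simp]: "zmul 1 x = x"
  using zmul_add_one[of 0 x] by simp

lemma zmul_add_left: "zmul (k + l) x = zmul k x + zmul l x"
  by (induction l rule: int_induct[where k = 0])
     (simp_all add: zmul_add_one zmul_diff_one add.assoc[symmetric] add_diff_eq)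

lemma zmul_minus_left: "zmul (- k) x = - zmul k x"
  using zmul_add_left[of k "- k" x] by (simp add: eq_neg_iff_add_eq_0 add.commute)

lemma zmul_diff_left: "zmul (k - l) x = zmul k x - zmul l x"
  using zmul_add_left[of k "- l" x] by (simp add: zmul_minus_left)

lemma zmul_hom:
  assumes "\<And>x y. f (x + y) = f x + f y"
  shows "f (zmul k x) = zmul k (f x)"
proof -
  have f0: "f 0 = 0" using assms[of 0 0] by simp
  have fd: "f (x - y) = f x - f y" for x y
    using assms[of "x - y" y] by (simp add: algebra_simps)
  show ?thesis
    by (induction k rule: int_induct[where k = 0])
       (simp_all add: zmul_add_one zmul_diff_one f0 fd assms)
qed

lemma zmul_add_right: "zmul k (x + y) = zmul k x + zmul k y"
  by (induction k rule: int_induct[where k = 0])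
     (simp_all add: zmul_add_one zmul_diff_one algebra_simps)

lemma zmul_0_right [simp]: "zmul k 0 = 0"
  using zmul_add_right[of k 0 0] by simp

lemma zmul_minus_right: "zmul k (- x) = - zmul k x"
  using zmul_add_right[of k x "- x"] by (simp add: eq_neg_iff_add_eq_0 add.commute)

lemma zmul_mult: "zmul (k * l) x = zmul k (zmul l x)"
  by (induction k rule: int_induct[where k = 0])
     (simp_all add: zmul_add_one zmul_diff_one distrib_right left_diff_distrib zmul_add_left zmul_diff_left)

lemma zmul_sum_right: "zmul k (sum f A) = (\<Sum>i\<in>A. zmul k (f i))"
  by (induction A rule: infinite_finite_induct) (simp_all add: zmul_add_right)

lemma zmul_cong:
  assumes "zmul m x = 0" "[k = l] (mod m)"
  shows "zmul k x = zmul l x"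
proof -
  obtain c where "k = l + m * c"
    using assms(2) by (metis cong_iff_lin cong_sym)
  then show ?thesis
    using assms(1) by (simp add: zmul_add_left mult.commute[of m] zmul_mult)
qed

lemma qmodz_of_rat_add: "qmodz_of_rat (x + y) = qmodz_of_rat x + qmodz_of_rat y"
  by transfer simp

lemma qmodz_of_rat_minus: "qmodz_of_rat (- x) = - qmodz_of_rat x"
  by transfer simp

lemma qmodz_of_rat_diff: "qmodz_of_rat (x - y) = qmodz_of_rat x - qmodz_of_rat y"
  by transfer simp

lemma qmodz_of_rat_eq_iff: "qmodz_of_rat x = qmodz_of_rat y \<longleftrightarrow> x - y \<in> \<int>"
  by transfer simp

lemma qmodz_of_rat_eq_0_iff: "qmodz_of_rat x = 0 \<longleftrightarrow> x \<in> \<int>"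
  by transfer simp

lemma qmodz_of_rat_0 [simp]: "qmodz_of_rat 0 = 0"
  by transfer simp

lemma qmodz_of_rat_sum: "qmodz_of_rat (sum f A) = (\<Sum>i\<in>A. qmodz_of_rat (f i))"
  by (induction A rule: infinite_finite_induct) (simp_all add: qmodz_of_rat_add)

lemma zmul_qmodz_of_rat: "zmul k (qmodz_of_rat x) = qmodz_of_rat (of_int k * x)"
proof -
  have "of_int k * x = zmul k x"
    by (induction k rule: int_induct[where k = 0])
       (simp_all add: zmul_add_one zmul_diff_one algebra_simps)
  then show ?thesis
    using zmul_hom[of qmodz_of_rat k x] by (simp add: qmodz_of_rat_add)
qed

text \<open>The character lifted to \<rat>, so that phases are handled as rational numbers and only
  integrality of differences has to be checked.\<close>

definition er :: "rat \<Rightarrow> complex" where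
  "er x = e_qmodz (qmodz_of_rat x)"

lemma er_cis: "er x = cis (2 * pi * of_rat x)"
proof -
  have "e_qmodz (qmodz_of_rat x) = exp (2 * of_real pi * \<i> * of_rat x)"
    by transfer simp
  moreover have "(of_rat x :: complex) = of_real (of_rat x)" by (cases x) (simp add: of_rat_rat)
  ultimately show ?thesis
    unfolding er_def cis_conv_exp by (simp only: of_real_mult of_real_numeral mult_ac)
qed

lemma er_add: "er (x + y) = er x * er y"
  by (simp add: er_cis cis_mult of_rat_add distrib_left)

lemma er_0 [simp]: "er 0 = 1"
  by (simp add: er_cis)

lemma er_minus: "er (- x) = cnj (er x)"
  by (simp add: er_cis of_rat_minus cis_cnj)

lemma norm_er [simp]: "norm (er x) = 1"
  by (simp add: er_cis)

lemma er_nonzero [simp]: "er x \<noteq> 0"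
  using norm_er[of x] by (metis norm_zero zero_neq_one)

lemma er_eq_1_iff: "er x = 1 \<longleftrightarrow> x \<in> \<int>"
proof
  assume "er x = 1"
  then have "cos (2 * pi * of_rat x) = 1"
    by (simp add: er_cis complex_eq_iff)
  then obtain k :: int where "2 * pi * of_rat x = of_int k * 2 * pi"
    using cos_one_2pi_int by auto
  then have "(of_rat x :: real) = of_int k" by simp
  then have "(of_rat x :: real) = of_rat (of_int k)" by simp
  then have "x = of_int k" by (simp only: of_rat_eq_iff)
  then show "x \<in> \<int>" by simp
next
  assume "x \<in> \<int>"
  then have "qmodz_of_rat x = qmodz_of_rat 0"
    by (simp only: qmodz_of_rat_eq_iff) simp
  then show "er x = 1" using er_0 by (simp add: er_def)
qed

lemma er_Ints: "x \<in> \<int> \<Longrightarrow> er x = 1"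
  by (simp add: er_eq_1_iff)

lemma er_cong: "x - y \<in> \<int> \<Longrightarrow> er x = er y"
  using er_add[of "x - y" y] er_Ints[of "x - y"] by simp

lemma er_sum: "er (sum f A) = (\<Prod>i\<in>A. er (f i))"
  by (induction A rule: infinite_finite_induct) (simp_all add: er_add)

section \<open>The sign of the quadratic Gauss sum\<close>

text \<open>Chord against arc: the distance equals 2|sin((x - y)/2)|, and |sin t| is at most
  |t|.\<close>

lemma norm_cis_diff_le: "norm (cis x - cis y) \<le> \<bar>x - y\<bar>"
proof -
  have "(norm (cis x - cis y))\<^sup>2 = (cos x - cos y)\<^sup>2 + (sin x - sin y)\<^sup>2"
    by (simp add: cmod_power2)
  also have "\<dots> = 2 - 2 * cos (x - y)"
    using sin_cos_squared_add[of x] sin_cos_squared_add[of y]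
    by (simp add: cos_diff power2_eq_square algebra_simps)
  also have "\<dots> = (2 * sin ((x - y) / 2))\<^sup>2"
  proof -
    have "cos (2 * ((x - y) / 2)) = 1 - 2 * (sin ((x - y) / 2))\<^sup>2" by (rule cos_double_sin)
    moreover have "2 * ((x - y) / 2) = x - y" by simp
    ultimately show ?thesis by (simp only: power_mult_distrib) simp
  qed
  finally have "norm (cis x - cis y) = 2 * \<bar>sin ((x - y) / 2)\<bar>"
    by (metis abs_mult abs_norm_cancel abs_numeral real_sqrt_abs)
  also have "\<dots> \<le> \<bar>x - y\<bar>"
    using abs_sin_x_le_abs_x[of "(x - y) / 2"] by simp
  finally show ?thesis .
qed

text \<open>\<open>gphase a y\<close> is e(y^2/4a), so \<open>gsum a\<close> is the Gauss sum of the
  discriminant group \<int>/2a of the rank one lattice generated by a vector of norm 2a.\<close>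

definition gphase :: "nat \<Rightarrow> nat \<Rightarrow> complex" where
  "gphase a y = cis (pi * (real y)\<^sup>2 / (2 * real a))"

definition gsum :: "nat \<Rightarrow> complex" where
  "gsum a = (\<Sum>y<2*a. gphase a y)"

lemma norm_gphase [simp]: "norm (gphase a y) = 1"
  by (simp add: gphase_def)

lemma cis_recip:
  fixes t :: real
  assumes "sin t \<noteq> 0"
  shows "(cis (2 * t) - 1) * (- 1 / 2 - \<i> / 2 * of_real (cot t)) = 1"
proof -
  have s: "sin t * sin t = 1 - cos t * cos t"
    using sin_cos_squared_add[of t] by (simp add: power2_eq_square)
  have s': "sin t * (sin t * x) = (1 - cos t * cos t) * x" for x
    by (metis s mult.assoc)
  have c2: "cos (t * 2) = 2 * (cos t * cos t) - 1" "sin (t * 2) = 2 * sin t * cos t"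
    using cos_double_cos[of t] sin_double[of t] by (simp_all add: power2_eq_square mult.commute)
  show ?thesis
    using assms
    by (simp add: complex_eq_iff cot_def c2 s s' field_simps)
qed

lemma cot_decreasing:
  fixes x y :: real
  assumes "0 < x" "x \<le> y" "y < pi"
  shows "cot y \<le> cot x"
proof -
  have "sin x > 0" "sin y > 0" using assms by (auto intro: sin_gt_zero)
  moreover have "0 \<le> sin (y - x)" using assms by (intro sin_ge_zero) auto
  then have "cos y * sin x \<le> cos x * sin y" by (simp add: sin_diff algebra_simps)
  ultimately show ?thesis by (simp add: cot_def field_simps)
qed

text \<open>The derivative 1/cos^2 of tan is at least 1, so the mean value theorem gives tan x >=
  x.\<close>

lemma cot_le_inverse:
  fixes x :: real
  assumes "0 < x" "x < pi / 2"
  shows "0 \<le> cot x" "cot x \<le> 1 / x"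
proof -
  have "\<exists>z>0. z < x \<and> tan x - tan 0 = (x - 0) * inverse ((cos z)\<^sup>2)"
  proof (rule MVT2)
    fix z assume "0 \<le> z" "z \<le> x"
    then have "cos z \<noteq> 0" using assms cos_gt_zero_pi[of z] by simp
    then show "(tan has_real_derivative inverse ((cos z)\<^sup>2)) (at z)" by (rule DERIV_tan)
  qed (use assms in auto)
  then obtain z where z: "0 < z" "z < x" "tan x = x * inverse ((cos z)\<^sup>2)" by auto
  have "cos z > 0" using z assms cos_gt_zero_pi[of z] by simp
  moreover have "(cos z)\<^sup>2 \<le> 1" by (simp add: abs_square_le_1)
  ultimately have "1 \<le> inverse ((cos z)\<^sup>2)" by (simp add: one_le_inverse)
  then have t: "x \<le> tan x" using z assms by simp
  then show "cot x \<le> 1 / x" "0 \<le> cot x"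
    using assms by (auto simp: cot_altdef inverse_eq_divide intro: divide_left_mono)
qed

text \<open>The consecutive quotients of the summands turn so slowly that summation by parts applies
  with the monotone weights \<open>cot\<close>.\<close>

lemma gphase_tail:
  assumes "1 \<le> A" "A \<le> a"
  shows "norm (\<Sum>y=A..<a. gphase a y) \<le> 1 + real a / real A"
proof (cases "A = a")
  case True
  then show ?thesis by simp
next
  case False
  with assms have Aa: "A < a" by simp
  \<comment> \<open>\<open>2 * t y\<close> is the phase difference between the summands at
    \<open>y\<close> and \<open>y + 1\<close>, and \<open>c y\<close> is the inverse of
    \<open>cis (2 * t y) - 1\<close>.\<close>
  define t where "t y = pi * (2 * real y + 1) / (4 * real a)" for y
  define c where "c y = - 1 / 2 - \<i> / 2 * complex_of_real (cot (t y))" for y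
  have t_pos: "0 < t y" for y using Aa by (simp add: t_def add_nonneg_pos)
  have t_less: "t y < pi / 2" if "y < a" for y
  proof -
    have "2 * real y + 1 < 2 * real a" using that by linarith
    then have "pi * (2 * real y + 1) < pi * (2 * real a)" by simp
    then show ?thesis using Aa by (simp add: t_def divide_less_eq)
  qed
  have t_mono: "t x \<le> t y" if "x \<le> y" for x y
    using that Aa by (auto simp: t_def intro!: divide_right_mono)
  have step: "(gphase a (Suc y) - gphase a y) * c y = gphase a y" if "y < a" for y
  proof -
    have "gphase a (Suc y) = gphase a y * cis (2 * t y)"
    proof -
      have "pi * (real (Suc y))\<^sup>2 / (2 * real a) = pi * (real y)\<^sup>2 / (2 * real a) + 2 * t y"
        using Aa by (simp add: t_def power2_eq_square field_simps)
      then show ?thesis by (simp only: gphase_def cis_mult)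
    qed
    then have "(gphase a (Suc y) - gphase a y) * c y = gphase a y * ((cis (2 * t y) - 1) * c y)"
      by (simp add: algebra_simps)
    moreover have nz: "sin (t y) \<noteq> 0"
      using t_pos[of y] t_less[OF that] sin_gt_zero[of "t y"] by simp
    ultimately show ?thesis unfolding c_def by (simp only: cis_recip[OF nz] mult_1_right)
  qed
  have cnorm: "norm (c y) \<le> 1 / 2 + cot (t y) / 2" if "y < a" for y
  proof -
    have "norm (c y) \<le> norm (- 1 / 2 :: complex) + norm (\<i> / 2 * complex_of_real (cot (t y)))"
      unfolding c_def by (rule norm_triangle_ineq4)
    then show ?thesis
      using cot_le_inverse(1)[OF t_pos t_less[OF that]] by (simp add: norm_mult norm_divide)
  qed
  \<comment> \<open>Summation by parts, with the boundary term at \<open>B\<close> kept on the left.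
    The variation of the weights telescopes because cot is decreasing.\<close>
  have main: "norm ((\<Sum>y=A..<B. gphase a y) - gphase a B * c (B - 1))
      \<le> 1 / 2 + cot (t A) / 2 + (cot (t A) - cot (t (B - 1))) / 2" if "B \<ge> Suc A" "B \<le> a" for B
    using that
  proof (induction B rule: dec_induct)
    case base
    have "gphase a A - gphase a (Suc A) * c A = - gphase a A * c A"
      using step[OF Aa] by (simp add: algebra_simps)
    then show ?case using cnorm[OF Aa] by (simp add: norm_mult)
  next
    case (step B)
    then have B: "B < a" "A < B" by auto
    \<comment> \<open>The fact quoted literally below is the outer \<open>step\<close>, whose name
      is shadowed by the induction case.\<close>
    have eq: "(\<Sum>y=A..<Suc B. gphase a y) - gphase a (Suc B) * c B =
       ((\<Sum>y=A..<B. gphase a y) - gphase a B * c (B - 1)) + gphase a B * (c (B - 1) - c B)"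
      using \<open>\<And>y. y < a \<Longrightarrow> _ = _\<close>[OF B(1)] B(2) by (simp add: algebra_simps)
    have le: "cot (t B) \<le> cot (t (B - 1))"
    proof (intro cot_decreasing t_mono t_pos)
      show "t B < pi" using t_less[OF B(1)] pi_gt_zero by linarith
    qed simp
    have "c (B - 1) - c B = \<i> / 2 * complex_of_real (cot (t B) - cot (t (B - 1)))"
      by (simp add: c_def algebra_simps)
    then have "norm (gphase a B * (c (B - 1) - c B)) = (cot (t (B - 1)) - cot (t B)) / 2"
      using le by (simp only: norm_mult norm_gphase norm_of_real) (simp add: norm_divide)
    moreover have "norm ((\<Sum>y=A..<B. gphase a y) - gphase a B * c (B - 1))
      \<le> 1 / 2 + cot (t A) / 2 + (cot (t A) - cot (t (B - 1))) / 2"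
      using step by simp
    ultimately have "norm ((\<Sum>y=A..<Suc B. gphase a y) - gphase a (Suc B) * c B) \<le>
       1 / 2 + cot (t A) / 2 + (cot (t A) - cot (t B)) / 2"
      unfolding eq by (intro order_trans[OF norm_triangle_ineq]) (simp add: field_simps)
    then show ?case by simp
  qed
  have "norm (\<Sum>y=A..<a. gphase a y) \<le>
      norm ((\<Sum>y=A..<a. gphase a y) - gphase a a * c (a - 1)) + norm (gphase a a * c (a - 1))"
    using norm_triangle_ineq[of "(\<Sum>y=A..<a. gphase a y) - gphase a a * c (a - 1)" "gphase a a * c (a - 1)"]
    by simp
  also have "\<dots> \<le> (1 / 2 + cot (t A) / 2 + (cot (t A) - cot (t (a - 1))) / 2) + (1 / 2 + cot (t (a - 1)) / 2)"
    using main[of a] Aa cnorm[of "a - 1"] by (intro add_mono) (auto simp: norm_mult)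
  also have "\<dots> = 1 + cot (t A)" by (simp add: field_simps)
  also have "cot (t A) \<le> 1 / t A" using t_pos t_less[OF Aa] by (rule cot_le_inverse(2))
  also have "1 / t A \<le> real a / real A"
  proof -
    have "4 * real A \<le> pi * (2 * real A + 1)"
      using mult_mono[of 2 pi "2 * real A" "2 * real A + 1"] pi_ge_two by simp
    then have "4 * real a * real A \<le> real a * (pi * (2 * real A + 1))"
      by (metis mult.assoc mult.commute mult_left_mono of_nat_0_le_iff)
    moreover have "0 < pi * (2 * real A + 1)" by (intro mult_pos_pos) auto
    ultimately show ?thesis using assms Aa
      by (simp only: t_def divide_divide_eq_right mult_1_left) (simp add: divide_le_eq le_divide_eq mult_ac)
  qed
  finally show ?thesis by simp
qed

text \<open>The reflection y -> 2a - y changes the phase by a multiple of 2\<pi>. Its fixed point y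
  = a contributes \<open>cis (pi * real a / 2)\<close>, and y = 0, whose mirror image lies outside
  the range, is counted once too often by the doubled sum.\<close>

lemma gsum_half: 
  assumes "a > 0"
  shows "gsum a = 2 * (\<Sum>y<a. gphase a y) + (cis (pi * real a / 2) - 1)"
proof -
  have refl: "gphase a (2 * a - y) = gphase a y" if "y \<le> 2 * a" for y
  proof -
    have "pi * (real (2 * a - y))\<^sup>2 / (2 * real a) =
        pi * (real y)\<^sup>2 / (2 * real a) + 2 * pi * of_int (int a - int y)"
      using that assms by (simp add: of_nat_diff power2_eq_square field_simps)
    then show ?thesis
      by (simp add: gphase_def cis_mult[symmetric] del: of_int_diff)
  qed
  have "gsum a = (\<Sum>y<a. gphase a y) + (\<Sum>y=a..<2*a. gphase a y)"
    unfolding gsum_def lessThan_atLeast0 by (rule sum.atLeastLessThan_concat[symmetric]) auto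
  also have "(\<Sum>y=a..<2*a. gphase a y) = gphase a a + (\<Sum>y=Suc a..<2*a. gphase a y)"
    using assms by (simp add: sum.atLeast_Suc_lessThan)
  also have "(\<Sum>y=Suc a..<2*a. gphase a y) = (\<Sum>y=1..<a. gphase a y)"
    by (rule sum.reindex_bij_witness[of _ "\<lambda>y. 2 * a - y" "\<lambda>y. 2 * a - y"]) (auto simp: refl)
  also have "\<dots> = (\<Sum>y<a. gphase a y) - 1"
  proof -
    have "(\<Sum>y<a. gphase a y) = gphase a 0 + (\<Sum>y=1..<a. gphase a y)"
      using assms by (simp add: lessThan_atLeast0 sum.atLeast_Suc_lessThan)
    then show ?thesis by (simp add: gphase_def)
  qed
  also have "gphase a a = cis (pi * real a / 2)"
    using assms by (simp add: gphase_def power2_eq_square)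
  finally show ?thesis by simp
qed

section \<open>Comparison with a Fresnel integral\<close>

definition fresnel :: "real \<Rightarrow> complex" where
  "fresnel t = cis (pi * t\<^sup>2 / 2)"

lemma fresnel_integrable: "fresnel integrable_on {a..b}"
  unfolding fresnel_def by (intro integrable_continuous_interval continuous_intros) simp_all

text \<open>On the cell [u, u + h] the integrand moves by at most \<pi>/2 ((u + h)^2 - u^2), which
  is at most \<pi> h^2 A as u + h <= A h. Each cell thus contributes at most \<pi> h^3 A.\<close>

lemma fresnel_riemann_sum:
  fixes h :: real
  assumes "h > 0" "k \<le> A"
  shows "norm (of_real h * (\<Sum>y<k. fresnel (real y * h)) - integral {0..real k * h} fresnel)
     \<le> real k * (pi * h ^ 3 * real A)"
  using assms(2)
proof (induction k)
  case 0
  then show ?case by simp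
next
  case (Suc k)
  let ?u = "real k * h" and ?v = "real (Suc k) * h"
  have uv: "0 \<le> ?u" "?u \<le> ?v" "?v = ?u + h" using assms by (auto simp: algebra_simps)
  have split: "integral {0..?v} fresnel = integral {0..?u} fresnel + integral {?u..?v} fresnel"
    using uv by (intro Henstock_Kurzweil_Integration.integral_combine[symmetric] fresnel_integrable) auto
  have const: "integral {?u..?v} (\<lambda>t. fresnel ?u) = of_real h * fresnel ?u"
    using uv by (simp add: scaleR_conv_of_real algebra_simps)
  have "norm (integral {?u..?v} (\<lambda>t. fresnel ?u - fresnel t)) \<le> (pi * h ^ 2 * real A) * (?v - ?u)"
  proof (rule integral_bound)
    show "?u \<le> ?v" by (rule uv)
    show "continuous_on {?u..?v} (\<lambda>t. fresnel ?u - fresnel t)"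
      unfolding fresnel_def by (intro continuous_intros) simp_all
    fix t assume t: "t \<in> {?u..?v}"
    have "norm (fresnel ?u - fresnel t) \<le> \<bar>pi * ?u\<^sup>2 / 2 - pi * t\<^sup>2 / 2\<bar>"
      unfolding fresnel_def by (rule norm_cis_diff_le)
    also have "\<dots> = pi / 2 * (t\<^sup>2 - ?u\<^sup>2)"
    proof -
      have "?u\<^sup>2 \<le> t\<^sup>2" using t uv(1) by (intro power_mono) auto
      then show ?thesis by (simp add: abs_if field_simps)
    qed
    also have "\<dots> \<le> pi / 2 * (?v\<^sup>2 - ?u\<^sup>2)"
    proof -
      have "0 \<le> t" using t uv(1) by (meson atLeastAtMost_iff order_trans)
      then have "t\<^sup>2 \<le> ?v\<^sup>2" using t by (intro power_mono) auto
      then show ?thesis by (intro mult_left_mono) auto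
    qed
    also have "?v\<^sup>2 - ?u\<^sup>2 = h\<^sup>2 * (2 * real k + 1)"
      by (simp add: power2_eq_square algebra_simps)
    also have "pi / 2 * (h\<^sup>2 * (2 * real k + 1)) \<le> pi / 2 * (h\<^sup>2 * (2 * real A))"
      using Suc.prems by (intro mult_left_mono) auto
    finally show "norm (fresnel ?u - fresnel t) \<le> pi * h\<^sup>2 * real A" by simp
  qed
  also have "integral {?u..?v} (\<lambda>t. fresnel ?u - fresnel t) =
      of_real h * fresnel ?u - integral {?u..?v} fresnel"
    by (subst Henstock_Kurzweil_Integration.integral_diff) (auto simp only: const fresnel_integrable integrable_const_ivl)
  finally have "norm (of_real h * fresnel ?u - integral {?u..?v} fresnel) \<le> pi * h ^ 3 * real A"
    using uv by (simp add: power3_eq_cube power2_eq_square mult_ac)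
  then have "norm ((of_real h * (\<Sum>y<k. fresnel (real y * h)) - integral {0..?u} fresnel) +
     (of_real h * fresnel ?u - integral {?u..?v} fresnel)) \<le>
     real k * (pi * h ^ 3 * real A) + pi * h ^ 3 * real A"
    using Suc by (intro order_trans[OF norm_triangle_ineq] add_mono) auto
  then show ?case unfolding split by (simp add: algebra_simps)
qed

lemma gphase_fresnel: "a > 0 \<Longrightarrow> gphase a y = fresnel (real y * (1 / sqrt (real a)))"
  by (simp add: gphase_def fresnel_def power_mult_distrib power_divide mult.commute)

text \<open>With mesh h = a^(-1/2), the summands up to Y/h form a Riemann sum for the integral over
  [0, Y]. The remaining ones contribute about h a/A <= 1/Y by the tail estimate, uniformly in a, so
  the cutoff Y can be chosen independently of a.\<close>

lemma gphase_sum_fresnel: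
  fixes Y h :: real
  assumes Y: "Y \<ge> 1" and a: "a > 0" and h: "h = 1 / sqrt (real a)" "h \<le> 1 / (2 * Y)"
  shows "norm (of_real h * (\<Sum>y<a. gphase a y) - integral {0..Y} fresnel) \<le> h * (4 * pi * Y\<^sup>2 + 2) + 1 / Y"
proof -
  have h0: "h > 0" using h a by simp
  have hh: "h * h * real a = 1" using h(1) a by simp
  have hY: "2 * Y * h \<le> 1" using h(2) Y by (simp add: field_simps)
  have "2 * h \<le> 2 * Y * h" using Y h0 by simp
  with hY have h1: "h \<le> 1 / 2" by simp
  \<comment> \<open>The least index with \<open>A * h \<ge> Y\<close>. The bound on \<open>h\<close>
    ensures \<open>A \<le> a\<close>, so the tail starts inside the range of summation.\<close>
  define A where "A = nat \<lceil>Y / h\<rceil>"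
  have Yh: "Y / h \<ge> 1" using Y h0 h1 by (simp add: field_simps)
  have A: "real A \<ge> Y / h" "real A < Y / h + 1" using Yh by (auto simp: A_def) linarith
  have A1: "A \<ge> 1" using A Yh by linarith
  have Ah: "Y \<le> real A * h" "real A * h \<le> Y + h"
    using A h0 by (auto simp: field_simps)
  have Ah2: "real A * h \<le> 2 * Y" using Ah h1 Y by linarith
  have Aa: "A \<le> a"
  proof -
    have "(real A * h) * h \<le> (Y + h) * h" using Ah h0 by simp
    also have "\<dots> = (2 * Y * h) / 2 + h * h" by (simp add: algebra_simps)
    also have "\<dots> \<le> 1 / 2 + (1/2) * (1/2)" using hY h1 h0 by (intro add_mono mult_mono) auto
    also have "\<dots> \<le> h * h * real a" using hh by simp
    finally have "real A * (h * h) \<le> real a * (h * h)" by (simp add: mult_ac)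
    then show ?thesis using h0 by simp
  qed
  have split: "(\<Sum>y<a. gphase a y) = (\<Sum>y<A. gphase a y) + (\<Sum>y=A..<a. gphase a y)"
    unfolding lessThan_atLeast0 by (rule sum.atLeastLessThan_concat[symmetric]) (use Aa in auto)
  have 1: "norm (of_real h * (\<Sum>y<A. gphase a y) - integral {0..real A * h} fresnel) \<le> h * (4 * pi * Y\<^sup>2)"
  proof -
    have "norm (of_real h * (\<Sum>y<A. gphase a y) - integral {0..real A * h} fresnel)
       \<le> real A * (pi * h ^ 3 * real A)"
      using fresnel_riemann_sum[OF h0 order_refl, of A] gphase_fresnel[OF a] by (simp add: h(1))
    also have "\<dots> = h * (pi * ((real A * h) * (real A * h)))"
      by (simp add: power3_eq_cube)
    also have "\<dots> \<le> h * (pi * ((2 * Y) * (2 * Y)))"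
      using Ah2 h0 Y by (intro mult_left_mono mult_mono[OF Ah2 Ah2]) auto
    finally show ?thesis by (simp add: power2_eq_square)
  qed
  have 2: "norm (integral {0..real A * h} fresnel - integral {0..Y} fresnel) \<le> h"
  proof -
    have "integral {0..real A * h} fresnel = integral {0..Y} fresnel + integral {Y..real A * h} fresnel"
      using Y Ah by (intro Henstock_Kurzweil_Integration.integral_combine[symmetric] fresnel_integrable) auto
    moreover have "norm (integral {Y..real A * h} fresnel) \<le> 1 * (real A * h - Y)"
      using Ah unfolding fresnel_def
      by (intro integral_bound continuous_intros) auto
    ultimately show ?thesis using Ah by simp
  qed
  have 3: "norm (of_real h * (\<Sum>y=A..<a. gphase a y)) \<le> h + 1 / Y"
  proof -
    have "norm (of_real h * (\<Sum>y=A..<a. gphase a y)) \<le> h * (1 + real a / real A)"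
      using gphase_tail[OF A1 Aa] h0 by (simp add: norm_mult)
    also have "\<dots> = h + h * (real a / real A)" by (simp add: distrib_left)
    also have "h * (real a / real A) \<le> 1 / Y"
    proof -
      have "h * real a * Y \<le> h * real a * (real A * h)"
        using Ah h0 by (intro mult_left_mono) auto
      also have "\<dots> = real A" using hh by (simp add: mult_ac)
      finally show ?thesis using Y A1 by (simp add: field_simps)
    qed
    finally show ?thesis by simp
  qed
  have "of_real h * (\<Sum>y<a. gphase a y) - integral {0..Y} fresnel =
     (of_real h * (\<Sum>y<A. gphase a y) - integral {0..real A * h} fresnel) +
     (integral {0..real A * h} fresnel - integral {0..Y} fresnel) +
     of_real h * (\<Sum>y=A..<a. gphase a y)"
    unfolding split by (simp add: algebra_simps)
  also have "norm \<dots> \<le> h * (4 * pi * Y\<^sup>2) + h + (h + 1 / Y)"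
    by (intro order_trans[OF norm_triangle_ineq] add_mono 1 2 3)
  finally show ?thesis by (simp add: algebra_simps)
qed

section \<open>Rescaling by squares and the value of the sum\<close>

lemma sum_lessThan_mult_split:
  fixes f :: "nat \<Rightarrow> 'b::comm_monoid_add"
  shows "(\<Sum>y<m*c. f y) = (\<Sum>u<m. \<Sum>t<c. f (u + m * t))"
proof (induction c)
  case (Suc c)
  have "(\<Sum>y<m * Suc c. f y) = (\<Sum>y<m*c. f y) + (\<Sum>y=m*c..<m*c+m. f y)"
    unfolding lessThan_atLeast0
    by (subst sum.atLeastLessThan_concat) (auto simp: add.commute)
  also have "(\<Sum>y=m*c..<m*c+m. f y) = (\<Sum>u<m. f (u + m * c))"
    by (rule sum.reindex_bij_witness[of _ "\<lambda>u. u + m * c" "\<lambda>y. y - m * c"]) auto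
  finally show ?case using Suc by (simp add: sum.distrib)
qed simp

lemma sum_roots_of_unity:
  fixes u c :: nat
  assumes "c > 0"
  shows "(\<Sum>t<c. cis (2 * pi * (real u / real c) * real t)) = (if c dvd u then of_nat c else 0)"
proof -
  define w where "w = cis (2 * pi * (real u / real c))"
  have pw: "cis (2 * pi * (real u / real c) * real t) = w ^ t" for t
    unfolding w_def by (subst Complex.DeMoivre) (simp only: mult.commute)
  have w1: "w = 1 \<longleftrightarrow> c dvd u"
  proof -
    have "w = er (of_nat u / of_nat c)" by (simp add: w_def er_cis of_rat_divide)
    then have "w = 1 \<longleftrightarrow> (of_nat u / of_nat c :: rat) \<in> \<int>" by (simp add: er_eq_1_iff)
    also have "\<dots> \<longleftrightarrow> c dvd u"
    proof
      assume "(of_nat u / of_nat c :: rat) \<in> \<int>"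
      then obtain k where "(of_nat u / of_nat c :: rat) = of_int k" by (auto elim: Ints_cases)
      then have "(of_nat u :: rat) = of_int k * of_nat c" using assms by (simp add: field_simps)
      then have "(of_int (int u) :: rat) = of_int (k * int c)" by simp
      then have "int u = k * int c" by (simp only: of_int_eq_iff)
      then have "int c dvd int u" by simp
      then show "c dvd u" by simp
    next
      assume "c dvd u"
      then show "(of_nat u / of_nat c :: rat) \<in> \<int>" using assms by (auto elim!: dvdE)
    qed
    finally show ?thesis .
  qed
  have wc: "w ^ c = 1"
  proof -
    have "w ^ c = cis (2 * pi * of_int (int u))"
      unfolding w_def using assms by (subst Complex.DeMoivre) simp
    then show ?thesis by simp
  qed
  show ?thesis
  proof (cases "c dvd u")
    case True
    then show ?thesis unfolding pw using w1 by simp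
  next
    case False
    then have "w \<noteq> 1" using w1 by simp
    then show ?thesis unfolding pw using False wc by (simp add: geometric_sum)
  qed
qed

text \<open>Write an index below 2ac^2 as u + 2ac t with t < c. The sum over t runs over powers of a
  c-th root of unity and vanishes unless c divides u; for u = cw the phase is the one of w for
  a.\<close>

lemma gsum_mult_square:
  assumes a: "a > 0" and c: "c > 0"
  shows "gsum (a * c\<^sup>2) = of_nat c * gsum a"
proof -
  define m where "m = 2 * a * c"
  have ph: "gphase (a * c\<^sup>2) (u + m * t) = gphase (a * c\<^sup>2) u * cis (2 * pi * (real u / real c) * real t)" for u t
  proof -
    have "pi * (real (u + m * t))\<^sup>2 / (2 * real (a * c\<^sup>2)) =
       pi * (real u)\<^sup>2 / (2 * real (a * c\<^sup>2)) + 2 * pi * (real u / real c) * real t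
         + 2 * pi * of_int (int (a * t\<^sup>2))"
      using a c by (simp add: m_def power2_eq_square field_simps)
    then show ?thesis
      by (simp only: gphase_def cis_mult[symmetric] cis_multiple_2pi Ints_of_int mult_1_right)
  qed
  have "gsum (a * c\<^sup>2) = (\<Sum>y<m*c. gphase (a * c\<^sup>2) y)"
    by (simp add: gsum_def m_def power2_eq_square mult_ac)
  also have "\<dots> = (\<Sum>u<m. gphase (a * c\<^sup>2) u * (if c dvd u then of_nat c else 0))"
    unfolding sum_lessThan_mult_split ph sum_distrib_left[symmetric] sum_roots_of_unity[OF c] ..
  also have "\<dots> = (\<Sum>u\<in>(\<lambda>w. c * w) ` {..<2*a}. gphase (a * c\<^sup>2) u * (if c dvd u then of_nat c else 0))"
  proof (rule sum.mono_neutral_right)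
    show "(\<lambda>w. c * w) ` {..<2*a} \<subseteq> {..<m}" using c by (auto simp: m_def mult.commute)
    show "\<forall>i\<in>{..<m} - (\<lambda>w. c * w) ` {..<2*a}. gphase (a * c\<^sup>2) i * (if c dvd i then of_nat c else 0) = 0"
    proof
      fix i assume i: "i \<in> {..<m} - (\<lambda>w. c * w) ` {..<2*a}"
      have "\<not> c dvd i"
      proof
        assume "c dvd i"
        then obtain w where w: "i = c * w" ..
        with i c have "w < 2 * a" by (auto simp: m_def mult.commute)
        with w i show False by auto
      qed
      then show "gphase (a * c\<^sup>2) i * (if c dvd i then of_nat c else 0) = 0" by simp
    qed
  qed simp
  also have "\<dots> = (\<Sum>w<2*a. gphase (a * c\<^sup>2) (c * w) * of_nat c)"
    using c by (subst sum.reindex) (auto simp: inj_on_def)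
  also have "\<dots> = of_nat c * gsum a"
    using a c by (simp add: gsum_def sum_distrib_left gphase_def power2_eq_square mult_ac)
  finally show ?thesis .
qed

text \<open>Replacing a by a c^2 leaves the normalised sum unchanged while h = (a c^2)^(-1/2) tends
  to 0, so only the part 2/Y of the error survives.\<close>

lemma gsum_near_fresnel:
  assumes Y: "Y \<ge> 1" and a: "a > 0"
  shows "norm (gsum a / of_real (sqrt (real a)) - 2 * integral {0..Y} fresnel) \<le> 2 / Y"
proof (rule field_le_epsilon)
  fix e :: real assume e: "e > 0"
  \<comment> \<open>\<open>K\<close> collects all error terms with a factor h: twice the one of
    \<open>gphase_sum_fresnel\<close>, and 2 from the boundary term of
    \<open>gsum_half\<close>.\<close>
  define K where "K = 2 * (4 * pi * Y\<^sup>2 + 2) + 2"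
  have K: "K > 0" using Y by (simp add: K_def add_pos_nonneg add_nonneg_pos)
  obtain c :: nat where c: "real c > max (2 * Y) (K / e)" using reals_Archimedean2 by blast
  then have c0: "c > 0" and c1: "real c \<ge> 2 * Y" and c2: "K / e \<le> real c" using Y by auto
  define a' where "a' = a * c\<^sup>2"
  define h where "h = 1 / sqrt (real a')"
  have a': "a' > 0" using a c0 by (simp add: a'_def)
  have hc: "h \<le> 1 / real c"
  proof -
    have "real c * 1 \<le> real c * sqrt (real a)" using a by (intro mult_left_mono) auto
    then show ?thesis using c0 a
      by (simp add: h_def a'_def real_sqrt_mult field_simps)
  qed
  have h0: "h > 0" using a' by (simp add: h_def)
  have hY: "h \<le> 1 / (2 * Y)"
    using hc c1 Y by (intro order_trans[OF hc] divide_left_mono) auto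
  have eq: "gsum a / of_real (sqrt (real a)) = of_real h * gsum a'"
    using gsum_mult_square[OF a c0] a c0
    by (simp add: a'_def h_def real_sqrt_mult)
  let ?V = "\<Sum>y<a'. gphase a' y"
  have "norm (gsum a / of_real (sqrt (real a)) - 2 * integral {0..Y} fresnel) =
     norm (2 * (of_real h * ?V - integral {0..Y} fresnel) + of_real h * (cis (pi * real a' / 2) - 1))"
    unfolding eq gsum_half[OF a'] by (simp add: algebra_simps)
  also have "\<dots> \<le> 2 * (h * (4 * pi * Y\<^sup>2 + 2) + 1 / Y) + h * 2"
  proof (intro order_trans[OF norm_triangle_ineq] add_mono)
    show "norm (2 * (of_real h * ?V - integral {0..Y} fresnel)) \<le> 2 * (h * (4 * pi * Y\<^sup>2 + 2) + 1 / Y)"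
      using gphase_sum_fresnel[OF Y a' h_def hY] by (simp only: norm_mult) simp
    have "norm (cis (pi * real a' / 2) - 1) \<le> norm (cis (pi * real a' / 2)) + norm (1::complex)"
      by (rule norm_triangle_ineq4)
    then have "norm (cis (pi * real a' / 2) - 1) \<le> 2" by simp
    then show "norm (of_real h * (cis (pi * real a' / 2) - 1)) \<le> h * 2"
      using h0 by (simp add: norm_mult mult_left_mono)
  qed
  also have "\<dots> = h * K + 2 / Y" by (simp add: K_def algebra_simps)
  also have "h * K \<le> e"
  proof -
    have "h * K \<le> 1 / real c * K" using hc K by (intro mult_right_mono) auto
    also have "\<dots> \<le> e" using c2 c0 e by (simp add: field_simps)
    finally show ?thesis .
  qed
  finally show "norm (gsum a / of_real (sqrt (real a)) - 2 * integral {0..Y} fresnel) \<le> 2 / Y + e"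
    by simp
qed

text \<open>The normalised sums for a and for 1 lie within 2/Y of the same truncated integral for
  every Y >= 1, so they agree; \<open>gsum 1\<close> is 1 + i.\<close>

theorem gsum_eq:
  assumes a: "a > 0"
  shows "gsum a = of_real (sqrt (2 * real a)) * cis (pi / 4)"
proof -
  let ?X = "\<lambda>a. gsum a / of_real (sqrt (real a))"
  have "norm (?X a - ?X 1) \<le> 0 + e" if e: "e > 0" for e
  proof -
    define Y where "Y = max 1 (4 / e)"
    have Y: "Y \<ge> 1" and Y4: "4 / Y \<le> e" using e by (auto simp: Y_def field_simps max_def)
    have "norm (?X a - ?X 1) \<le> norm (?X a - 2 * integral {0..Y} fresnel) + norm (?X 1 - 2 * integral {0..Y} fresnel)"
      by (metis dist_norm dist_triangle2)
    also have "\<dots> \<le> 2 / Y + 2 / Y"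
      using gsum_near_fresnel[OF Y a] gsum_near_fresnel[OF Y, of 1] by (intro add_mono) auto
    finally show ?thesis using Y4 by simp
  qed
  then have "norm (?X a - ?X 1) \<le> 0" by (rule field_le_epsilon)
  then have "?X a = gsum 1" by simp
  moreover have "gsum 1 = of_real (sqrt 2) * cis (pi / 4)"
  proof -
    have "{..<2::nat} = {0, 1}" by auto
    then have "gsum 1 = 1 + \<i>" by (simp add: gsum_def gphase_def)
    moreover have "of_real (sqrt 2) * cis (pi / 4) = 1 + \<i>"
      by (simp add: complex_eq_iff cos_45 sin_45)
    ultimately show ?thesis by simp
  qed
  ultimately show ?thesis using a by (simp add: real_sqrt_mult field_simps)
qed

section \<open>Orthogonal bases and inertia\<close>

text \<open>Elimination of one unknown per equation. The index types are arbitrary because the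
  equations come from coordinates in some applications and from pairings between two families in
  others.\<close>

lemma homogeneous_system_solution:
  fixes A :: "'e \<Rightarrow> 'k \<Rightarrow> 'b::field"
  assumes "finite E" "finite K" "card E < card K"
  shows "\<exists>x. (\<exists>k\<in>K. x k \<noteq> 0) \<and> (\<forall>e\<in>E. (\<Sum>k\<in>K. A e k * x k) = 0)"
  using assms
proof (induction E arbitrary: K A rule: finite_induct)
  case empty
  then obtain k where "k \<in> K" by (metis card.empty card_gt_0_iff ex_in_conv)
  then show ?case by (intro exI[of _ "\<lambda>_. 1"]) auto
next
  case (insert e E)
  show ?case
  proof (cases "\<forall>k\<in>K. A e k = 0")
    case True
    have "card E < card K" using insert by simp
    then obtain x where "\<exists>k\<in>K. x k \<noteq> 0" "\<forall>e\<in>E. (\<Sum>k\<in>K. A e k * x k) = 0"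
      using insert.IH[of K A] insert.prems by blast
    with True show ?thesis by (intro exI[of _ x]) auto
  next
    case False
    then obtain k0 where k0: "k0 \<in> K" "A e k0 \<noteq> 0" by blast
    define K' where "K' = K - {k0}"
    have K: "K = insert k0 K'" "k0 \<notin> K'" "finite K'" using k0 insert.prems by (auto simp: K'_def)
    have "card E < card K'" using insert K by simp
    then obtain x where x: "\<exists>k\<in>K'. x k \<noteq> 0"
        "\<forall>e'\<in>E. (\<Sum>k\<in>K'. (A e' k - A e' k0 * A e k / A e k0) * x k) = 0"
      using insert.IH[of K' "\<lambda>e' k. A e' k - A e' k0 * A e k / A e k0"] K(3) by blast
    \<comment> \<open>The eliminated unknown takes the value that makes equation \<open>e\<close>
      hold.\<close>
    define z where "z = x(k0 := - (\<Sum>k\<in>K'. A e k * x k) / A e k0)"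
    have z: "(\<Sum>k\<in>K. A e' k * z k) =
        A e' k0 * (- (\<Sum>k\<in>K'. A e k * x k) / A e k0) + (\<Sum>k\<in>K'. A e' k * x k)" for e'
      using K by (auto simp: z_def intro!: sum.cong)
    show ?thesis
    proof (intro exI[of _ z] conjI ballI)
      show "\<exists>k\<in>K. z k \<noteq> 0" using x(1) K by (auto simp: z_def)
      fix e' assume "e' \<in> insert e E"
      then consider "e' = e" | "e' \<in> E" by auto
      then show "(\<Sum>k\<in>K. A e' k * z k) = 0"
      proof cases
        case 1
        then show ?thesis using k0 by (simp add: z)
      next
        case 2
        have "(\<Sum>k\<in>K'. (A e' k - A e' k0 * A e k / A e k0) * x k) =
            (\<Sum>k\<in>K'. A e' k * x k) - A e' k0 / A e k0 * (\<Sum>k\<in>K'. A e k * x k)"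
          by (simp add: algebra_simps sum_subtractf sum_distrib_left)
        then show ?thesis using x(2) 2 by (simp add: z)
      qed
    qed
  qed
qed

section \<open>The Gram form and orthogonal families\<close>

lemma gram_cong:
  assumes "\<And>i. i < m \<Longrightarrow> x i = x' i" "\<And>i. i < m \<Longrightarrow> y i = y' i"
  shows "gram m G x y = gram m G x' y'"
  unfolding gram_def using assms by (intro sum.cong) auto

lemma gram_add_left: "gram m G (\<lambda>i. x i + y i) z = gram m G x z + gram m G y z"
  by (simp add: gram_def distrib_right sum.distrib)

lemma gram_add_right: "gram m G z (\<lambda>i. x i + y i) = gram m G z x + gram m G z y"
  by (simp add: gram_def distrib_left sum.distrib)

lemma gram_diff_left: "gram m G (\<lambda>i. x i - y i) z = gram m G x z - gram m G y z"
  by (simp add: gram_def left_diff_distrib sum_subtractf)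

lemma gram_diff_right: "gram m G z (\<lambda>i. x i - y i) = gram m G z x - gram m G z y"
  by (simp add: gram_def right_diff_distrib sum_subtractf)

lemma gram_scale_left: "gram m G (\<lambda>i. c * x i) z = c * gram m G x z"
  by (simp add: gram_def sum_distrib_left mult.assoc)

lemma gram_scale_right: "gram m G z (\<lambda>i. c * x i) = c * gram m G z x"
  by (simp add: gram_def sum_distrib_left mult_ac)

lemma gram_zero_left [simp]: "gram m G (\<lambda>i. 0) z = 0"
  by (simp add: gram_def)

lemma gram_zero_right [simp]: "gram m G z (\<lambda>i. 0) = 0"
  by (simp add: gram_def)

lemma gram_sum_left: "gram m G (\<lambda>i. \<Sum>k\<in>K. c k * v k i) z = (\<Sum>k\<in>K. c k * gram m G (v k) z)"
  by (induction K rule: infinite_finite_induct) (simp_all add: gram_add_left gram_scale_left)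

lemma gram_sum_right: "gram m G z (\<lambda>i. \<Sum>k\<in>K. c k * v k i) = (\<Sum>k\<in>K. c k * gram m G z (v k))"
  by (induction K rule: infinite_finite_induct) (simp_all add: gram_add_right gram_scale_right)

lemma gram_of_rat: "gram m G (\<lambda>i. of_rat (x i)) (\<lambda>i. of_rat (y i)) = of_rat (gram m G x y)"
  by (simp add: gram_def of_rat_sum of_rat_mult)

lemma gram_commute:
  assumes "\<forall>i<m. \<forall>j<m. G i j = G j i"
  shows "gram m G x y = gram m G y x"
proof -
  have "gram m G x y = (\<Sum>j<m. \<Sum>i<m. x i * of_int (G i j) * y j)"
    unfolding gram_def by (rule sum.swap)
  also have "\<dots> = gram m G y x"
    unfolding gram_def using assms by (intro sum.cong) (auto simp: mult_ac)
  finally show ?thesis .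
qed

definition orth_family :: "nat \<Rightarrow> (nat \<Rightarrow> nat \<Rightarrow> int) \<Rightarrow> nat \<Rightarrow> (nat \<Rightarrow> nat \<Rightarrow> 'b::field_char_0) \<Rightarrow> bool" where
  "orth_family m G k v \<longleftrightarrow>
     (\<forall>i<k. \<forall>j<k. i \<noteq> j \<longrightarrow> gram m G (v i) (v j) = 0) \<and> (\<forall>i<k. gram m G (v i) (v i) \<noteq> 0)"

lemma orth_family_gram_sum:
  assumes "orth_family m G k v" "j < k"
  shows "gram m G (\<lambda>i. \<Sum>l<k. c l * v l i) (v j) = c j * gram m G (v j) (v j)"
proof -
  have "(\<Sum>l<k. c l * gram m G (v l) (v j)) = (\<Sum>l\<in>{j}. c l * gram m G (v l) (v j))"
    using assms by (intro sum.mono_neutral_right) (auto simp: orth_family_def)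
  then show ?thesis by (simp add: gram_sum_left)
qed

lemma orth_family_gram_sum_sum:
  assumes "orth_family m G k v" "K \<subseteq> {..<k}"
  shows "gram m G (\<lambda>i. \<Sum>l\<in>K. c l * v l i) (\<lambda>i. \<Sum>l\<in>K. d l * v l i) =
     (\<Sum>l\<in>K. c l * d l * gram m G (v l) (v l))"
proof -
  have fin: "finite K" using assms(2) finite_subset by blast
  have "gram m G (\<lambda>i. \<Sum>l\<in>K. c l * v l i) (\<lambda>i. \<Sum>l\<in>K. d l * v l i) =
      (\<Sum>l\<in>K. c l * (\<Sum>j\<in>K. d j * gram m G (v l) (v j)))"
    by (simp add: gram_sum_left gram_sum_right)
  also have "\<dots> = (\<Sum>l\<in>K. c l * d l * gram m G (v l) (v l))"
  proof (rule sum.cong)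
    fix l assume l: "l \<in> K"
    have "(\<Sum>j\<in>K. d j * gram m G (v l) (v j)) = (\<Sum>j\<in>{l}. d j * gram m G (v l) (v j))"
      using assms l fin by (intro sum.mono_neutral_right) (auto simp: orth_family_def)
    then show "c l * (\<Sum>j\<in>K. d j * gram m G (v l) (v j)) = c l * d l * gram m G (v l) (v l)"
      by simp
  qed simp
  finally show ?thesis .
qed

text \<open>The remainder \<open>x'\<close> after projection is orthogonal to the family. The m + 1
  vectors \<open>v 0, ..., v (m - 1), x'\<close> have m coordinates and so satisfy a relation;
  pairing it with \<open>v j\<close> kills the coefficient of \<open>v j\<close>, and only the one
  of \<open>x'\<close> remains.\<close>

lemma orth_family_expand:
  fixes v :: "nat \<Rightarrow> nat \<Rightarrow> 'b::field_char_0"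
  assumes v: "orth_family m G m v" and i: "i < m"
  shows "x i = (\<Sum>k<m. gram m G x (v k) / gram m G (v k) (v k) * v k i)"
proof -
  define c where "c k = gram m G x (v k) / gram m G (v k) (v k)" for k
  define x' where "x' = (\<lambda>i. x i - (\<Sum>k<m. c k * v k i))"
  define V where "V k = (if k < m then v k else x')" for k
  have x'v: "gram m G x' (v j) = 0" if "j < m" for j
    using orth_family_gram_sum[OF v that, of c] that v
    by (simp add: x'_def gram_diff_left c_def orth_family_def)
  have "\<exists>y. (\<exists>k\<in>{..m}. y k \<noteq> 0) \<and> (\<forall>i\<in>{..<m}. (\<Sum>k\<in>{..m}. V k i * y k) = 0)"
    by (rule homogeneous_system_solution) auto
  then obtain y where y: "\<exists>k\<le>m. y k \<noteq> 0" "\<And>i. i < m \<Longrightarrow> (\<Sum>k\<le>m. y k * V k i) = 0"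
    by (auto simp: mult.commute)
  have split: "(\<Sum>k\<le>m. y k * V k i) = (\<Sum>k<m. y k * v k i) + y m * x' i" for i
    by (simp add: lessThan_Suc_atMost[symmetric] V_def)
  have y0: "y j = 0" if j: "j < m" for j
  proof -
    have "0 = gram m G (\<lambda>i. \<Sum>k\<le>m. y k * V k i) (v j)"
      using y(2) gram_cong[of m "\<lambda>i. \<Sum>k\<le>m. y k * V k i" "\<lambda>_. 0" "v j" "v j" G] by simp
    also have "\<dots> = y j * gram m G (v j) (v j)"
      unfolding split by (simp add: gram_add_left gram_scale_left orth_family_gram_sum[OF v j] x'v[OF j])
    finally show ?thesis using v j by (simp add: orth_family_def)
  qed
  then have "y m \<noteq> 0" using y(1) le_neq_implies_less by blast
  moreover have "y m * x' i = 0" using y(2)[OF i] y0 by (simp add: split)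
  ultimately have "x' i = 0" by simp
  then show ?thesis by (simp add: x'_def c_def)
qed

text \<open>Gram-Schmidt for an indefinite form needs an anisotropic vector orthogonal to the
  family. If all vectors of that complement were isotropic, polarisation would make the form vanish
  on it, and its nonzero vector \<open>w0\<close> would lie in the radical.\<close>

lemma rational_orth_family:
  assumes sym: "\<forall>i<m. \<forall>j<m. G i j = G j i"
    and nondeg: "\<forall>x::nat \<Rightarrow> rat. (\<forall>y. gram m G x y = 0) \<longrightarrow> (\<forall>i<m. x i = 0)"
    and "k \<le> m"
  shows "\<exists>v :: nat \<Rightarrow> nat \<Rightarrow> rat. orth_family m G k v"
  using \<open>k \<le> m\<close>
proof (induction k)
  case 0
  then show ?case by (simp add: orth_family_def)
next
  case (Suc k)
  then obtain v :: "nat \<Rightarrow> nat \<Rightarrow> rat" where v: "orth_family m G k v" by auto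
  note comm = gram_commute[OF sym]
  have "\<exists>w. (\<exists>i\<in>{..<m}. w i \<noteq> 0) \<and> (\<forall>j\<in>{..<k}. (\<Sum>i\<in>{..<m}. (\<Sum>l<m. of_int (G i l) * v j l) * w i) = 0)"
    by (rule homogeneous_system_solution) (use Suc in auto)
  then obtain w0 where w0: "\<exists>i<m. w0 i \<noteq> 0"
      and "\<forall>j<k. (\<Sum>i<m. (\<Sum>l<m. of_int (G i l) * v j l) * w0 i) = 0" by auto
  then have w0v: "gram m G w0 (v j) = 0" if "j < k" for j
    using that by (simp add: gram_def sum_distrib_left sum_distrib_right mult_ac)
  have "\<exists>w. (\<forall>j<k. gram m G w (v j) = 0) \<and> gram m G w w \<noteq> 0"
  proof (rule ccontr)
    assume "\<nexists>w. (\<forall>j<k. gram m G w (v j) = 0) \<and> gram m G w w \<noteq> 0"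
    then have iso: "gram m G w w = 0" if "\<And>j. j < k \<Longrightarrow> gram m G w (v j) = 0" for w
      using that by blast
    have "gram m G w0 y = 0" for y
    proof -
      define c where "c l = gram m G y (v l) / gram m G (v l) (v l)" for l
      define y' where "y' = (\<lambda>i. y i - (\<Sum>l<k. c l * v l i))"
      have y'v: "gram m G y' (v j) = 0" if "j < k" for j
        using orth_family_gram_sum[OF v that, of c] that v
        by (simp add: y'_def gram_diff_left c_def orth_family_def)
      have "gram m G (\<lambda>i. w0 i + y' i) (\<lambda>i. w0 i + y' i) = 0"
        by (rule iso) (simp add: gram_add_left w0v y'v)
      then have "2 * gram m G w0 y' = 0"
        using iso[OF w0v] iso[OF y'v] comm[of y' w0] by (simp add: gram_add_left gram_add_right)
      then have "gram m G w0 y' = 0" by simp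
      moreover have "gram m G w0 y' = gram m G w0 y"
        unfolding y'_def gram_diff_right gram_sum_right using w0v by simp
      ultimately show ?thesis by simp
    qed
    with nondeg w0 show False by blast
  qed
  then obtain w where w: "\<And>j. j < k \<Longrightarrow> gram m G w (v j) = 0" "gram m G w w \<noteq> 0" by blast
  have w': "gram m G (v j) w = 0" if "j < k" for j using w(1)[OF that] comm[of "v j" w] by simp
  have "orth_family m G (Suc k) (v(k := w))"
    using v w w' by (auto simp: orth_family_def less_Suc_eq)
  then show ?case by blast
qed

lemma common_denominator:
  fixes x :: "nat \<Rightarrow> rat"
  shows "\<exists>d::int. d > 0 \<and> (\<forall>i<m. of_int d * x i \<in> \<int>)"
proof (induction m)
  case 0
  then show ?case by (intro exI[of _ 1]) auto
next
  case (Suc m)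
  then obtain d where d: "d > 0" "\<And>i. i < m \<Longrightarrow> of_int d * x i \<in> \<int>" by blast
  obtain n e where ne: "quotient_of (x m) = (n, e)" by force
  have e: "e > 0" "x m = of_int n / of_int e"
    using ne quotient_of_denom_pos quotient_of_div by blast+
  have "of_int (d * e) * x i \<in> \<int>" if "i < Suc m" for i
  proof (cases "i = m")
    case True
    then have "of_int (d * e) * x i = of_int (d * n)" using e by simp
    then show ?thesis by (metis Ints_of_int)
  next
    case False
    then have "of_int e * (of_int d * x i) \<in> \<int>" using d(2)[of i] that Ints_mult[OF Ints_of_int] by simp
    then show ?thesis by (simp add: mult_ac)
  qed
  then show ?case using d e by (intro exI[of _ "d * e"]) auto
qed

text \<open>Clearing denominators moves a rational orthogonal basis into the lattice, where evenness
  makes its norms even integers.\<close>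

lemma even_lattice_orth_basis:
  assumes "even_lattice m G"
  obtains v :: "nat \<Rightarrow> nat \<Rightarrow> rat" and a :: "nat \<Rightarrow> int" where
    "orth_family m G m v" "\<And>k. k < m \<Longrightarrow> v k \<in> lattice_vecs m"
    "\<And>k. k < m \<Longrightarrow> gram m G (v k) (v k) = 2 * of_int (a k)" "\<And>k. k < m \<Longrightarrow> a k \<noteq> 0"
proof -
  have ev: "\<forall>x\<in>lattice_vecs m. \<exists>k::int. gram m G x x = 2 * of_int k"
    using assms by (simp add: even_lattice_def)
  obtain u :: "nat \<Rightarrow> nat \<Rightarrow> rat" where u: "orth_family m G m u"
    using rational_orth_family[of m G m] assms unfolding even_lattice_def by auto
  obtain d :: "nat \<Rightarrow> int" where d: "\<And>k. d k > 0" "\<And>k i. i < m \<Longrightarrow> of_int (d k) * u k i \<in> \<int>"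
  proof -
    have "\<forall>k. \<exists>d::int. d > 0 \<and> (\<forall>i<m. of_int d * u k i \<in> \<int>)"
      using common_denominator by blast
    then show ?thesis using that by (metis (no_types, lifting))
  qed
  define v where "v k i = (if i < m then of_int (d k) * u k i else 0)" for k i
  have gv: "gram m G (v k) (v l) = of_int (d k) * (of_int (d l) * gram m G (u k) (u l))" for k l
  proof -
    have "gram m G (v k) (v l) = gram m G (\<lambda>i. of_int (d k) * u k i) (\<lambda>i. of_int (d l) * u l i)"
      by (rule gram_cong) (auto simp: v_def)
    then show ?thesis by (simp add: gram_scale_left gram_scale_right)
  qed
  have d0: "d k \<noteq> 0" for k using d(1)[of k] by simp
  have v1: "orth_family m G m v"
    using u d0 by (auto simp: orth_family_def gv)
  have v2: "v k \<in> lattice_vecs m" for k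
    using d(2) by (auto simp: lattice_vecs_def v_def)
  have "\<exists>a::int. gram m G (v k) (v k) = 2 * of_int a" for k using ev v2 by blast
  then obtain a :: "nat \<Rightarrow> int" where a: "\<And>k. gram m G (v k) (v k) = 2 * of_int (a k)" by metis
  have "a k \<noteq> 0" if "k < m" for k using v1 that a[of k] by (auto simp: orth_family_def)
  with v1 v2 a that show ?thesis by blast
qed

text \<open>Sylvester's argument: with too many positive vectors in \<open>u\<close>, a dimension
  count gives a nonzero combination of them orthogonal to all positive vectors of \<open>v\<close>.
  Its norm is positive when computed in \<open>u\<close> and nonpositive when computed in
  \<open>v\<close>.\<close>

lemma inertia_le:
  fixes u v :: "nat \<Rightarrow> nat \<Rightarrow> real"
  assumes sym: "\<forall>i<m. \<forall>j<m. G i j = G j i"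
    and u: "orth_family m G m u" and v: "orth_family m G m v"
  shows "card {i. i < m \<and> gram m G (u i) (u i) > 0} \<le> card {i. i < m \<and> gram m G (v i) (v i) > 0}"
    (is "card ?K \<le> card ?E")
proof (rule ccontr)
  assume "\<not> card ?K \<le> card ?E"
  then have "\<exists>x. (\<exists>k\<in>?K. x k \<noteq> 0) \<and> (\<forall>e\<in>?E. (\<Sum>k\<in>?K. gram m G (u k) (v e) * x k) = 0)"
    by (intro homogeneous_system_solution) auto
  then obtain x where x: "\<exists>k\<in>?K. x k \<noteq> 0" "\<And>e. e \<in> ?E \<Longrightarrow> (\<Sum>k\<in>?K. x k * gram m G (u k) (v e)) = 0"
    by (auto simp: mult.commute)
  define U where "U = (\<lambda>i. \<Sum>k\<in>?K. x k * u k i)"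
  have "gram m G U U = (\<Sum>k\<in>?K. x k * x k * gram m G (u k) (u k))"
    unfolding U_def by (rule orth_family_gram_sum_sum[OF u]) auto
  also have "\<dots> > 0"
  proof -
    obtain k where k: "k \<in> ?K" "x k \<noteq> 0" using x(1) by blast
    show ?thesis
    proof (rule sum_pos2[OF _ k(1)])
      show "0 < x k * x k * gram m G (u k) (u k)"
      proof (rule mult_pos_pos)
        show "0 < x k * x k" using k(2) not_real_square_gt_zero by blast
        show "0 < gram m G (u k) (u k)" using k(1) by simp
      qed
      show "0 \<le> x j * x j * gram m G (u j) (u j)" if "j \<in> ?K" for j
        using that by (intro mult_nonneg_nonneg[OF zero_le_square]) auto
    qed simp
  qed
  finally have pos: "gram m G U U > 0" .
  define c where "c k = gram m G U (v k) / gram m G (v k) (v k)" for k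
  have "gram m G U U = gram m G (\<lambda>i. \<Sum>k<m. c k * v k i) (\<lambda>i. \<Sum>k<m. c k * v k i)"
    unfolding c_def by (intro gram_cong orth_family_expand[OF v])
  also have "\<dots> = (\<Sum>k<m. c k * c k * gram m G (v k) (v k))"
    by (rule orth_family_gram_sum_sum[OF v]) auto
  also have "\<dots> \<le> 0"
  proof (rule sum_nonpos)
    fix k assume k: "k \<in> {..<m}"
    show "c k * c k * gram m G (v k) (v k) \<le> 0"
    proof (cases "k \<in> ?E")
      case True
      then have "c k = 0" using x(2)[OF True] by (simp add: c_def U_def gram_sum_left)
      then show ?thesis by simp
    next
      case False
      then show ?thesis using k by (intro mult_nonneg_nonpos) auto
    qed
  qed
  finally show False using pos by simp
qed

lemma inertia:
  fixes u v :: "nat \<Rightarrow> nat \<Rightarrow> real"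
  assumes "\<forall>i<m. \<forall>j<m. G i j = G j i" "orth_family m G m u" "orth_family m G m v"
  shows "card {i. i < m \<and> gram m G (u i) (u i) > 0} = card {i. i < m \<and> gram m G (v i) (v i) > 0}"
  by (intro antisym inertia_le assms)

lemma orth_family_of_rat:
  assumes "orth_family m G k v"
  shows "orth_family m G k (\<lambda>j i. of_rat (v j i) :: real)"
  using assms unfolding orth_family_def gram_of_rat by simp

text \<open>The signature is defined by a real basis, whereas the Gauss sums use a rational one;
  inertia identifies the two counts.\<close>

lemma signature_card_pos:
  fixes v :: "nat \<Rightarrow> nat \<Rightarrow> rat"
  assumes sym: "\<forall>i<m. \<forall>j<m. G i j = G j i" and sig: "lattice_signature m G bp bm"
    and v: "orth_family m G m v" and a: "\<And>k. k < m \<Longrightarrow> gram m G (v k) (v k) = 2 * of_int (a k)"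
  shows "card {k. k < m \<and> a k > 0} = bp"
proof -
  obtain u :: "nat \<Rightarrow> nat \<Rightarrow> real" where
    u: "\<And>i j. i < m \<Longrightarrow> j < m \<Longrightarrow> gram m G (u i) (u j) = (if i \<noteq> j then 0 else if i < bp then 1 else - 1)"
    and bm: "bp + bm = m"
    using sig unfolding lattice_signature_def by blast
  have "orth_family m G m u" using u by (auto simp: orth_family_def)
  then have "card {i. i < m \<and> gram m G (u i) (u i) > 0} =
      card {i. i < m \<and> gram m G (\<lambda>l. of_rat (v i l) :: real) (\<lambda>l. of_rat (v i l)) > 0}"
    using inertia[OF sym] orth_family_of_rat[OF v] by blast
  also have "{i. i < m \<and> gram m G (\<lambda>l. of_rat (v i l) :: real) (\<lambda>l. of_rat (v i l)) > 0} =
      {k. k < m \<and> a k > 0}"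
    by (auto simp: gram_of_rat a)
  also have "{i. i < m \<and> gram m G (u i) (u i) > 0} = {..<bp}"
    using u bm by (auto split: if_splits)
  finally show ?thesis by simp
qed

lemma even_lattice_signature_exists:
  assumes L: "even_lattice m G"
  shows "\<exists>bp bm. lattice_signature m G bp bm"
proof -
  obtain v :: "nat \<Rightarrow> nat \<Rightarrow> rat" and a :: "nat \<Rightarrow> int" where v: "orth_family m G m v"
    and a: "\<And>k. k < m \<Longrightarrow> gram m G (v k) (v k) = 2 * of_int (a k)" "\<And>k. k < m \<Longrightarrow> a k \<noteq> 0"
    using even_lattice_orth_basis[OF L] by metis
  define P where "P = {k. k < m \<and> a k > 0}"
  define bp where "bp = card P"
  have P: "finite P" "P \<subseteq> {..<m}" by (auto simp: P_def)
  have bpm: "bp \<le> m" using card_mono[OF _ P(2)] by (simp add: bp_def)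
  obtain f where f: "bij_betw f {..<bp} P"
    using ex_bij_betw_nat_finite[OF P(1)] by (auto simp: bp_def lessThan_atLeast0)
  have "card {bp..<m} = card ({..<m} - P)"
    using P by (simp add: card_Diff_subset bp_def)
  then obtain g where g: "bij_betw g {bp..<m} ({..<m} - P)"
    using finite_same_card_bij[of "{bp..<m}" "{..<m} - P"] by auto
  \<comment> \<open>A permutation that lists the positive vectors first, as
    \<open>lattice_signature\<close> demands.\<close>
  define h where "h i = (if i < bp then f i else g i)" for i
  have "bij_betw h ({..<bp} \<union> {bp..<m}) (P \<union> ({..<m} - P))"
  proof (rule bij_betw_combine)
    show "bij_betw h {..<bp} P" using f by (subst bij_betw_cong[of _ _ f]) (auto simp: h_def)
    show "bij_betw h {bp..<m} ({..<m} - P)" using g by (subst bij_betw_cong[of _ _ g]) (auto simp: h_def)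
  qed auto
  moreover have "{..<bp} \<union> {bp..<m} = {..<m}" "P \<union> ({..<m} - P) = {..<m}" using bpm P by auto
  ultimately have h: "bij_betw h {..<m} {..<m}" by simp
  have hP: "h i \<in> P \<longleftrightarrow> i < bp" if "i < m" for i
  proof (cases "i < bp")
    case True
    then show ?thesis using bij_betwE[OF f] by (simp add: h_def)
  next
    case False
    then show ?thesis using bij_betwE[OF g] that by (auto simp: h_def)
  qed
  have hm: "h i < m" if "i < m" for i using bij_betwE[OF h] that by auto
  define w where "w i = (\<lambda>l. 1 / sqrt (2 * \<bar>of_int (a (h i))\<bar>) * real_of_rat (v (h i) l))" for i
  have gw: "gram m G (w i) (w j) =
      1 / sqrt (2 * \<bar>of_int (a (h i))\<bar>) * (1 / sqrt (2 * \<bar>of_int (a (h j))\<bar>) * real_of_rat (gram m G (v (h i)) (v (h j))))" for i j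
    unfolding w_def by (simp only: gram_scale_left gram_scale_right gram_of_rat)
  have "gram m G (w i) (w j) = (if i \<noteq> j then 0 else if i < bp then 1 else - 1)" if "i < m" "j < m" for i j
  proof (cases "i = j")
    case True
    have h0: "a (h i) \<noteq> 0" using a(2) hm that by blast
    have "gram m G (w i) (w i) = 2 * of_int (a (h i)) / (2 * \<bar>of_int (a (h i))\<bar>)"
      using a(1)[OF hm[OF that(1)]] h0 unfolding gw by (simp add: of_rat_mult abs_mult)
    also have "\<dots> = (if a (h i) > 0 then 1 else - 1)" using h0 by (auto simp: abs_if)
    also have "\<dots> = (if i < bp then 1 else - 1)"
      using hP[OF that(1)] hm[OF that(1)] by (simp add: P_def)
    finally show ?thesis using True by simp
  next
    case False
    then have "h i \<noteq> h j" using bij_betw_imp_inj_on[OF h] that by (auto dest: inj_onD)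
    then show ?thesis using v hm that False unfolding gw by (simp add: orth_family_def)
  qed
  then have "lattice_signature m G bp (m - bp)"
    unfolding lattice_signature_def using bpm by (intro conjI exI[of _ w] allI impI) simp_all
  then show ?thesis by blast
qed

section \<open>Milgram's formula\<close>

text \<open>The box represents (\<int>/N)^m, on which translations are permutations.\<close>

lemma sum_box_shift:
  fixes f :: "(nat \<Rightarrow> int) \<Rightarrow> 'b::comm_monoid_add"
  assumes N: "N > 0"
    and per: "\<And>y z. (\<And>k. k < m \<Longrightarrow> [y k = z k] (mod N)) \<Longrightarrow> f y = f z"
  shows "(\<Sum>y\<in>{..<m} \<rightarrow>\<^sub>E {0..<N}. f (\<lambda>k. y k + h k)) = (\<Sum>y\<in>{..<m} \<rightarrow>\<^sub>E {0..<N}. f y)"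
proof (rule sum.reindex_bij_witness[of _
      "\<lambda>y. \<lambda>k\<in>{..<m}. (y k - h k) mod N" "\<lambda>y. \<lambda>k\<in>{..<m}. (y k + h k) mod N"])
  fix y assume y: "y \<in> {..<m} \<rightarrow>\<^sub>E {0..<N}"
  have "y k mod N = y k" if "k < m" for k using y that by (auto simp: PiE_def Pi_def)
  then show "(\<lambda>k\<in>{..<m}. ((\<lambda>k\<in>{..<m}. (y k + h k) mod N) k - h k) mod N) = y"
    and "(\<lambda>k\<in>{..<m}. ((\<lambda>k\<in>{..<m}. (y k - h k) mod N) k + h k) mod N) = y"
    using y by (auto simp: fun_eq_iff mod_simps PiE_def extensional_def)
  show "(\<lambda>k\<in>{..<m}. (y k + h k) mod N) \<in> {..<m} \<rightarrow>\<^sub>E {0..<N}"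
    and "(\<lambda>k\<in>{..<m}. (y k - h k) mod N) \<in> {..<m} \<rightarrow>\<^sub>E {0..<N}"
    using N by auto
  show "f (\<lambda>k\<in>{..<m}. (y k + h k) mod N) = f (\<lambda>k. y k + h k)"
    by (rule per) (simp add: cong_def)
qed

text \<open>e(t^2/4a) has period 2|a| in t, so the sum consists of copies of \<open>gsum\<close>;
  conjugation treats a < 0.\<close>

lemma gauss_sum_multiple_period:
  fixes a :: int and N :: int
  assumes a: "a \<noteq> 0" and N: "N > 0" "2 * a dvd N"
  shows "\<exists>r>0. (\<Sum>t\<in>{0..<N}. er ((of_int t)\<^sup>2 / (4 * of_int a))) = of_real r * cis (of_int (sgn a) * (pi / 4))"
proof -
  define b where "b = nat \<bar>a\<bar>"
  have b: "b > 0" "int b = \<bar>a\<bar>" using a by (auto simp: b_def)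
  have "\<bar>2 * a\<bar> dvd N" using N(2) by (simp only: abs_dvd_iff)
  then have "2 * \<bar>a\<bar> dvd N" by (simp only: abs_mult abs_numeral)
  then have "int (2 * b) dvd N" using b by simp
  then obtain c' where c': "N = int (2 * b) * c'" ..
  have "c' > 0" using c' N b by (simp add: zero_less_mult_iff)
  define c where "c = nat c'"
  have c: "c > 0" "N = int (2 * b * c)" using c' \<open>c' > 0\<close> by (auto simp: c_def)
  have ph: "er ((of_int (int y))\<^sup>2 / (4 * of_int (int b))) = gphase b y" for y
    by (simp add: er_cis gphase_def of_rat_divide of_rat_mult of_rat_power)
  have per: "gphase b (u + 2 * b * t) = gphase b u" for u t
  proof -
    have "pi * (real (u + 2 * b * t))\<^sup>2 / (2 * real b) =
        pi * (real u)\<^sup>2 / (2 * real b) + 2 * pi * of_int (int (u * t + b * t\<^sup>2))"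
      using b(1) by (simp add: power2_eq_square field_simps)
    then show ?thesis
      by (simp only: gphase_def cis_mult[symmetric] cis_multiple_2pi Ints_of_int mult_1_right)
  qed
  have "(\<Sum>t\<in>{0..<N}. er ((of_int t)\<^sup>2 / (4 * of_int (int b)))) = (\<Sum>y<2*b*c. gphase b y)"
    unfolding c(2) by (rule sum.reindex_bij_witness[of _ int nat]) (auto simp: nat_less_iff ph[symmetric] simp del: of_nat_mult)
  also have "\<dots> = of_nat c * gsum b"
    unfolding sum_lessThan_mult_split[of _ "2 * b" c] per by (simp add: gsum_def sum_distrib_left)
  also have "\<dots> = of_real (real c * sqrt (2 * real b)) * cis (pi / 4)"
    using gsum_eq[OF b(1)] by simp
  finally have main: "(\<Sum>t\<in>{0..<N}. er ((of_int t)\<^sup>2 / (4 * of_int (int b)))) =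
    of_real (real c * sqrt (2 * real b)) * cis (pi / 4)" .
  have pos: "real c * sqrt (2 * real b) > 0" using b c by simp
  show ?thesis
  proof (cases "a > 0")
    case True
    then show ?thesis using main pos b by (intro exI[of _ "real c * sqrt (2 * real b)"]) simp
  next
    case False
    then have ab: "a = - int b" "a < 0" using a b by auto
    have "(\<Sum>t\<in>{0..<N}. er ((of_int t)\<^sup>2 / (4 * of_int a))) =
       cnj (\<Sum>t\<in>{0..<N}. er ((of_int t)\<^sup>2 / (4 * of_int (int b))))"
      by (simp add: ab er_minus[symmetric] cnj_sum)
    also have "\<dots> = of_real (real c * sqrt (2 * real b)) * cis (- (pi / 4))"
      unfolding main by (simp add: cis_cnj)
    finally show ?thesis using pos ab by (intro exI[of _ "real c * sqrt (2 * real b)"]) simp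
  qed
qed

section \<open>Lattice vectors, dual vectors and their Gauss sums\<close>

lemma lattice_gram_Ints:
  assumes "x \<in> lattice_vecs m" "y \<in> lattice_vecs m"
  shows "gram m G x y \<in> \<int>"
  using assms unfolding gram_def lattice_vecs_def by (auto intro!: Ints_sum Ints_mult)

lemma lattice_subset_dual: "lattice_vecs m \<subseteq> dual_vecs m G"
  using lattice_gram_Ints by (auto simp: dual_vecs_def lattice_vecs_def)

lemma lattice_vecs_add: "x \<in> lattice_vecs m \<Longrightarrow> y \<in> lattice_vecs m \<Longrightarrow> (\<lambda>i. x i + y i) \<in> lattice_vecs m"
  by (auto simp: lattice_vecs_def)

lemma lattice_vecs_minus: "x \<in> lattice_vecs m \<Longrightarrow> (\<lambda>i. - x i) \<in> lattice_vecs m"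
  by (auto simp: lattice_vecs_def)

lemma lattice_vecs_sum:
  assumes "\<And>k. k \<in> K \<Longrightarrow> v k \<in> lattice_vecs m" "\<And>k. k \<in> K \<Longrightarrow> c k \<in> \<int>"
  shows "(\<lambda>i. \<Sum>k\<in>K. c k * v k i) \<in> lattice_vecs m"
  using assms by (auto simp: lattice_vecs_def intro!: Ints_sum Ints_mult)

lemma dual_vecs_add: "x \<in> dual_vecs m G \<Longrightarrow> y \<in> dual_vecs m G \<Longrightarrow> (\<lambda>i. x i + y i) \<in> dual_vecs m G"
  by (auto simp: dual_vecs_def gram_add_left)

lemma dual_vecs_diff: "x \<in> dual_vecs m G \<Longrightarrow> y \<in> dual_vecs m G \<Longrightarrow> (\<lambda>i. x i - y i) \<in> dual_vecs m G"
  by (auto simp: dual_vecs_def gram_diff_left)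

text \<open>Milgram's formula up to a positive factor: the lattice contains an orthogonal sum \<open>M\<close> of rank
  one lattices; the Gauss sum of \<open>M'/M\<close> is a product of classical ones, and
  averaging over the isotropic subgroup \<open>L/M\<close> leaves a multiple of the Gauss sum of \<open>L'/L\<close>.\<close>

lemma milgram_up_to_factor:
  fixes q :: "'a::{finite,ab_group_add} \<Rightarrow> qmodz"
  assumes L: "even_lattice m G" and D: "has_discriminant_form m G q"
    and sig: "lattice_signature m G bp bm"
  shows "\<exists>r>0. (\<Sum>d\<in>UNIV. e_qmodz (q d)) = of_real r * cis (of_int (int bp - int bm) * (pi / 4))"
proof -
  have sym: "\<forall>i<m. \<forall>j<m. G i j = G j i"
    and ev: "\<And>x. x \<in> lattice_vecs m \<Longrightarrow> gram m G x x / 2 \<in> \<int>"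
    using L by (auto simp: even_lattice_def)
  obtain v :: "nat \<Rightarrow> nat \<Rightarrow> rat" and a :: "nat \<Rightarrow> int" where v: "orth_family m G m v"
    and vL: "\<And>k. k < m \<Longrightarrow> v k \<in> lattice_vecs m"
    and a: "\<And>k. k < m \<Longrightarrow> gram m G (v k) (v k) = 2 * of_int (a k)" "\<And>k. k < m \<Longrightarrow> a k \<noteq> 0"
    using even_lattice_orth_basis[OF L] by metis
  obtain \<phi> where
    phi_add: "\<And>x y. x \<in> dual_vecs m G \<Longrightarrow> y \<in> dual_vecs m G \<Longrightarrow> \<phi> (\<lambda>i. x i + y i) = \<phi> x + \<phi> y" and
    phi_surj: "\<phi> ` dual_vecs m G = (UNIV :: 'a set)" and
    phi_ker: "\<And>x. x \<in> dual_vecs m G \<Longrightarrow> \<phi> x = 0 \<longleftrightarrow> x \<in> lattice_vecs m" and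
    phi_q: "\<And>x. x \<in> dual_vecs m G \<Longrightarrow> q (\<phi> x) = qmodz_of_rat (gram m G x x / 2)"
    using D unfolding has_discriminant_form_def by blast
  note comm = gram_commute[OF sym]
  note L_dual = subsetD[OF lattice_subset_dual[of m G]]

  \<comment> \<open>Let M be spanned by the \<open>v k\<close>. As N is a multiple of every
    \<open>2 * a k\<close>, NM' lies in M and hence in L. The box \<open>B\<close> below represents
    M'/NM', which only multiplies the counts for M'/M by a positive factor.\<close>
  define N where "N = 2 * (\<Prod>k<m. \<bar>a k\<bar>)"
  have N: "N > 0" using a(2) by (auto simp: N_def intro!: prod_pos)
  have aN: "2 * a k dvd N" if "k < m" for k
  proof -
    have "\<bar>a k\<bar> dvd (\<Prod>k<m. \<bar>a k\<bar>)" using that by (intro dvd_prodI) auto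
    then show ?thesis unfolding N_def by (intro mult_dvd_mono) auto
  qed
  have aN': "of_int (N * j) / (2 * of_int (a k)) \<in> (\<int> :: rat set)" if k: "k < m" for k j
  proof -
    obtain c where "N = 2 * a k * c" using aN[OF k] ..
    then have "of_int (N * j) / (2 * of_int (a k)) = (of_int (c * j) :: rat)" using a(2)[OF k] by simp
    then show ?thesis by (metis Ints_of_int)
  qed
  \<comment> \<open>The vectors \<open>v k / (2 * a k)\<close> form the basis of M' dual to
    \<open>v\<close>, so \<open>y\<close> holds the coordinates of a vector of M'.\<close>
  define V :: "(nat \<Rightarrow> int) \<Rightarrow> nat \<Rightarrow> rat" where
    "V y = (\<lambda>i. \<Sum>k<m. (of_int (y k) / (2 * of_int (a k))) * v k i)" for y
  have V_add: "V (\<lambda>k. y k + z k) = (\<lambda>i. V y i + V z i)" for y z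
    by (simp add: V_def fun_eq_iff add_divide_distrib distrib_right sum.distrib)
  have V_0: "V y i = 0" if "i \<ge> m" for y i
    using vL that by (simp add: V_def lattice_vecs_def)
  have gram_V: "gram m G (V y) (V z) = (\<Sum>k<m. of_int (y k) * of_int (z k) / (2 * of_int (a k)))" for y z
    unfolding V_def by (subst orth_family_gram_sum_sum[OF v]) (auto intro!: sum.cong simp: a)
  have dual_V: "\<exists>y. x = V y" if x: "x \<in> dual_vecs m G" for x
  proof -
    have "\<exists>j. gram m G x (v k) = of_int j" if "k < m" for k
    proof -
      have "gram m G x (v k) \<in> \<int>" using x vL[OF that] by (auto simp: dual_vecs_def)
      then show ?thesis by (auto elim: Ints_cases)
    qed
    then obtain y where y: "\<And>k. k < m \<Longrightarrow> gram m G x (v k) = of_int (y k)" by metis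
    have "x i = V y i" for i
    proof (cases "i < m")
      case True
      have "x i = (\<Sum>k<m. gram m G x (v k) / gram m G (v k) (v k) * v k i)"
        by (rule orth_family_expand[OF v True])
      also have "\<dots> = V y i" unfolding V_def by (intro sum.cong) (auto simp: y a)
      finally show ?thesis .
    next
      case False
      then show ?thesis using x V_0 by (simp add: dual_vecs_def)
    qed
    then show ?thesis by blast
  qed
  have V_period: "\<exists>j. V y = (\<lambda>i. V z i + V (\<lambda>k. N * j k) i)"
    if yz: "\<And>k. k < m \<Longrightarrow> [y k = z k] (mod N)" for y z
  proof -
    have "\<exists>j. y k = z k + N * j" if "k < m" for k
      using yz[OF that] by (metis cong_iff_lin cong_sym)
    then obtain j where "\<And>k. k < m \<Longrightarrow> y k = z k + N * j k" by metis
    then have "V y = V (\<lambda>k. z k + N * j k)" by (auto simp: V_def intro!: sum.cong ext)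
    then show ?thesis using V_add by auto
  qed
  have V_N: "V (\<lambda>k. N * j k) \<in> lattice_vecs m" for j
    unfolding V_def using aN' vL by (intro lattice_vecs_sum) auto
  have gram_V_N: "gram m G (V y) (V (\<lambda>k. N * j k)) \<in> \<int>" for y j
  proof -
    have "of_int (y k) * of_int (N * j k) / (2 * of_int (a k)) \<in> (\<int> :: rat set)" if "k < m" for k
      using aN'[OF that, of "j k"] Ints_mult[OF Ints_of_int[of "y k"]] by (metis times_divide_eq_right)
    then show ?thesis unfolding gram_V by (intro Ints_sum) auto
  qed
  define F where "F y = er (gram m G (V y) (V y) / 2)" for y
  have F_shift: "F (\<lambda>k. y k + h k) = F y * er (gram m G (V y) (V h))" if h: "V h \<in> lattice_vecs m" for y h
  proof -
    have "gram m G (\<lambda>i. V y i + V h i) (\<lambda>i. V y i + V h i) / 2 =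
        gram m G (V y) (V y) / 2 + gram m G (V y) (V h) + gram m G (V h) (V h) / 2"
      using comm[of "V h" "V y"] by (simp add: gram_add_left gram_add_right add_divide_distrib)
    then show ?thesis
      unfolding F_def V_add by (simp only: er_add er_Ints[OF ev[OF h]] mult_1_right)
  qed
  have F_per: "F y = F z" if yz: "\<And>k. k < m \<Longrightarrow> [y k = z k] (mod N)" for y z
  proof -
    obtain j where j: "V y = (\<lambda>i. V z i + V (\<lambda>k. N * j k) i)" using V_period[of y z] yz by blast
    have "F y = F (\<lambda>k. z k + N * j k)" unfolding F_def V_add j ..
    also have "\<dots> = F z" using F_shift[OF V_N] er_Ints[OF gram_V_N] by simp
    finally show ?thesis .
  qed
  define B where "B = {..<m} \<rightarrow>\<^sub>E {0..<N}"
  have finB: "finite B" by (auto simp: B_def intro!: finite_PiE)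
  note shift = sum_box_shift[OF N, where m = m, folded B_def]
  have L_per: "V y \<in> lattice_vecs m \<longleftrightarrow> V z \<in> lattice_vecs m"
    if yz: "\<And>k. k < m \<Longrightarrow> [y k = z k] (mod N)" for y z
  proof -
    have *: "V y \<in> lattice_vecs m" if "V z \<in> lattice_vecs m" "\<And>k. k < m \<Longrightarrow> [y k = z k] (mod N)" for y z
      using V_period[of y z] that(2) lattice_vecs_add[OF that(1) V_N] by auto
    show ?thesis using *[of y z] *[of z y] yz by (auto simp: cong_sym_eq)
  qed
  \<comment> \<open>Representatives of L/NM', the group over which the sum is averaged.\<close>
  define H where "H = {y \<in> B. V y \<in> lattice_vecs m}"
  have finH: "finite H" using finB by (simp add: H_def)
  have H_pos: "card H > 0"
  proof -
    have "V (\<lambda>k\<in>{..<m}. 0) = (\<lambda>i. 0)" by (simp add: V_def)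
    then have "(\<lambda>k\<in>{..<m}. 0) \<in> H" using N by (auto simp: H_def B_def lattice_vecs_def)
    then show ?thesis using finH card_gt_0_iff by blast
  qed
  have sumH: "(\<Sum>h\<in>H. g h) = (\<Sum>h\<in>B. if V h \<in> lattice_vecs m then g h else 0)" for g :: "_ \<Rightarrow> complex"
    unfolding H_def by (rule sum.inter_filter[OF finB])
  \<comment> \<open>Orthogonality of characters on L/NM': the sum survives exactly when
    \<open>V y\<close> pairs integrally with L, that is, lies in L'. Otherwise shifting by a vector
    \<open>l\<close> of L with nonintegral pairing multiplies the sum by a number other than
    1.\<close>
  have char: "(\<Sum>h\<in>H. er (gram m G (V y) (V h))) = (if V y \<in> dual_vecs m G then of_nat (card H) else 0)" for y
  proof (cases "V y \<in> dual_vecs m G")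
    case True
    then have "er (gram m G (V y) (V h)) = 1" if "h \<in> H" for h
      using that by (intro er_Ints) (auto simp: dual_vecs_def H_def)
    then show ?thesis using True by simp
  next
    case False
    then obtain l where l: "l \<in> lattice_vecs m" "gram m G (V y) l \<notin> \<int>"
      using V_0 by (auto simp: dual_vecs_def)
    obtain h0 where h0: "l = V h0" using dual_V L_dual l(1) by blast
    define f where "f h = (if V h \<in> lattice_vecs m then er (gram m G (V y) (V h)) else 0)" for h
    have f_per: "f h = f h'" if hh: "\<And>k. k < m \<Longrightarrow> [h k = h' k] (mod N)" for h h'
    proof -
      obtain j where "V h = (\<lambda>i. V h' i + V (\<lambda>k. N * j k) i)" using V_period[of h h'] hh by blast
      then have "er (gram m G (V y) (V h)) = er (gram m G (V y) (V h'))"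
        using gram_V_N by (simp add: gram_add_right er_add er_Ints)
      then show ?thesis using L_per[of h h'] hh by (simp add: f_def)
    qed
    have f_add: "f (\<lambda>k. h k + h0 k) = er (gram m G (V y) l) * f h" for h
    proof -
      have "(\<lambda>i. V h i + l i) \<in> lattice_vecs m \<longleftrightarrow> V h \<in> lattice_vecs m"
        using lattice_vecs_add[OF _ l(1), of "V h"]
          lattice_vecs_add[OF _ lattice_vecs_minus[OF l(1)], of "\<lambda>i. V h i + l i"] by auto
      then show ?thesis by (simp add: f_def V_add h0[symmetric] gram_add_right er_add)
    qed
    have "(\<Sum>h\<in>B. f h) = (\<Sum>h\<in>B. f (\<lambda>k. h k + h0 k))"
      by (rule shift[symmetric]) (rule f_per)
    also have "\<dots> = er (gram m G (V y) l) * (\<Sum>h\<in>B. f h)"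
      by (simp add: f_add sum_distrib_left)
    finally have "(1 - er (gram m G (V y) l)) * (\<Sum>h\<in>B. f h) = 0" by (simp add: algebra_simps)
    then have "(\<Sum>h\<in>B. f h) = 0" using l(2) er_eq_1_iff by auto
    then show ?thesis using False by (simp add: sumH f_def)
  qed
  have "of_nat (card H) * (\<Sum>y\<in>B. F y) = (\<Sum>h\<in>H. \<Sum>y\<in>B. F (\<lambda>k. y k + h k))"
    using shift[of F, OF F_per] by simp
  also have "\<dots> = (\<Sum>h\<in>H. \<Sum>y\<in>B. F y * er (gram m G (V y) (V h)))"
    by (intro sum.cong refl F_shift) (auto simp: H_def)
  also have "\<dots> = (\<Sum>y\<in>B. F y * (\<Sum>h\<in>H. er (gram m G (V y) (V h))))"
    by (subst sum.swap) (simp add: sum_distrib_left)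
  also have "\<dots> = of_nat (card H) * (\<Sum>y\<in>B. if V y \<in> dual_vecs m G then F y else 0)"
    unfolding char by (auto simp: sum_distrib_left intro!: sum.cong)
  finally have step1: "(\<Sum>y\<in>B. F y) = (\<Sum>y\<in>B. if V y \<in> dual_vecs m G then F y else 0)"
    using H_pos by simp
  \<comment> \<open>The indicator of the fibre of \<phi> over \<open>d\<close>. It is a translate of
    the fibre over 0, which is L, so every fibre meets \<open>B\<close> in \<open>card H\<close>
    points.\<close>
  define f where "f d y = (if V y \<in> dual_vecs m G \<and> \<phi> (V y) = d then 1 else 0 :: complex)" for d y
  have dual_add_iff: "(\<lambda>i. x i + z i) \<in> dual_vecs m G \<longleftrightarrow> x \<in> dual_vecs m G" if "z \<in> dual_vecs m G" for x z
    using dual_vecs_add[OF _ that, of x] dual_vecs_diff[OF _ that, of "\<lambda>i. x i + z i"] by auto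
  have f_per: "f d y = f d z" if yz: "\<And>k. k < m \<Longrightarrow> [y k = z k] (mod N)" for d y z
  proof -
    obtain j where j: "V y = (\<lambda>i. V z i + V (\<lambda>k. N * j k) i)" using V_period[of y z] yz by blast
    have d: "V (\<lambda>k. N * j k) \<in> dual_vecs m G" by (rule L_dual[OF V_N])
    then have "\<phi> (V (\<lambda>k. N * j k)) = 0" using phi_ker V_N by blast
    then show ?thesis using dual_add_iff[OF d] phi_add[OF _ d] by (auto simp: f_def j)
  qed
  have f_sum: "(\<Sum>y\<in>B. f d y) = of_nat (card H)" for d
  proof -
    obtain x where x: "x \<in> dual_vecs m G" "\<phi> x = d" using phi_surj by (metis UNIV_I imageE)
    obtain y0 where y0: "x = V y0" using dual_V[OF x(1)] by blast
    have "(\<Sum>y\<in>B. f d y) = (\<Sum>y\<in>B. f d (\<lambda>k. y k + y0 k))"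
      by (rule shift[symmetric]) (rule f_per)
    also have "\<dots> = (\<Sum>y\<in>B. if V y \<in> lattice_vecs m then 1 else 0)"
    proof (rule sum.cong)
      fix y
      show "f d (\<lambda>k. y k + y0 k) = (if V y \<in> lattice_vecs m then 1 else 0)"
        using dual_add_iff[OF x(1), of "V y"] phi_add[OF _ x(1), of "V y"] phi_ker[of "V y"] L_dual[of "V y"] x(2)
        by (auto simp: f_def V_add y0[symmetric])
    qed simp
    also have "\<dots> = of_nat (card H)" by (simp add: sumH[symmetric])
    finally show ?thesis .
  qed
  have "(\<Sum>y\<in>B. if V y \<in> dual_vecs m G then F y else 0) = (\<Sum>y\<in>B. \<Sum>d\<in>UNIV. f d y * e_qmodz (q d))"
  proof (rule sum.cong)
    fix y
    show "(if V y \<in> dual_vecs m G then F y else 0) = (\<Sum>d\<in>UNIV. f d y * e_qmodz (q d))"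
    proof (cases "V y \<in> dual_vecs m G")
      case True
      have "(\<Sum>d\<in>UNIV. f d y * e_qmodz (q d)) = (\<Sum>d\<in>{\<phi> (V y)}. f d y * e_qmodz (q d))"
        by (rule sum.mono_neutral_right) (auto simp: f_def)
      then show ?thesis using True by (simp add: f_def phi_q F_def er_def)
    qed (simp add: f_def)
  qed simp
  also have "\<dots> = of_nat (card H) * (\<Sum>d\<in>UNIV. e_qmodz (q d))"
    by (subst sum.swap) (simp add: sum_distrib_right[symmetric] f_sum sum_distrib_left)
  finally have step2: "(\<Sum>y\<in>B. F y) = of_nat (card H) * (\<Sum>d\<in>UNIV. e_qmodz (q d))"
    using step1 by simp
  have F_prod: "F y = (\<Prod>k<m. er ((of_int (y k))\<^sup>2 / (4 * of_int (a k))))" for y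
    unfolding F_def gram_V er_sum[symmetric] by (simp add: sum_divide_distrib power2_eq_square)
  have "\<exists>r>0. (\<Sum>t\<in>{0..<N}. er ((of_int t)\<^sup>2 / (4 * of_int (a k)))) = of_real r * cis (of_int (sgn (a k)) * (pi / 4))"
    if "k < m" for k
    using gauss_sum_multiple_period[OF a(2)[OF that] N aN[OF that]] .
  then obtain r where r: "\<And>k. k < m \<Longrightarrow> r k > (0::real)"
    "\<And>k. k < m \<Longrightarrow> (\<Sum>t\<in>{0..<N}. er ((of_int t)\<^sup>2 / (4 * of_int (a k)))) = of_real (r k) * cis (of_int (sgn (a k)) * (pi / 4))"
    by metis
  have "(\<Sum>y\<in>B. F y) = (\<Prod>k<m. \<Sum>t\<in>{0..<N}. er ((of_int t)\<^sup>2 / (4 * of_int (a k))))"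
    unfolding F_prod B_def by (rule prod_sum_PiE[symmetric]) auto
  also have "\<dots> = (\<Prod>k<m. of_real (r k) * cis (of_int (sgn (a k)) * (pi / 4)))"
    by (rule prod.cong) (auto simp: r(2))
  also have "\<dots> = of_real (\<Prod>k<m. r k) * cis (\<Sum>k<m. of_int (sgn (a k)) * (pi / 4))"
    by (simp add: prod.distrib cis_conv_exp exp_sum sum_distrib_left)
  also have "(\<Sum>k<m. of_int (sgn (a k)) * (pi / 4)) = of_int (int bp - int bm) * (pi / 4)"
  proof -
    let ?P = "{k. k < m \<and> a k > 0}"
    have "(\<Sum>k<m. sgn (a k)) = (\<Sum>k\<in>?P. sgn (a k)) + (\<Sum>k\<in>{..<m} - ?P. sgn (a k))"
      by (subst sum.subset_diff[of ?P]) auto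
    also have "(\<Sum>k\<in>?P. sgn (a k)) = int (card ?P)" by simp
    also have "(\<Sum>k\<in>{..<m} - ?P. sgn (a k)) = (\<Sum>k\<in>{..<m} - ?P. - 1)"
    proof (rule sum.cong)
      fix k assume "k \<in> {..<m} - ?P"
      then have "a k < 0" using a(2)[of k] by auto
      then show "sgn (a k) = - 1" by simp
    qed simp
    also have "\<dots> = - int (card ({..<m} - ?P))" by simp
    also have "card ({..<m} - ?P) = m - card ?P"
      by (subst card_Diff_subset) auto
    also have "card ?P = bp" by (rule signature_card_pos[OF sym sig v a(1)])
    also have "int bp + - int (m - bp) = int bp - int bm"
      using sig by (auto simp: lattice_signature_def)
    finally have "(\<Sum>k<m. of_int (sgn (a k))) = (of_int (int bp - int bm) :: real)"
      by (simp only: of_int_sum[symmetric])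
    then show ?thesis by (simp only: sum_distrib_right[symmetric])
  qed
  finally have "(\<Sum>y\<in>B. F y) = of_real (\<Prod>k<m. r k) * cis (of_int (int bp - int bm) * (pi / 4))" .
  with step2 have "(\<Sum>d\<in>UNIV. e_qmodz (q d)) =
      of_real ((\<Prod>k<m. r k) / real (card H)) * cis (of_int (int bp - int bm) * (pi / 4))"
    using H_pos by (simp add: field_simps)
  moreover have "(\<Prod>k<m. r k) / real (card H) > 0" using r(1) H_pos by (auto intro!: prod_pos divide_pos_pos)
  ultimately show ?thesis by blast
qed

text \<open>The modulus, known independently, determines the positive factor.\<close>

theorem milgram:
  fixes q :: "'a::{finite,ab_group_add} \<Rightarrow> qmodz"
  assumes "even_lattice m G" "has_discriminant_form m G q" "lattice_signature m G bp bm"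
    and norm: "norm (\<Sum>d\<in>UNIV. e_qmodz (q d)) = sqrt (real CARD('a))"
  shows "(\<Sum>d\<in>UNIV. e_qmodz (q d)) = of_real (sqrt (real CARD('a))) * cis (of_int (int bp - int bm) * (pi / 4))"
proof -
  obtain r where r: "r > 0" "(\<Sum>d\<in>UNIV. e_qmodz (q d)) = of_real r * cis (of_int (int bp - int bm) * (pi / 4))"
    using milgram_up_to_factor[OF assms(1-3)] by blast
  then have "r = sqrt (real CARD('a))" using norm by (simp add: norm_mult)
  with r(2) show ?thesis by simp
qed

section \<open>Lattices with prescribed discriminant form\<close>

text \<open>Bordering a lattice by a vector \<open>e\<^sub>m\<close> of norm \<open>b\<close> that pairs with the old lattice like the
  dual vector \<open>u\<close>. If \<open>u\<close> has norm \<open>r/s\<close>, then \<open>e\<^sub>m - u\<close> is orthogonal to the old lattice with norm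
  \<open>b - r/s\<close>, so the new dual vector has norm \<open>s/(bs - r)\<close>: iterating this runs a continued
  fraction with even partial quotients backwards.\<close>

definition bordered :: "nat \<Rightarrow> (nat \<Rightarrow> nat \<Rightarrow> int) \<Rightarrow> (nat \<Rightarrow> int) \<Rightarrow> int \<Rightarrow> nat \<Rightarrow> nat \<Rightarrow> int" where
  "bordered m G \<beta> b i j =
     (if i < m then (if j < m then G i j else \<beta> i) else (if j < m then \<beta> j else b))"

text \<open>The entries \<beta> are the pairings of \<open>u\<close> with the unit vectors, so the
  new basis vector pairs with old vectors as \<open>u\<close> does; this gives the two mixed
  terms.\<close>

lemma gram_bordered:
  fixes x y :: "nat \<Rightarrow> rat"
  assumes sym: "\<forall>i<m. \<forall>j<m. G i j = G j i"
    and \<beta>: "\<And>j. j < m \<Longrightarrow> of_int (\<beta> j) = gram m G u (\<lambda>i. if i = j then 1 else 0)"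
  shows "gram (Suc m) (bordered m G \<beta> b) x y =
    gram m G x y + x m * gram m G u y + gram m G x u * y m + x m * of_int b * y m"
proof -
  have bu: "of_int (\<beta> j) = (\<Sum>i<m. u i * of_int (G i j))" if "j < m" for j
  proof -
    have "of_int (\<beta> j) = (\<Sum>i<m. \<Sum>l<m. u i * of_int (G i l) * (if l = j then 1 else 0))"
      using \<beta>[OF that] by (simp add: gram_def)
    also have "\<dots> = (\<Sum>i<m. u i * of_int (G i j))"
      using that by (intro sum.cong) (auto simp: if_distrib[of "(*) _"] cong: if_cong)
    finally show ?thesis .
  qed
  have bz: "(\<Sum>j<m. of_int (\<beta> j) * z j) = gram m G u z" for z :: "nat \<Rightarrow> rat"
    unfolding gram_def by (subst sum.swap) (simp add: bu sum_distrib_right)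
  have "gram (Suc m) (bordered m G \<beta> b) x y =
     (\<Sum>i<m. (\<Sum>j<m. x i * of_int (G i j) * y j) + x i * of_int (\<beta> i) * y m)
      + ((\<Sum>j<m. x m * of_int (\<beta> j) * y j) + x m * of_int b * y m)"
    by (simp add: gram_def bordered_def)
  also have "(\<Sum>i<m. (\<Sum>j<m. x i * of_int (G i j) * y j) + x i * of_int (\<beta> i) * y m) =
     gram m G x y + (\<Sum>i<m. of_int (\<beta> i) * x i) * y m"
    by (simp add: sum.distrib gram_def sum_distrib_right sum_distrib_left mult_ac)
  also have "(\<Sum>j<m. x m * of_int (\<beta> j) * y j) = x m * (\<Sum>j<m. of_int (\<beta> j) * y j)"
    by (simp add: sum_distrib_left mult_ac)
  finally show ?thesis by (simp add: bz gram_commute[OF sym, of u x])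
qed

text \<open>The class of \<open>w i\<close> in L'/L is to become the generator \<open>g i\<close>:
  norm 2a/p means q = a/p. That these classes generate L'/L is stated separately, because along a
  chain one further generator is present.\<close>

definition orth_realization ::
    "nat \<Rightarrow> (nat \<Rightarrow> int) \<Rightarrow> nat \<Rightarrow> nat \<Rightarrow> (nat \<Rightarrow> nat \<Rightarrow> int) \<Rightarrow> (nat \<Rightarrow> nat \<Rightarrow> rat) \<Rightarrow> bool" where
  "orth_realization p a n m G w \<longleftrightarrow>
     even_lattice m G \<and>
     (\<forall>i<n. w i \<in> dual_vecs m G \<and> (\<lambda>l. of_nat p * w i l) \<in> lattice_vecs m \<and>
            gram m G (w i) (w i) = 2 * of_int (a i) / of_nat p) \<and>
     (\<forall>i<n. \<forall>j<n. i \<noteq> j \<longrightarrow> gram m G (w i) (w j) = 0)"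

text \<open>An intermediate stage: L'/L is generated by the \<open>w j\<close> and the class of one
  more vector \<open>u\<close>, orthogonal to them, of norm r/s and with multiple s u in L. For r =
  2a and s = p this vector is the next generator.\<close>

definition chain_state ::
    "nat \<Rightarrow> (nat \<Rightarrow> int) \<Rightarrow> nat \<Rightarrow> int \<Rightarrow> int \<Rightarrow> nat \<Rightarrow> (nat \<Rightarrow> nat \<Rightarrow> int) \<Rightarrow> (nat \<Rightarrow> nat \<Rightarrow> rat) \<Rightarrow> (nat \<Rightarrow> rat) \<Rightarrow> bool" where
  "chain_state p a n r s m G w u \<longleftrightarrow>
     orth_realization p a n m G w \<and> u \<in> dual_vecs m G \<and> (\<forall>i<n. gram m G (w i) u = 0) \<and>
     of_int s * gram m G u u = of_int r \<and> (\<lambda>l. of_int s * u l) \<in> lattice_vecs m \<and>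
     (\<forall>x\<in>dual_vecs m G. \<exists>(c :: nat \<Rightarrow> int) (k :: int).
        (\<lambda>l. x l - (\<Sum>j<n. of_int (c j) * w j l) - of_int k * u l) \<in> lattice_vecs m)"

lemma chain_state_step:
  assumes st: "chain_state p a n r s m G w u" and s: "s \<noteq> 0" and b: "even b" and t: "t = b * s - r" "t \<noteq> 0"
  shows "\<exists>m' G' u'. chain_state p a n s t m' G' w u'"
proof -
  have re: "orth_realization p a n m G w" and u: "u \<in> dual_vecs m G"
    and wu: "\<And>i. i < n \<Longrightarrow> gram m G (w i) u = 0"
    and uu: "of_int s * gram m G u u = of_int r" and su: "(\<lambda>l. of_int s * u l) \<in> lattice_vecs m"
    and span: "\<And>x. x \<in> dual_vecs m G \<Longrightarrow> \<exists>(c :: nat \<Rightarrow> int) (k :: int).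
        (\<lambda>l. x l - (\<Sum>j<n. of_int (c j) * w j l) - of_int k * u l) \<in> lattice_vecs m"
    using st unfolding chain_state_def by blast+
  have L: "even_lattice m G"
    and w: "\<And>i. i < n \<Longrightarrow> w i \<in> dual_vecs m G" "\<And>i. i < n \<Longrightarrow> (\<lambda>l. of_nat p * w i l) \<in> lattice_vecs m"
      "\<And>i. i < n \<Longrightarrow> gram m G (w i) (w i) = 2 * of_int (a i) / of_nat p"
      "\<And>i j. i < n \<Longrightarrow> j < n \<Longrightarrow> i \<noteq> j \<Longrightarrow> gram m G (w i) (w j) = 0"
    using re unfolding orth_realization_def by blast+
  have sym: "\<forall>i<m. \<forall>j<m. G i j = G j i"
    and ev: "\<And>x. x \<in> lattice_vecs m \<Longrightarrow> \<exists>k::int. gram m G x x = 2 * of_int k"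
    and nondeg: "\<And>x::nat \<Rightarrow> rat. (\<And>y. gram m G x y = 0) \<Longrightarrow> (\<forall>i<m. x i = 0)"
    using L unfolding even_lattice_def by blast+
  have u_gram: "gram m G u l \<in> \<int>" if "l \<in> lattice_vecs m" for l
    using u that by (auto simp: dual_vecs_def)
  have u0: "u i = 0" if "i \<ge> m" for i using u that by (auto simp: dual_vecs_def)
  have w0: "w j i = 0" if "j < n" "i \<ge> m" for i j using w(1)[OF that(1)] that by (auto simp: dual_vecs_def)
  have "\<exists>k. gram m G u (\<lambda>i. if i = j then 1 else 0) = of_int k" if "j < m" for j
  proof -
    have "(\<lambda>i. if i = j then 1 else 0) \<in> lattice_vecs m" using that by (auto simp: lattice_vecs_def)
    then have "gram m G u (\<lambda>i. if i = j then 1 else 0) \<in> \<int>" by (rule u_gram)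
    then show ?thesis by (auto elim: Ints_cases)
  qed
  then obtain \<beta> where \<beta>: "\<And>j. j < m \<Longrightarrow> of_int (\<beta> j) = gram m G u (\<lambda>i. if i = j then 1 else 0)"
    by metis
  define G' where "G' = bordered m G \<beta> b"
  \<comment> \<open>Vectors of the old lattice must vanish from index m on, hence the
    truncation.\<close>
  define cut :: "(nat \<Rightarrow> rat) \<Rightarrow> nat \<Rightarrow> rat" where "cut x = (\<lambda>i. if i < m then x i else 0)" for x
  have cut_gram: "gram m G (cut x) y = gram m G x y" "gram m G y (cut x) = gram m G y x" for x y
    by (rule gram_cong; simp add: cut_def)+
  have cut_lat: "cut x \<in> lattice_vecs m" if "x \<in> lattice_vecs (Suc m)" for x
    using that by (auto simp: cut_def lattice_vecs_def)
  have lat_suc: "x \<in> lattice_vecs (Suc m)" if "x \<in> lattice_vecs m" for x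
    using that by (auto simp: lattice_vecs_def less_Suc_eq)
  have gram': "gram (Suc m) G' x y =
      gram m G x y + x m * gram m G u y + gram m G x u * y m + x m * of_int b * y m" for x y
    unfolding G'_def using gram_bordered[of m G \<beta> u b x y] sym \<beta> by blast
  note comm = gram_commute[OF sym]
  have sym': "\<forall>i<Suc m. \<forall>j<Suc m. G' i j = G' j i"
    using sym by (auto simp: G'_def bordered_def)
  note comm' = gram_commute[OF sym']
  let ?s = "of_int s :: rat" and ?t = "of_int t :: rat" and ?r = "of_int r :: rat" and ?b = "of_int b :: rat"
  have s0: "?s \<noteq> 0" and t0: "?t \<noteq> 0" using s t(2) by auto
  have uu': "gram m G u u = ?r / ?s" using uu s0 by (simp add: field_simps)
  have tb: "?t = ?b * ?s - ?r" using t(1) by simp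
  \<comment> \<open>This is (s/t)(e_m - u), where e_m is the new basis vector. It pairs with any
    vector y to the coordinate \<open>y m\<close>.\<close>
  define u' where "u' = (\<lambda>i. if i = m then ?s / ?t else - (?s / ?t) * u i)"
  have gu'm: "gram m G u' y = - (?s / ?t) * gram m G u y" for y
  proof -
    have "gram m G u' y = gram m G (\<lambda>i. - (?s / ?t) * u i) y" by (rule gram_cong) (auto simp: u'_def)
    then show ?thesis by (simp only: gram_scale_left)
  qed
  have gu': "gram (Suc m) G' u' y = y m" for y
  proof -
    have "gram (Suc m) G' u' y = (?s / ?t) * (?b - ?r / ?s) * y m"
      unfolding gram' gu'm uu' by (simp add: u'_def algebra_simps)
    also have "(?s / ?t) * (?b - ?r / ?s) = 1"
    proof -
      have "?b - ?r / ?s = ?t / ?s" using s0 tb by (simp add: field_simps)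
      then show ?thesis using s0 t0 by simp
    qed
    finally show ?thesis by simp
  qed
  have ev': "\<exists>k::int. gram (Suc m) G' x x = 2 * of_int k" if x: "x \<in> lattice_vecs (Suc m)" for x
  proof -
    have "x m \<in> \<int>" using x by (auto simp: lattice_vecs_def)
    then obtain z where z: "x m = of_int z" by (auto elim: Ints_cases)
    obtain k where k: "gram m G x x = 2 * of_int k"
      using ev[OF cut_lat[OF x]] by (auto simp: cut_gram)
    have "gram m G u (cut x) \<in> \<int>" by (rule u_gram[OF cut_lat[OF x]])
    then obtain j where j: "gram m G u x = of_int j" by (auto simp: cut_gram elim: Ints_cases)
    obtain b' where b': "b = 2 * b'" using b ..
    have "gram (Suc m) G' x x = 2 * of_int (k + z * j + z * b' * z)"
      unfolding gram' using k j comm[of x u] by (simp add: z b' algebra_simps)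
    then show ?thesis by blast
  qed
  have nondeg': "\<forall>i<Suc m. x i = 0" if x: "\<And>y. gram (Suc m) G' x y = 0" for x :: "nat \<Rightarrow> rat"
  proof -
    have xm: "x m = 0" using x[of u'] gu'[of x] comm'[of x u'] by simp
    have "gram m G x y = 0" for y
      using x[of "cut y"] xm by (simp add: gram' cut_gram) (simp add: cut_def)
    then have "\<forall>i<m. x i = 0" by (rule nondeg)
    then show ?thesis using xm by (auto simp: less_Suc_eq)
  qed
  have L': "even_lattice (Suc m) G'"
    unfolding even_lattice_def using sym' ev' nondeg' by blast
  have old_gram: "gram (Suc m) G' x y = gram m G x y + gram m G x u * y m" if "x m = 0" for x y
    using that by (simp add: gram')
  have w': "w i \<in> dual_vecs (Suc m) G'" if i: "i < n" for i
  proof -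
    have "gram (Suc m) G' (w i) y \<in> \<int>" if y: "y \<in> lattice_vecs (Suc m)" for y
    proof -
      have "gram m G (w i) (cut y) \<in> \<int>" using w(1)[OF i] cut_lat[OF y] by (auto simp: dual_vecs_def)
      then show ?thesis using w0[OF i] wu[OF i] by (simp add: old_gram cut_gram)
    qed
    then show ?thesis using w0[OF i] by (auto simp: dual_vecs_def)
  qed
  have re': "orth_realization p a n (Suc m) G' w"
    unfolding orth_realization_def
    using L' w' w lat_suc[OF w(2)] w0 wu by (simp add: old_gram)
  have "u' \<in> dual_vecs (Suc m) G'"
    using u0 by (auto simp: dual_vecs_def gu' lattice_vecs_def) (simp add: u'_def)
  moreover have "gram (Suc m) G' (w i) u' = 0" if "i < n" for i
    using gu'[of "w i"] w0[OF that, of m] comm'[of "w i" u'] by simp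
  moreover have "?t * gram (Suc m) G' u' u' = ?s"
    using t0 by (simp add: gu') (simp add: u'_def)
  moreover have "(\<lambda>l. ?t * u' l) \<in> lattice_vecs (Suc m)"
  proof -
    have "?t * u' l = (if l = m then ?s else - (?s * u l))" for l
      using t0 by (simp add: u'_def)
    then show ?thesis using su u0 by (auto simp: lattice_vecs_def less_Suc_eq)
  qed
  moreover have "\<exists>(c :: nat \<Rightarrow> int) (k :: int).
      (\<lambda>l. x l - (\<Sum>j<n. of_int (c j) * w j l) - of_int k * u' l) \<in> lattice_vecs (Suc m)"
    if x: "x \<in> dual_vecs (Suc m) G'" for x
  proof -
    \<comment> \<open>The component of \<open>x\<close> in the old space: x = y + x_m (e_m -
      u).\<close>
    define y where "y = (\<lambda>i. if i < m then x i + x m * u i else 0)"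
    have gy: "gram m G y z = gram m G x z + x m * gram m G u z" for z
    proof -
      have "gram m G y z = gram m G (\<lambda>i. x i + x m * u i) z" by (rule gram_cong) (auto simp: y_def)
      then show ?thesis by (simp only: gram_add_left gram_scale_left)
    qed
    have "y \<in> dual_vecs m G"
    proof -
      have "gram m G y l \<in> \<int>" if l: "l \<in> lattice_vecs m" for l
      proof -
        have "l m = 0" using l by (auto simp: lattice_vecs_def)
        then have "gram m G y l = gram (Suc m) G' x l" by (simp add: gy gram')
        then show ?thesis using x lat_suc[OF l] by (auto simp: dual_vecs_def)
      qed
      then show ?thesis by (auto simp: dual_vecs_def y_def)
    qed
    then obtain c :: "nat \<Rightarrow> int" and k :: int where
      ck: "(\<lambda>l. y l - (\<Sum>j<n. of_int (c j) * w j l) - of_int k * u l) \<in> lattice_vecs m"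
      using span by blast
    define l where "l = (\<lambda>i. y i - (\<Sum>j<n. of_int (c j) * w j i) - of_int k * u i)"
    have l: "l \<in> lattice_vecs m" using ck by (simp add: l_def)
    have ly: "y = (\<lambda>i. l i + (\<Sum>j<n. of_int (c j) * w j i) + of_int k * u i)" by (simp add: l_def)
    have "gram m G y u = gram m G l u + of_int k * (?r / ?s)"
      unfolding ly gram_add_left gram_sum_left gram_scale_left using wu uu' by simp
    then have yu: "gram m G x u + x m * (?r / ?s) = gram m G l u + of_int k * (?r / ?s)"
      using gy[of u] uu' by simp
    have "(\<lambda>i. if i = m then 1 else 0) \<in> lattice_vecs (Suc m)" by (auto simp: lattice_vecs_def)
    then have "gram (Suc m) G' x (\<lambda>i. if i = m then 1 else 0) \<in> \<int>" using x by (auto simp: dual_vecs_def)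
    moreover have "gram m G z (\<lambda>i. if i = m then 1 else 0) = 0" for z :: "nat \<Rightarrow> rat"
      using gram_cong[of m z z "\<lambda>i. if i = m then 1 else 0" "\<lambda>i. 0" G] by simp
    ultimately have "gram m G x u + x m * ?b \<in> \<int>" by (simp add: gram')
    moreover have "gram m G l u \<in> \<int>" using u_gram[OF l] comm[of l u] by simp
    ultimately have "gram m G x u + x m * ?b - gram m G l u \<in> \<int>" by (rule Ints_diff)
    then obtain J where J: "gram m G x u + x m * ?b - gram m G l u = of_int J" by (auto elim: Ints_cases)
    \<comment> \<open>Modulo the old lattice and the \<open>w j\<close>, the vector x is k e_m +
      (x_m - k)(e_m - u). The pairing of x with e_m is integral, which makes x_m - k an integral
      multiple K s/t, so the second term is K u'.\<close>
    define K where "K = J - k * b"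
    have "of_int J = x m * ?b + of_int k * (?r / ?s) - x m * (?r / ?s)" using J yu by simp
    then have "of_int J * ?s = (x m * ?b + of_int k * (?r / ?s) - x m * (?r / ?s)) * ?s" by simp
    also have "\<dots> = x m * ?t + of_int k * ?r"
      using s0 unfolding tb by (simp add: field_simps)
    finally have "of_int J * ?s = x m * ?t + of_int k * ?r" .
    then have "of_int K * ?s = (x m - of_int k) * ?t"
      unfolding K_def tb by (simp add: algebra_simps)
    then have K: "of_int K * (?s / ?t) = x m - of_int k" using t0 by (simp add: field_simps)
    have "(\<lambda>i. x i - (\<Sum>j<n. of_int (c j) * w j i) - of_int K * u' i) = (\<lambda>i. if i = m then of_int k else l i)"
    proof
      fix i
      consider "i < m" | "i = m" | "i > m" by linarith
      then show "x i - (\<Sum>j<n. of_int (c j) * w j i) - of_int K * u' i = (if i = m then of_int k else l i)"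
      proof cases
        case 1
        have "of_int K * u' i = - ((of_int K * (?s / ?t)) * u i)" using 1 by (simp add: u'_def)
        also have "\<dots> = - ((x m - of_int k) * u i)" unfolding K ..
        finally show ?thesis using 1 by (simp add: l_def y_def algebra_simps)
      next
        case 2
        have "of_int K * u' i = x m - of_int k" using 2 K by (simp add: u'_def)
        moreover have "(\<Sum>j<n. of_int (c j) * w j i) = 0" using w0 2 by simp
        ultimately show ?thesis using 2 by simp
      next
        case 3
        then have "x i = 0" "u i = 0" "(\<Sum>j<n. of_int (c j) * w j i) = 0" "l i = 0"
          using x u0 w0 l by (auto simp: dual_vecs_def lattice_vecs_def)
        then show ?thesis using 3 by (simp add: u'_def)
      qed
    qed
    also have "\<dots> \<in> lattice_vecs (Suc m)" using l by (auto simp: lattice_vecs_def less_Suc_eq)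
    finally show ?thesis by blast
  qed
  ultimately have "chain_state p a n s t (Suc m) G' w u'"
    unfolding chain_state_def using re' by blast
  then show ?thesis by blast
qed

text \<open>The remainder of s modulo 2|r| is at distance less than |r| from 0 or from 2|r|, unless
  it is |r| itself. In that case |r| divides s, so |r| = 1 by coprimality, and both numbers are
  odd.\<close>

lemma even_quotient:
  fixes r s :: int
  assumes "coprime r s" "even (r * s)" "r \<noteq> 0"
  obtains b where "even b" "\<bar>b * r - s\<bar> < \<bar>r\<bar>"
proof -
  define k where "k = 2 * \<bar>r\<bar>"
  define \<rho> where "\<rho> = s mod k"
  have k: "k > 0" using assms by (simp add: k_def)
  have \<rho>: "0 \<le> \<rho>" "\<rho> < k" using k by (auto simp: \<rho>_def)
  have s: "s = k * (s div k) + \<rho>" by (simp add: \<rho>_def)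
  have br: "(2 * sgn r * d) * r = k * d" for d
    by (simp add: k_def abs_sgn mult_ac)
  have "\<rho> \<noteq> \<bar>r\<bar>"
  proof
    assume r: "\<rho> = \<bar>r\<bar>"
    then have "\<bar>r\<bar> dvd s" using s by (metis dvd_add dvd_mult2 dvd_refl dvd_triv_right k_def)
    then have "\<bar>r\<bar> = 1" using assms(1) by (meson abs_dvd_iff coprime_absorb_left zdvd1_eq)
    then have "odd r" "odd s" using s r by (auto simp: k_def) presburger+
    then show False using assms(2) by simp
  qed
  then consider "\<rho> < \<bar>r\<bar>" | "\<rho> > \<bar>r\<bar>" by linarith
  then show thesis
  proof cases
    case 1
    have "(2 * sgn r * (s div k)) * r - s = - \<rho>" using br[of "s div k"] s by linarith
    then show ?thesis using 1 \<rho> by (intro that[of "2 * sgn r * (s div k)"]) auto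
  next
    case 2
    have "(2 * sgn r * (s div k + 1)) * r - s = k - \<rho>"
      using br[of "s div k + 1"] s by (simp add: distrib_left)
    then show ?thesis using 2 \<rho> k_def by (intro that[of "2 * sgn r * (s div k + 1)"]) auto
  qed
qed

text \<open>Descent on |r|: the pair (r, s) is reached by one bordering from (b r - s, r), with b
  even and |b r - s| < |r|. Coprimality and evenness of the product pass to the new pair.\<close>

lemma chain_state_exists:
  assumes base: "orth_realization p a n m0 G0 w"
    and span: "\<And>x. x \<in> dual_vecs m0 G0 \<Longrightarrow>
       \<exists>c :: nat \<Rightarrow> int. (\<lambda>l. x l - (\<Sum>j<n. of_int (c j) * w j l)) \<in> lattice_vecs m0"
    and "coprime r s" "even (r * s)" "s \<noteq> 0"
  shows "\<exists>m G u. chain_state p a n r s m G w u"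
  using assms(3-5)
proof (induction "nat \<bar>r\<bar>" arbitrary: r s rule: less_induct)
  case less
  show ?case
  proof (cases "r = 0")
    case True
    \<comment> \<open>Start of the chain: the given lattice with the zero vector as
      \<open>u\<close>.\<close>
    have "chain_state p a n r s m0 G0 w (\<lambda>_. 0)"
      unfolding chain_state_def using True base span by (auto simp: dual_vecs_def lattice_vecs_def)
    then show ?thesis by blast
  next
    case False
    obtain b where b: "even b" "\<bar>b * r - s\<bar> < \<bar>r\<bar>"
      using even_quotient[OF less.prems(1,2) False] by blast
    have "coprime (b * r - s) r"
    proof (rule coprimeI)
      fix d assume d: "d dvd b * r - s" "d dvd r"
      then have "d dvd b * r - (b * r - s)" by (meson dvd_diff dvd_mult)
      then have "d dvd s" by simp
      then show "is_unit d" by (rule coprime_common_divisor[OF less.prems(1) d(2)])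
    qed
    moreover have "even ((b * r - s) * r)"
      using b(1) less.prems(2) by (auto simp: algebra_simps)
    ultimately obtain m G u where "chain_state p a n (b * r - s) r m G w u"
      using less.hyps[of "b * r - s" r] b(2) False by auto
    moreover have "s = b * r - (b * r - s)" by simp
    ultimately show ?thesis
      using chain_state_step[of p a n "b * r - s" r m G w u b s] False b(1) less.prems(3) by blast
  qed
qed

lemma prime_dvd_double:
  fixes a :: int
  assumes "prime p" "odd p" "int p dvd 2 * a"
  shows "int p dvd a"
proof -
  have "\<not> int p dvd 2"
  proof
    assume "int p dvd 2"
    then have "int p dvd int 2" by simp
    then have "p dvd 2" by (simp only: int_dvd_int_iff)
    then have "p \<le> 2" by (simp add: dvd_imp_le)
    then show False using assms prime_ge_2_nat[of p] by auto
  qed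
  then show ?thesis using assms by (simp add: prime_dvd_mult_iff)
qed

text \<open>One chain per generator. The target norm 2a/p has an even numerator, and it is in lowest
  terms because p is odd and does not divide a, so the descent applies.\<close>

lemma orth_realization_exists:
  assumes p: "prime p" "odd p" and a: "\<And>i. i < n \<Longrightarrow> \<not> int p dvd a i"
  shows "\<exists>m G w. orth_realization p a n m G w \<and> (\<forall>x\<in>dual_vecs m G.
       \<exists>c :: nat \<Rightarrow> int. (\<lambda>l. x l - (\<Sum>j<n. of_int (c j) * w j l)) \<in> lattice_vecs m)"
  using a
proof (induction n)
  case 0
  have "orth_realization p a 0 0 (\<lambda>_ _. 0) (\<lambda>_ _. 0)"
    by (auto simp: orth_realization_def even_lattice_def gram_def)
  moreover have "\<forall>x\<in>dual_vecs 0 (\<lambda>_ _. 0). x \<in> lattice_vecs 0"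
    by (auto simp: dual_vecs_def lattice_vecs_def)
  ultimately show ?case by fastforce
next
  case (Suc n)
  then obtain m0 G0 w where base: "orth_realization p a n m0 G0 w"
    and span: "\<And>x. x \<in> dual_vecs m0 G0 \<Longrightarrow>
       \<exists>c :: nat \<Rightarrow> int. (\<lambda>l. x l - (\<Sum>j<n. of_int (c j) * w j l)) \<in> lattice_vecs m0"
    by (metis less_SucI)
  have "coprime (int p) (2 * a n)"
  proof (rule prime_imp_coprime)
    show "prime (int p)" using p by simp
    show "\<not> int p dvd 2 * a n"
      using Suc.prems[of n] prime_dvd_double[OF p] by blast
  qed
  then have cop: "coprime (2 * a n) (int p)" by (simp add: coprime_commute)
  have p0: "p \<noteq> 0" using p(1) by auto
  obtain m G u where st: "chain_state p a n (2 * a n) (int p) m G w u"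
    using chain_state_exists[OF base span cop] p0 by auto
  define w' where "w' = w(n := u)"
  have re: "orth_realization p a n m G w" and u: "u \<in> dual_vecs m G"
    and wu: "\<And>i. i < n \<Longrightarrow> gram m G (w i) u = 0"
    and uu: "of_nat p * gram m G u u = 2 * of_int (a n)" and pu: "(\<lambda>l. of_nat p * u l) \<in> lattice_vecs m"
    and span': "\<And>x. x \<in> dual_vecs m G \<Longrightarrow> \<exists>(c :: nat \<Rightarrow> int) (k :: int).
        (\<lambda>l. x l - (\<Sum>j<n. of_int (c j) * w j l) - of_int k * u l) \<in> lattice_vecs m"
    using st by (auto simp: chain_state_def)
  have L: "even_lattice m G"
    and w: "\<And>i. i < n \<Longrightarrow> w i \<in> dual_vecs m G" "\<And>i. i < n \<Longrightarrow> (\<lambda>l. of_nat p * w i l) \<in> lattice_vecs m"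
      "\<And>i. i < n \<Longrightarrow> gram m G (w i) (w i) = 2 * of_int (a i) / of_nat p"
      "\<And>i j. i < n \<Longrightarrow> j < n \<Longrightarrow> i \<noteq> j \<Longrightarrow> gram m G (w i) (w j) = 0"
    using re unfolding orth_realization_def by blast+
  have uw: "gram m G u (w i) = 0" if "i < n" for i
    using wu[OF that] gram_commute[of m G u "w i"] L by (simp add: even_lattice_def)
  have uu': "gram m G u u = 2 * of_int (a n) / of_nat p" using uu p0 by (simp add: field_simps)
  have "orth_realization p a (Suc n) m G w'"
    unfolding orth_realization_def w'_def less_Suc_eq
    using L w u pu uu' wu uw by auto
  moreover have "\<exists>c :: nat \<Rightarrow> int. (\<lambda>l. x l - (\<Sum>j<Suc n. of_int (c j) * w' j l)) \<in> lattice_vecs m"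
    if x: "x \<in> dual_vecs m G" for x
  proof -
    obtain c :: "nat \<Rightarrow> int" and k :: int where
      "(\<lambda>l. x l - (\<Sum>j<n. of_int (c j) * w j l) - of_int k * u l) \<in> lattice_vecs m"
      using span'[OF x] by blast
    moreover have "(\<Sum>j<Suc n. of_int ((c(n := k)) j) * w' j l) = (\<Sum>j<n. of_int (c j) * w j l) + of_int k * u l" for l
      by (auto simp: w'_def intro!: sum.cong)
    ultimately show ?thesis by (intro exI[of _ "c(n := k)"]) (simp add: diff_diff_eq)
  qed
  ultimately show ?case by blast
qed

section \<open>The signature of a form of type \<open>p\<^bsup>\<epsilon>n\<^esup>\<close>\<close>

lemma bil_commute: "bil q x y = bil q y x"
  by (simp add: bil_def algebra_simps)

lemma quadratic_form_add: "q (x + y) = q x + q y + bil q x y"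
  by (simp add: bil_def)

context
  fixes q :: "'a::ab_group_add \<Rightarrow> qmodz"
  assumes q: "quadratic_form q"
begin

lemma quadratic_form_zmul: "q (zmul k x) = zmul (k\<^sup>2) (q x)"
  using q by (simp add: quadratic_form_def)

lemma quadratic_form_0: "q 0 = 0"
  using quadratic_form_zmul[of 0 0] by simp

lemma bil_add_left: "bil q (x + y) z = bil q x z + bil q y z"
  using q by (simp add: quadratic_form_def)

lemma bil_zmul_left: "bil q (zmul k x) y = zmul k (bil q x y)"
  using zmul_hom[of "\<lambda>x. bil q x y" k x] by (simp add: bil_add_left)

lemma bil_zmul_right: "bil q y (zmul k x) = zmul k (bil q y x)"
  using bil_zmul_left by (simp add: bil_commute)

lemma bil_0_left: "bil q 0 y = 0"
  using bil_zmul_left[of 0 0 y] by simp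

lemma bil_sum_left: "bil q (sum f A) y = (\<Sum>i\<in>A. bil q (f i) y)"
  by (induction A rule: infinite_finite_induct) (simp_all add: bil_0_left bil_add_left)

lemma quadratic_form_orth_sum:
  fixes n :: nat
  assumes "\<And>i j. i < n \<Longrightarrow> j < n \<Longrightarrow> i \<noteq> j \<Longrightarrow> bil q (g i) (g j) = 0"
  shows "q (\<Sum>i<n. zmul (c i) (g i)) = (\<Sum>i<n. zmul ((c i)\<^sup>2) (q (g i)))"
  using assms
proof (induction n)
  case 0
  then show ?case by (simp add: quadratic_form_0)
next
  case (Suc n)
  have "bil q (\<Sum>i<n. zmul (c i) (g i)) (zmul (c n) (g n)) = 0"
    using Suc.prems[of _ n] by (simp add: bil_sum_left bil_zmul_left bil_zmul_right)
  then show ?case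
    using Suc.IH Suc.prems by (simp add: quadratic_form_add quadratic_form_zmul)
qed

end

lemma int_div_Ints_iff:
  fixes k :: int
  assumes "p > 0"
  shows "(of_int k / of_nat p :: rat) \<in> \<int> \<longleftrightarrow> int p dvd k"
proof
  assume "(of_int k / of_nat p :: rat) \<in> \<int>"
  then obtain j where "(of_int k / of_nat p :: rat) = of_int j" by (auto elim: Ints_cases)
  then have "(of_int k :: rat) = of_int (j * int p)" using assms by (simp add: field_simps)
  then have "k = j * int p" by (simp only: of_int_eq_iff)
  then show "int p dvd k" by simp
next
  assume "int p dvd k"
  then show "(of_int k / of_nat p :: rat) \<in> \<int>" using assms by (auto elim!: dvdE)
qed

text \<open>Fixes the generators and coefficients that \<open>disc_type\<close> asserts to
  exist.\<close>

locale orth_decomp =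
  fixes q :: "'a::{finite,ab_group_add} \<Rightarrow> qmodz" and p n :: nat and g :: "nat \<Rightarrow> 'a" and a :: "nat \<Rightarrow> int"
  assumes p: "prime p" "odd p" and disc: "discriminant_form q"
    and g_order: "\<And>i. i < n \<Longrightarrow> zmul (int p) (g i) = 0"
    and a_ndvd: "\<And>i. i < n \<Longrightarrow> \<not> int p dvd a i"
    and q_g: "\<And>i. i < n \<Longrightarrow> q (g i) = qmodz_of_rat (of_int (a i) / of_nat p)"
    and g_orth: "\<And>i j. i < n \<Longrightarrow> j < n \<Longrightarrow> i \<noteq> j \<Longrightarrow> bil q (g i) (g j) = 0"
    and g_bij: "bij_betw (\<lambda>c. \<Sum>i<n. zmul (c i) (g i)) ({..<n} \<rightarrow>\<^sub>E {0..<int p}) UNIV"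
begin

lemma quad: "quadratic_form q"
  using disc by (simp add: discriminant_form_def)

lemma p_pos: "p > 0"
  using p by (simp add: prime_gt_0_nat)

definition comb :: "(nat \<Rightarrow> int) \<Rightarrow> 'a" where
  "comb c = (\<Sum>i<n. zmul (c i) (g i))"

lemma comb_cong: "(\<And>i. i < n \<Longrightarrow> [c i = d i] (mod int p)) \<Longrightarrow> comb c = comb d"
  unfolding comb_def by (intro sum.cong zmul_cong[OF g_order]) auto

lemma comb_add: "comb (\<lambda>i. c i + d i) = comb c + comb d"
  by (simp add: comb_def zmul_add_left sum.distrib)

lemma comb_surj: "\<exists>c. x = comb c"
proof -
  have "x \<in> (\<lambda>c. \<Sum>i<n. zmul (c i) (g i)) ` ({..<n} \<rightarrow>\<^sub>E {0..<int p})"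
    using g_bij by (simp add: bij_betw_def)
  then show ?thesis by (auto simp: comb_def)
qed

lemma comb_eq_0_iff: "comb c = 0 \<longleftrightarrow> (\<forall>i<n. int p dvd c i)"
proof
  assume 0: "comb c = 0"
  define c' where "c' = (\<lambda>i\<in>{..<n}. c i mod int p)"
  have "comb c' = comb c" by (rule comb_cong) (simp add: c'_def cong_def)
  moreover have "comb (\<lambda>i\<in>{..<n}. 0) = 0" by (simp add: comb_def)
  ultimately have "comb c' = comb (\<lambda>i\<in>{..<n}. 0)" using 0 by simp
  moreover have "c' \<in> {..<n} \<rightarrow>\<^sub>E {0..<int p}" "(\<lambda>i\<in>{..<n}. 0) \<in> {..<n} \<rightarrow>\<^sub>E {0..<int p}"
    using p_pos by (auto simp: c'_def)
  ultimately have eq: "c' = (\<lambda>i\<in>{..<n}. 0)"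
    using g_bij unfolding bij_betw_def comb_def by (meson inj_onD)
  show "\<forall>i<n. int p dvd c i"
  proof (intro allI impI)
    fix i assume "i < n"
    then show "int p dvd c i" using fun_cong[OF eq, of i] by (simp add: c'_def mod_eq_0_iff_dvd)
  qed
next
  assume "\<forall>i<n. int p dvd c i"
  then have "comb c = comb (\<lambda>_. 0)" by (intro comb_cong) (simp add: cong_0_iff)
  then show "comb c = 0" by (simp add: comb_def)
qed

lemma q_comb: "q (comb c) = qmodz_of_rat (of_int (\<Sum>i<n. (c i)\<^sup>2 * a i) / of_nat p)"
proof -
  have "q (comb c) = (\<Sum>i<n. zmul ((c i)\<^sup>2) (q (g i)))"
    unfolding comb_def by (rule quadratic_form_orth_sum[OF quad g_orth])
  also have "\<dots> = (\<Sum>i<n. qmodz_of_rat (of_int ((c i)\<^sup>2 * a i) / of_nat p))"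
    by (intro sum.cong) (auto simp: q_g zmul_qmodz_of_rat)
  also have "\<dots> = qmodz_of_rat (of_int (\<Sum>i<n. (c i)\<^sup>2 * a i) / of_nat p)"
    by (simp add: qmodz_of_rat_sum[symmetric] sum_divide_distrib)
  finally show ?thesis .
qed

lemma card_eq: "CARD('a) = p ^ n"
proof -
  have "CARD('a) = card ({..<n} \<rightarrow>\<^sub>E {0..<int p})" using bij_betw_same_card[OF g_bij] by simp
  also have "\<dots> = p ^ n" by (simp add: card_PiE)
  finally show ?thesis .
qed

text \<open>The lattice realises the same diagonal form on independent generators of order p, so
  sending the class of \<open>w i\<close> to \<open>g i\<close> is an isometry.\<close>

lemma lattice_exists: "\<exists>m G. even_lattice m G \<and> has_discriminant_form m G q"
proof -
  obtain m G w where re: "orth_realization p a n m G w"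
    and span: "\<And>x. x \<in> dual_vecs m G \<Longrightarrow>
       \<exists>c :: nat \<Rightarrow> int. (\<lambda>l. x l - (\<Sum>j<n. of_int (c j) * w j l)) \<in> lattice_vecs m"
    using orth_realization_exists[OF p, of n a] a_ndvd by blast
  have L: "even_lattice m G"
    and w: "\<And>i. i < n \<Longrightarrow> w i \<in> dual_vecs m G" "\<And>i. i < n \<Longrightarrow> (\<lambda>l. of_nat p * w i l) \<in> lattice_vecs m"
      "\<And>i. i < n \<Longrightarrow> gram m G (w i) (w i) = 2 * of_int (a i) / of_nat p"
      "\<And>i j. i < n \<Longrightarrow> j < n \<Longrightarrow> i \<noteq> j \<Longrightarrow> gram m G (w i) (w j) = 0"
    using re unfolding orth_realization_def by blast+
  have sym: "\<forall>i<m. \<forall>j<m. G i j = G j i"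
    and ev: "\<And>x. x \<in> lattice_vecs m \<Longrightarrow> gram m G x x / 2 \<in> \<int>"
    using L by (auto simp: even_lattice_def)
  note comm = gram_commute[OF sym]
  define S where "S c = (\<lambda>l. \<Sum>j<n. of_int (c j) * w j l)" for c :: "nat \<Rightarrow> int"
  have "a i \<noteq> 0" if "i < n" for i using a_ndvd[OF that] by auto
  then have orth: "orth_family m G n w"
    using w(3,4) p_pos by (simp add: orth_family_def)
  have S_add: "S (\<lambda>i. c i + d i) = (\<lambda>l. S c l + S d l)" for c d
    by (simp add: S_def distrib_right sum.distrib)
  have S_diff: "S (\<lambda>i. c i - d i) = (\<lambda>l. S c l - S d l)" for c d
    by (simp add: S_def left_diff_distrib sum_subtractf)
  \<comment> \<open>Pairing with \<open>w i\<close> isolates 2 a_i c_i/p, so a combination in L has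
    all coefficients divisible by p.\<close>
  have S_lat: "S c \<in> lattice_vecs m \<longleftrightarrow> (\<forall>i<n. int p dvd c i)" for c
  proof
    assume S: "S c \<in> lattice_vecs m"
    show "\<forall>i<n. int p dvd c i"
    proof (intro allI impI)
      fix i assume i: "i < n"
      have "gram m G (S c) (w i) = of_int (c i) * gram m G (w i) (w i)"
        unfolding S_def by (rule orth_family_gram_sum[OF orth i])
      moreover have "gram m G (w i) (S c) \<in> \<int>" using w(1)[OF i] S by (auto simp: dual_vecs_def)
      ultimately have "of_int (2 * a i * c i) / of_nat p \<in> (\<int> :: rat set)"
        using comm[of "w i" "S c"] w(3)[OF i] by (simp add: mult_ac)
      then have "int p dvd 2 * (a i * c i)" by (simp only: int_div_Ints_iff[OF p_pos] mult.assoc)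
      then have "int p dvd a i * c i" by (rule prime_dvd_double[OF p])
      then show "int p dvd c i" using a_ndvd[OF i] p(1) by (simp add: prime_dvd_mult_iff)
    qed
  next
    assume "\<forall>i<n. int p dvd c i"
    then obtain d where d: "\<And>i. i < n \<Longrightarrow> c i = int p * d i" unfolding dvd_def by metis
    have "S c = (\<lambda>l. \<Sum>j<n. of_int (d j) * (of_nat p * w j l))"
      unfolding S_def by (intro ext sum.cong) (auto simp: d)
    also have "\<dots> \<in> lattice_vecs m" using w(2) by (intro lattice_vecs_sum) auto
    finally show "S c \<in> lattice_vecs m" .
  qed
  \<comment> \<open>The coefficients of \<open>x\<close> modulo L are determined modulo p, so every
    choice gives the same element.\<close>
  define \<phi> where "\<phi> x = comb (SOME c. (\<lambda>l. x l - S c l) \<in> lattice_vecs m)" for x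
  have phi: "\<phi> x = comb c" if xc: "(\<lambda>l. x l - S c l) \<in> lattice_vecs m" for x c
  proof -
    define c0 where "c0 = (SOME c. (\<lambda>l. x l - S c l) \<in> lattice_vecs m)"
    have "(\<lambda>l. x l - S c0 l) \<in> lattice_vecs m" unfolding c0_def by (rule someI[of _ c]) (rule xc)
    then have "(\<lambda>l. (x l - S c0 l) + - (x l - S c l)) \<in> lattice_vecs m"
      by (intro lattice_vecs_add lattice_vecs_minus[OF xc])
    moreover have "(\<lambda>l. (x l - S c0 l) + - (x l - S c l)) = S (\<lambda>i. c i - c0 i)"
      by (simp add: S_diff)
    ultimately have "\<forall>i<n. int p dvd c i - c0 i" using S_lat by simp
    then have "comb c = comb c0" by (intro comb_cong) (simp add: cong_iff_dvd_diff)
    then show ?thesis by (simp add: \<phi>_def c0_def)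
  qed
  have S_dual: "S c \<in> dual_vecs m G" for c
  proof -
    have "gram m G (S c) y \<in> \<int>" if "y \<in> lattice_vecs m" for y
      unfolding S_def gram_sum_left using w(1) that by (intro Ints_sum Ints_mult) (auto simp: dual_vecs_def)
    then show ?thesis using w(1) by (auto simp: dual_vecs_def S_def)
  qed
  have "has_discriminant_form m G q"
    unfolding has_discriminant_form_def
  proof (intro exI[of _ \<phi>] conjI ballI)
    fix x y assume x: "x \<in> dual_vecs m G" and y: "y \<in> dual_vecs m G"
    obtain c where c: "(\<lambda>l. x l - S c l) \<in> lattice_vecs m" using span[OF x] by (auto simp: S_def)
    obtain d where d: "(\<lambda>l. y l - S d l) \<in> lattice_vecs m" using span[OF y] by (auto simp: S_def)
    have "(\<lambda>l. (x l + y l) - S (\<lambda>i. c i + d i) l) \<in> lattice_vecs m"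
      using lattice_vecs_add[OF c d] by (simp add: S_add algebra_simps)
    then show "\<phi> (\<lambda>i. x i + y i) = \<phi> x + \<phi> y"
      using phi c d by (simp add: comb_add)
  next
    show "\<phi> ` dual_vecs m G = UNIV"
    proof (intro equalityI subsetI)
      fix d :: 'a
      obtain c where c: "d = comb c" using comb_surj by blast
      have "(\<lambda>l. S c l - S c l) \<in> lattice_vecs m" by (simp add: lattice_vecs_def)
      then have "\<phi> (S c) = comb c" by (rule phi)
      then have "d = \<phi> (S c)" using c by simp
      then show "d \<in> \<phi> ` dual_vecs m G" using S_dual by blast
    qed simp
  next
    fix x assume x: "x \<in> dual_vecs m G"
    obtain c where c: "(\<lambda>l. x l - S c l) \<in> lattice_vecs m" using span[OF x] by (auto simp: S_def)
    have "x \<in> lattice_vecs m \<longleftrightarrow> S c \<in> lattice_vecs m"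
      using lattice_vecs_add[OF c, of "S c"] lattice_vecs_add[OF _ lattice_vecs_minus[OF c], of x] by auto
    then show "\<phi> x = 0 \<longleftrightarrow> x \<in> lattice_vecs m" using phi[OF c] comb_eq_0_iff S_lat by simp
    define l where "l = (\<lambda>i. x i - S c i)"
    have l: "l \<in> lattice_vecs m" using c by (simp add: l_def)
    have xl: "x = (\<lambda>i. l i + S c i)" by (simp add: l_def)
    have "gram m G (S c) (S c) = (\<Sum>i<n. of_int (c i) * of_int (c i) * gram m G (w i) (w i))"
      unfolding S_def by (rule orth_family_gram_sum_sum[OF orth]) auto
    also have "\<dots> = 2 * (of_int (\<Sum>i<n. (c i)\<^sup>2 * a i) / of_nat p)"
      by (simp add: w(3) sum_distrib_left sum_divide_distrib power2_eq_square mult_ac)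
    finally have gS: "gram m G (S c) (S c) / 2 = of_int (\<Sum>i<n. (c i)\<^sup>2 * a i) / of_nat p" by simp
    have "gram m G x x / 2 = gram m G (S c) (S c) / 2 + (gram m G l l / 2 + gram m G (S c) l)"
      unfolding xl using comm[of l "S c"] by (simp add: gram_add_left gram_add_right field_simps)
    moreover have "gram m G l l / 2 + gram m G (S c) l \<in> \<int>"
      using ev[OF l] S_dual[of c] l by (auto simp: dual_vecs_def)
    ultimately have "qmodz_of_rat (gram m G x x / 2) = qmodz_of_rat (gram m G (S c) (S c) / 2)"
      unfolding qmodz_of_rat_eq_iff by (simp only: add_diff_cancel_left')
    then show "q (\<phi> x) = qmodz_of_rat (gram m G x x / 2)"
      unfolding phi[OF c] q_comb gS by simp
  qed
  with L show ?thesis by blast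
qed

end

text \<open>Milgram's formula holds for every lattice with this form, so the Gauss sum fixes e(s/8)
  and hence s in {0..<8}. This is the uniqueness behind \<open>disc_sign\<close>; existence comes
  from \<open>ex\<close> and from the signature that every even lattice has.\<close>

lemma disc_sign_exp:
  fixes q :: "'a::{finite,ab_group_add} \<Rightarrow> qmodz"
  assumes ex: "\<exists>m G. even_lattice m G \<and> has_discriminant_form m G q"
    and norm: "norm (\<Sum>d\<in>UNIV. e_qmodz (q d)) = sqrt (real CARD('a))"
  shows "(\<Sum>d\<in>UNIV. e_qmodz (q d)) =
    of_real (sqrt (real CARD('a))) * exp (2 * of_real pi * \<i> * of_int (disc_sign q) / 8)"
proof -
  let ?W = "\<Sum>d\<in>UNIV. e_qmodz (q d)"
  define P where "P s \<longleftrightarrow> 0 \<le> s \<and> s < 8 \<and>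
     (\<exists>m G bp bm. even_lattice m G \<and> has_discriminant_form m G q \<and>
        lattice_signature m G bp bm \<and> [int bp - int bm = s] (mod 8))" for s
  have W: "?W = of_real (sqrt (real CARD('a))) * er (of_int s / 8)" if Ps: "P s" for s
  proof -
    obtain m G bp bm where *: "even_lattice m G" "has_discriminant_form m G q"
      "lattice_signature m G bp bm" "[int bp - int bm = s] (mod 8)"
      using Ps unfolding P_def by blast
    have "cis (of_int (int bp - int bm) * (pi / 4)) = er (of_int (int bp - int bm) / 8)"
      by (simp add: er_cis of_rat_divide of_rat_diff mult.commute)
    also have "\<dots> = er (of_int s / 8)"
    proof (rule er_cong)
      have "int 8 dvd (int bp - int bm) - s" using *(4) by (simp add: cong_iff_dvd_diff)
      then have "of_int ((int bp - int bm) - s) / of_nat 8 \<in> (\<int> :: rat set)"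
        by (subst int_div_Ints_iff) auto
      then show "of_int (int bp - int bm) / 8 - of_int s / 8 \<in> (\<int> :: rat set)"
        by (simp add: diff_divide_distrib)
    qed
    finally show ?thesis using milgram[OF *(1-3) norm] by simp
  qed
  have "\<exists>s. P s"
  proof -
    obtain m G where L: "even_lattice m G" "has_discriminant_form m G q" using ex by blast
    obtain bp bm where "lattice_signature m G bp bm" using even_lattice_signature_exists[OF L(1)] by blast
    with L have "P ((int bp - int bm) mod 8)" unfolding P_def by (auto simp: cong_def)
    then show ?thesis ..
  qed
  moreover have "s = s'" if s: "P s" "P s'" for s s'
  proof -
    have "er (of_int s / 8) = er (of_int s' / 8)" using W[OF s(1)] W[OF s(2)] by simp
    then have "er (of_int (s - s') / of_nat 8) * er (of_int s' / 8) = er (of_int s' / 8)"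
      by (simp add: er_add[symmetric] diff_divide_distrib)
    then have "er (of_int (s - s') / of_nat 8) = 1" by simp
    then have "int 8 dvd s - s'" by (subst (asm) er_eq_1_iff, subst (asm) int_div_Ints_iff) auto
    moreover have "0 \<le> s" "s < 8" "0 \<le> s'" "s' < 8" using s by (auto simp: P_def)
    ultimately show ?thesis by presburger
  qed
  ultimately have "P (THE s. P s)" by (metis theI)
  moreover have "disc_sign q = (THE s. P s)" unfolding disc_sign_def P_def ..
  ultimately have "?W = of_real (sqrt (real CARD('a))) * er (of_int (disc_sign q) / 8)" using W by simp
  also have "er (of_int (disc_sign q) / 8) = exp (2 * of_real pi * \<i> * of_int (disc_sign q) / 8)"
    by (simp add: er_cis cis_conv_exp of_rat_divide mult_ac)
  finally show ?thesis .
qed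

section \<open>Gauss sums modulo an odd prime\<close>

locale odd_prime =
  fixes p :: nat
  assumes p_prime: "prime p" and p_odd: "odd p"
begin

abbreviation R :: "int set" where
  "R \<equiv> {0..<int p}"

abbreviation Leg :: "int \<Rightarrow> int" where
  "Leg t \<equiv> Legendre t (int p)"

definition ep :: "int \<Rightarrow> complex" where
  "ep k = er (of_int k / of_nat p)"

lemma p_gt_0: "p > 0"
  using p_prime by (simp add: prime_gt_0_nat)

lemma p_gt_2: "p > 2"
  using p_prime p_odd prime_ge_2_nat[of p] by (cases "p = 2") auto

lemma prime_int_p: "prime (int p)"
  using p_prime by simp

lemma ep_add: "ep (k + l) = ep k * ep l"
  by (simp add: ep_def add_divide_distrib er_add)

lemma ep_0 [simp]: "ep 0 = 1"
  by (simp add: ep_def)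

lemma ep_minus: "ep (- k) = cnj (ep k)"
  by (simp add: ep_def er_minus[symmetric])

lemma ep_eq_1_iff: "ep k = 1 \<longleftrightarrow> int p dvd k"
  using int_div_Ints_iff[OF p_gt_0] by (simp add: ep_def er_eq_1_iff)

lemma ep_cong:
  assumes "[k = l] (mod int p)"
  shows "ep k = ep l"
proof -
  have "ep (k - l) = 1" using assms by (simp add: ep_eq_1_iff cong_iff_dvd_diff)
  then show ?thesis using ep_add[of "k - l" l] by simp
qed

lemma sum_R_reindex:
  fixes f :: "int \<Rightarrow> 'b::comm_monoid_add"
  assumes per: "\<And>k l. [k = l] (mod int p) \<Longrightarrow> f k = f l"
    and inj: "\<And>j k. j \<in> R \<Longrightarrow> k \<in> R \<Longrightarrow> [h j = h k] (mod int p) \<Longrightarrow> j = k"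
  shows "(\<Sum>j\<in>R. f (h j)) = (\<Sum>j\<in>R. f j)"
proof -
  define h' where "h' j = h j mod int p" for j
  have "inj_on h' R" by (rule inj_onI) (auto simp: h'_def cong_def intro!: inj)
  moreover have "h' ` R \<subseteq> R" using p_gt_0 by (auto simp: h'_def)
  ultimately have "bij_betw h' R R"
    by (simp add: bij_betw_def endo_inj_surj)
  then have "(\<Sum>j\<in>R. f (h' j)) = (\<Sum>j\<in>R. f j)" by (rule sum.reindex_bij_betw)
  moreover have "f (h' j) = f (h j)" for j by (rule per) (simp add: h'_def cong_def)
  ultimately show ?thesis by simp
qed

lemma R_cong_eq: "j \<in> R \<Longrightarrow> k \<in> R \<Longrightarrow> [j = k] (mod int p) \<Longrightarrow> j = k"
  by (simp add: cong_def)

lemma R_dvd_iff: "k \<in> R \<Longrightarrow> int p dvd k \<longleftrightarrow> k = 0"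
  by (auto simp: dvd_eq_mod_eq_0)

lemma sum_R_shift:
  assumes "\<And>k l. [k = l] (mod int p) \<Longrightarrow> f k = f l"
  shows "(\<Sum>j\<in>R. f (j + h)) = (\<Sum>j\<in>R. f j)"
  by (rule sum_R_reindex[OF assms]) (auto simp: cong_add_rcancel intro: R_cong_eq)

lemma sum_R_scale:
  assumes "\<And>k l. [k = l] (mod int p) \<Longrightarrow> f k = f l" "\<not> int p dvd t"
  shows "(\<Sum>j\<in>R. f (t * j)) = (\<Sum>j\<in>R. f j)"
proof (rule sum_R_reindex[OF assms(1)])
  fix j k assume *: "j \<in> R" "k \<in> R" "[t * j = t * k] (mod int p)"
  have "coprime t (int p)" 
    using prime_imp_coprime[OF prime_int_p assms(2)] by (simp add: coprime_commute)
  then have "[j = k] (mod int p)" using * by (simp add: cong_mult_lcancel)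
  then show "j = k" using * by (intro R_cong_eq)
qed

lemma sum_ep: "(\<Sum>j\<in>R. ep (t * j)) = (if int p dvd t then of_nat p else 0)"
proof (cases "int p dvd t")
  case True
  then have "ep (t * j) = 1" for j by (simp add: ep_eq_1_iff)
  then show ?thesis using True by simp
next
  case False
  have "(\<Sum>j\<in>R. ep j) = (\<Sum>j\<in>R. ep (j + 1))" by (rule sum_R_shift[symmetric]) (rule ep_cong)
  also have "\<dots> = (\<Sum>j\<in>R. ep j) * ep 1" by (simp add: ep_add sum_distrib_right)
  finally have "(\<Sum>j\<in>R. ep j) * (ep 1 - 1) = 0" by (simp add: algebra_simps)
  moreover have "ep 1 \<noteq> 1" using p_gt_2 by (simp add: ep_eq_1_iff)
  ultimately have "(\<Sum>j\<in>R. ep j) = 0" by simp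
  then show ?thesis using False sum_R_scale[of ep t] ep_cong by simp
qed

lemma cong_unit_not_dvd:
  assumes "[x * y = 1] (mod int p)"
  shows "\<not> int p dvd x" "\<not> int p dvd y"
proof -
  have "\<not> int p dvd 1" using p_gt_2 by simp
  then have "\<not> int p dvd x * y" using assms cong_dvd_iff by blast
  then show "\<not> int p dvd x" "\<not> int p dvd y" by auto
qed

lemma Leg_cong: "[k = l] (mod int p) \<Longrightarrow> Leg k = Leg l"
proof -
  assume kl: "[k = l] (mod int p)"
  have "[k = 0] (mod int p) \<longleftrightarrow> [l = 0] (mod int p)" using kl by (metis cong_sym cong_trans)
  moreover have "QuadRes (int p) k \<longleftrightarrow> QuadRes (int p) l"
    unfolding QuadRes_def using kl by (metis cong_sym cong_trans)
  ultimately show ?thesis by (simp add: Legendre_def)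
qed

lemma Leg_eq_0_iff: "Leg t = 0 \<longleftrightarrow> int p dvd t"
  by (simp add: Legendre_def cong_0_iff)

lemma Leg_values: "Leg t \<in> {-1, 0, 1}"
  by (simp add: Legendre_def)

text \<open>Euler's criterion gives a congruence modulo p; both sides lie in {-1, 0, 1} and p > 2,
  so they are equal.\<close>

lemma Leg_mult: "Leg (s * t) = Leg s * Leg t"
proof -
  have "[Leg (s * t) = (s * t) ^ ((p - 1) div 2)] (mod int p)"
    by (rule euler_criterion[OF p_prime p_gt_2])
  also have "(s * t) ^ ((p - 1) div 2) = s ^ ((p - 1) div 2) * t ^ ((p - 1) div 2)"
    by (rule power_mult_distrib)
  also have "[\<dots> = Leg s * Leg t] (mod int p)"
    by (intro cong_mult cong_sym[OF euler_criterion[OF p_prime p_gt_2]])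
  finally have "int p dvd Leg (s * t) - Leg s * Leg t" by (simp add: cong_iff_dvd_diff)
  moreover have "\<bar>Leg (s * t) - Leg s * Leg t\<bar> < int p"
    using Leg_values[of "s * t"] Leg_values[of s] Leg_values[of t] p_gt_2 by auto
  ultimately show ?thesis using zdvd_imp_le[of "int p" "\<bar>Leg (s * t) - Leg s * Leg t\<bar>"] by fastforce
qed

lemma Leg_1 [simp]: "Leg 1 = 1"
proof -
  have "QuadRes (int p) 1" unfolding QuadRes_def by (rule exI[of _ 1]) simp
  moreover have "\<not> [1 = 0] (mod int p)" using p_gt_2 by (simp add: cong_0_iff)
  ultimately show ?thesis by (simp add: Legendre_def)
qed

lemma Leg_square: "\<not> int p dvd t \<Longrightarrow> Leg t * Leg t = 1"
  using Leg_values[of t] Leg_eq_0_iff[of t] by auto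

lemma card_square_roots: "int (card {k \<in> R. [k\<^sup>2 = j] (mod int p)}) = 1 + Leg j"
proof -
  let ?S = "{k \<in> R. [k\<^sup>2 = j] (mod int p)}"
  consider "int p dvd j" | "\<not> int p dvd j" "QuadRes (int p) j" | "\<not> int p dvd j" "\<not> QuadRes (int p) j" by blast
  then show ?thesis
  proof cases
    case 1
    have "?S = {0}"
    proof (intro equalityI subsetI)
      fix k assume k: "k \<in> ?S"
      then have "[k\<^sup>2 = j] (mod int p)" by simp
      moreover have "[j = 0] (mod int p)" using 1 by (simp add: cong_0_iff)
      ultimately have "[k\<^sup>2 = 0] (mod int p)" by (rule cong_trans)
      then have "int p dvd k" using prime_int_p by (simp add: cong_0_iff prime_dvd_power_iff)
      then show "k \<in> {0}" using k R_dvd_iff by simp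
    next
      fix k :: int assume "k \<in> {0}"
      then show "k \<in> ?S" using 1 p_gt_0 cong_sym[of j 0 "int p"] by (simp add: cong_0_iff)
    qed
    then show ?thesis using 1 Leg_eq_0_iff by simp
  next
    case 2
    then obtain y where y: "[y\<^sup>2 = j] (mod int p)" unfolding QuadRes_def by blast
    define k where "k = y mod int p"
    have k: "k \<in> R" "[k\<^sup>2 = j] (mod int p)"
      using p_gt_0 y by (auto simp: k_def cong_def power_mod)
    have "\<not> int p dvd k"
    proof
      assume "int p dvd k"
      then have "int p dvd k\<^sup>2" by (simp add: power2_eq_square)
      then show False using k(2) 2(1) cong_dvd_iff by blast
    qed
    then have k0: "k \<noteq> 0" by auto
    have "?S = {k, int p - k}"
    proof (intro equalityI subsetI)
      fix l assume l: "l \<in> ?S"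
      then have "[l\<^sup>2 = j] (mod int p)" by simp
      then have "[l\<^sup>2 = k\<^sup>2] (mod int p)" using cong_sym[OF k(2)] by (rule cong_trans)
      then have "int p dvd (l - k) * (l + k)"
        by (simp add: cong_iff_dvd_diff power2_eq_square algebra_simps)
      then have "int p dvd l - k \<or> int p dvd l + k" using prime_int_p by (simp add: prime_dvd_mult_iff)
      then show "l \<in> {k, int p - k}"
      proof
        assume "int p dvd l - k"
        then have "l = k" using l k by (intro R_cong_eq) (auto simp: cong_iff_dvd_diff)
        then show ?thesis by simp
      next
        assume "int p dvd l + k"
        then have "[l = int p - k] (mod int p)"
          using dvd_diff[of "int p" "l + k" "int p"] by (simp add: cong_iff_dvd_diff algebra_simps)
        moreover have "int p - k \<in> R" using k k0 by auto
        ultimately show ?thesis using l R_cong_eq by blast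
      qed
    next
      fix l assume "l \<in> {k, int p - k}"
      moreover have "[(int p - k)\<^sup>2 = j] (mod int p)"
      proof -
        have "(int p - k)\<^sup>2 - k\<^sup>2 = int p * (int p - 2 * k)" by (simp add: power2_eq_square algebra_simps)
        then have "[(int p - k)\<^sup>2 = k\<^sup>2] (mod int p)" by (simp add: cong_iff_dvd_diff)
        then show ?thesis using k(2) cong_trans by blast
      qed
      ultimately show "l \<in> ?S" using k k0 by auto
    qed
    moreover have "k \<noteq> int p - k" using p_odd by presburger
    ultimately show ?thesis using 2 by (simp add: Legendre_def cong_0_iff)
  next
    case 3
    then have "?S = {}" unfolding QuadRes_def by blast
    then show ?thesis using 3 by (simp only: Legendre_def cong_0_iff) simp
  qed
qed

definition gs :: "int \<Rightarrow> complex" where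
  "gs t = (\<Sum>k\<in>R. ep (t * k\<^sup>2))"

definition leg_sum :: "int \<Rightarrow> complex" where
  "leg_sum t = (\<Sum>j\<in>R. of_int (Leg j) * ep (t * j))"

text \<open>Group the k by their squares: j has 1 + (j/p) square roots.\<close>

lemma gs_eq: "gs t = (\<Sum>j\<in>R. ep (t * j)) + leg_sum t"
proof -
  have "gs t = (\<Sum>j\<in>R. \<Sum>k\<in>{k \<in> R. k\<^sup>2 mod int p = j}. ep (t * k\<^sup>2))"
    unfolding gs_def using p_gt_0 by (intro sum.group[symmetric]) auto
  also have "\<dots> = (\<Sum>j\<in>R. of_int (1 + Leg j) * ep (t * j))"
  proof (rule sum.cong)
    fix j assume j: "j \<in> R"
    then have set: "{k \<in> R. k\<^sup>2 mod int p = j} = {k \<in> R. [k\<^sup>2 = j] (mod int p)}"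
      by (auto simp: cong_def)
    have "(\<Sum>k\<in>{k \<in> R. [k\<^sup>2 = j] (mod int p)}. ep (t * k\<^sup>2)) = (\<Sum>k\<in>{k \<in> R. [k\<^sup>2 = j] (mod int p)}. ep (t * j))"
      by (intro sum.cong ep_cong cong_mult) auto
    also have "\<dots> = of_int (int (card {k \<in> R. [k\<^sup>2 = j] (mod int p)})) * ep (t * j)" by simp
    finally show "(\<Sum>k\<in>{k \<in> R. k\<^sup>2 mod int p = j}. ep (t * k\<^sup>2)) = of_int (1 + Leg j) * ep (t * j)"
      unfolding set card_square_roots .
  qed simp
  also have "\<dots> = (\<Sum>j\<in>R. ep (t * j)) + leg_sum t"
    by (simp add: leg_sum_def distrib_right sum.distrib)
  finally show ?thesis .
qed

text \<open>For t prime to p the substitution j -> tj brings out the symbol of t. If p divides t,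
  both \<open>gs t\<close> and the sum of the trivial phases equal p, so their difference
  vanishes.\<close>

lemma leg_sum_scale: "leg_sum t = of_int (Leg t) * leg_sum 1"
proof (cases "int p dvd t")
  case True
  have ep1: "ep (t * j) = 1" for j using True by (simp add: ep_eq_1_iff)
  have "gs t = of_nat p" unfolding gs_def ep1 by simp
  then have "leg_sum t = 0" using gs_eq[of t] by (simp add: ep1)
  then show ?thesis using True Leg_eq_0_iff by simp
next
  case False
  have "of_int (Leg t) * leg_sum t = (\<Sum>j\<in>R. of_int (Leg (t * j)) * ep (t * j))"
    by (simp add: leg_sum_def sum_distrib_left Leg_mult mult_ac)
  also have "\<dots> = leg_sum 1"
    unfolding leg_sum_def using False
    by (subst sum_R_scale[where f = "\<lambda>j. of_int (Leg j) * ep j"]) (auto intro: ep_cong dest: Leg_cong simp: ep_cong)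
  finally have "of_int (Leg t * Leg t) * leg_sum t = of_int (Leg t) * leg_sum 1" by (simp add: mult.assoc)
  then show ?thesis using Leg_square[OF False] by simp
qed

lemma gs_scale:
  assumes "\<not> int p dvd t"
  shows "gs t = of_int (Leg t) * gs 1"
proof -
  have 1: "\<not> int p dvd 1" using p_gt_2 by simp
  show ?thesis using assms 1 leg_sum_scale[of t] by (simp only: gs_eq sum_ep if_False add_0_left)
qed

lemma gs_1: "gs 1 = leg_sum 1"
proof -
  have 1: "\<not> int p dvd 1" using p_gt_2 by simp
  then show ?thesis by (simp only: gs_eq sum_ep if_False add_0_left)
qed

text \<open>The substitution k -> k + l makes the phase (k + l)^2 - l^2 = k^2 + 2kl linear in l, and
  only k = 0 survives the sum over l.\<close>

lemma gs_norm: "gs 1 * cnj (gs 1) = of_nat p"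
proof -
  have "gs 1 * cnj (gs 1) = (\<Sum>l\<in>R. \<Sum>k\<in>R. ep (k\<^sup>2 - l\<^sup>2))"
  proof -
    have "ep (k\<^sup>2 - l\<^sup>2) = ep (k\<^sup>2) * cnj (ep (l\<^sup>2))" for k l
      using ep_add[of "k\<^sup>2" "- l\<^sup>2"] by (simp add: ep_minus)
    then have "(\<Sum>l\<in>R. \<Sum>k\<in>R. ep (k\<^sup>2 - l\<^sup>2)) = (\<Sum>l\<in>R. gs 1 * cnj (ep (l\<^sup>2)))"
      by (simp add: gs_def sum_distrib_right)
    also have "\<dots> = gs 1 * cnj (gs 1)"
      unfolding sum_distrib_left[symmetric] by (simp add: gs_def cnj_sum)
    finally show ?thesis ..
  qed
  also have "\<dots> = (\<Sum>l\<in>R. \<Sum>k\<in>R. ep ((k + l)\<^sup>2 - l\<^sup>2))"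
  proof (rule sum.cong)
    fix l
    show "(\<Sum>k\<in>R. ep (k\<^sup>2 - l\<^sup>2)) = (\<Sum>k\<in>R. ep ((k + l)\<^sup>2 - l\<^sup>2))"
      by (rule sum_R_shift[where f = "\<lambda>k. ep (k\<^sup>2 - l\<^sup>2)", symmetric])
         (auto intro!: ep_cong cong_diff cong_pow)
  qed simp
  also have "\<dots> = (\<Sum>k\<in>R. ep (k\<^sup>2) * (\<Sum>l\<in>R. ep ((2 * k) * l)))"
  proof (subst sum.swap, rule sum.cong)
    fix k :: int
    have "(k + l)\<^sup>2 - l\<^sup>2 = k\<^sup>2 + (2 * k) * l" for l by (simp add: power2_eq_square algebra_simps)
    then show "(\<Sum>l\<in>R. ep ((k + l)\<^sup>2 - l\<^sup>2)) = ep (k\<^sup>2) * (\<Sum>l\<in>R. ep ((2 * k) * l))"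
      by (simp only: ep_add sum_distrib_left)
  qed simp
  also have "\<dots> = (\<Sum>k\<in>R. if k = 0 then of_nat p else 0)"
  proof (rule sum.cong)
    fix k assume k: "k \<in> R"
    have "int p dvd 2 * k \<longleftrightarrow> k = 0"
    proof
      assume "int p dvd 2 * k"
      then have "int p dvd k" by (rule prime_dvd_double[OF p_prime p_odd])
      then show "k = 0" using k R_dvd_iff by simp
    qed simp
    then show "ep (k\<^sup>2) * (\<Sum>l\<in>R. ep ((2 * k) * l)) = (if k = 0 then of_nat p else 0)"
      unfolding sum_ep by simp
  qed simp
  also have "\<dots> = of_nat p" using p_gt_0 by simp
  finally show ?thesis .
qed

text \<open>Conjugation is t -> -t and so multiplies the sum by (-1/p).\<close>

lemma gs_square: "gs 1 * gs 1 = of_int (Leg (-1)) * of_nat p"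
proof -
  have "cnj (gs 1) = leg_sum (-1)"
    unfolding gs_1 by (simp add: leg_sum_def cnj_sum ep_minus)
  also have "\<dots> = of_int (Leg (-1)) * gs 1" using leg_sum_scale[of "-1"] by (simp add: gs_1)
  finally have "of_int (Leg (-1)) * (gs 1 * gs 1) = of_nat p" using gs_norm by (simp add: mult_ac)
  then have "of_int (Leg (-1) * Leg (-1)) * (gs 1 * gs 1) = of_int (Leg (-1)) * of_nat p"
    by (simp only: of_int_mult mult.assoc)
  moreover have "Leg (-1) * Leg (-1) = 1" using p_gt_2 by (intro Leg_square) simp
  ultimately show ?thesis by (simp only: of_int_1 mult_1_left)
qed

end

section \<open>An explicit formula for the Weil representation\<close>

text \<open>The phase comparison in the generic case of \<open>weil_entry_S\<close>, over the
  integers. Here \<open>qm\<close>, \<open>qg\<close>, \<open>bm\<close> stand for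
  \<open>Q \<mu>\<close>, \<open>Q \<gamma>\<close>, \<open>B \<mu> \<gamma>\<close>, and
  \<open>ri\<close>, \<open>si\<close> are inverses of \<open>r\<close>, \<open>s\<close> modulo P;
  the explicit cofactor shows divisibility by P.\<close>

lemma weil_phase_identity:
  fixes P :: int
  assumes "r * ri - 1 = P * x" "s * si - 1 = P * y" "k * s - l * r = 1"
  shows "- (ri * k * qm) + r * si * (qg + ri\<^sup>2 * qm + ri * bm) - (- (si * (l * qm - bm + - r * qg))) =
    P * (qm * (ri * k * y - si * l * x + si * ri * x) + bm * si * x)"
proof -
  have "- (ri * k * qm) + r * si * (qg + ri\<^sup>2 * qm + ri * bm) - (- (si * (l * qm - bm + - r * qg))) =
     qm * (- ri * k + si * ri + si * l) + (r * ri - 1) * (si * ri * qm + si * bm)"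
    by (simp add: power2_eq_square algebra_simps)
  also have "- ri * k + si * ri + si * l = ri * k * (s * si - 1) - si * l * (r * ri - 1)"
  proof -
    have "ri * k * (s * si - 1) - si * l * (r * ri - 1) = ri * si * (k * s - l * r) - ri * k + si * l"
      by (simp add: algebra_simps)
    then show ?thesis unfolding assms(3) by (simp add: algebra_simps)
  qed
  finally show ?thesis unfolding assms(1,2) by (simp add: algebra_simps)
qed

sublocale orth_decomp \<subseteq> odd_prime p
  by unfold_locales (rule p)+

section \<open>Values of the form modulo p and its Gauss sums\<close>

context orth_decomp
begin

text \<open>An integer representative of p q(x), meaningful only modulo p. Hence homogeneity and
  bilinearity below are congruences.\<close>

definition Q :: "'a \<Rightarrow> int" where
  "Q x = (SOME k. q x = qmodz_of_rat (of_int k / of_nat p))"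

definition B :: "'a \<Rightarrow> 'a \<Rightarrow> int" where
  "B x y = Q (x + y) - Q x - Q y"

lemma Q_spec: "q x = qmodz_of_rat (of_int (Q x) / of_nat p)"
proof -
  obtain c where "x = comb c" using comb_surj by blast
  then have "\<exists>k::int. q x = qmodz_of_rat (of_int k / of_nat p)" using q_comb by blast
  then show ?thesis unfolding Q_def by (rule someI_ex)
qed

lemma qmodz_p_eq_iff:
  "qmodz_of_rat (of_int k / of_nat p) = qmodz_of_rat (of_int l / of_nat p) \<longleftrightarrow> [k = l] (mod int p)"
proof -
  have "(of_int k / of_nat p - of_int l / of_nat p :: rat) = of_int (k - l) / of_nat p"
    by (simp add: diff_divide_distrib)
  then show ?thesis
    by (simp only: qmodz_of_rat_eq_iff int_div_Ints_iff[OF p_pos] cong_iff_dvd_diff)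
qed

lemma bil_B: "bil q x y = qmodz_of_rat (of_int (B x y) / of_nat p)"
  by (simp add: bil_def B_def Q_spec[of "x + y"] Q_spec[of x] Q_spec[of y] diff_divide_distrib
      qmodz_of_rat_diff)

lemma e_q: "e_qmodz (q x) = ep (Q x)"
  by (simp add: Q_spec[of x] ep_def er_def)

lemma e_minus_q: "e_qmodz (- q x) = ep (- Q x)"
  by (simp add: Q_spec[of x] ep_def er_def qmodz_of_rat_minus)

lemma e_bil: "e_qmodz (bil q x y) = ep (B x y)"
  by (simp add: bil_B ep_def er_def)

lemma zmul_p: "zmul (int p) (x :: 'a) = 0"
proof -
  obtain c where "x = comb c" using comb_surj by blast
  then have "zmul (int p) x = (\<Sum>i<n. zmul (c i) (zmul (int p) (g i)))"
    by (simp add: comb_def zmul_sum_right zmul_mult[symmetric] mult.commute)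
  then show ?thesis by (simp add: g_order)
qed

lemma zmul_cong_p: "[k = l] (mod int p) \<Longrightarrow> zmul k (x :: 'a) = zmul l x"
  by (rule zmul_cong[OF zmul_p])

lemma Q_add: "Q (x + y) = Q x + Q y + B x y"
  by (simp add: B_def)

lemma B_commute: "B x y = B y x"
  by (simp add: B_def add.commute)

lemma Q_zmul: "[Q (zmul k x) = k\<^sup>2 * Q x] (mod int p)"
  using quadratic_form_zmul[OF quad, of k x]
  by (simp add: Q_spec[of x] Q_spec[of "zmul k x"] zmul_qmodz_of_rat flip: qmodz_p_eq_iff)

lemma B_zmul_left: "[B (zmul k x) y = k * B x y] (mod int p)"
  using bil_zmul_left[OF quad, of k x y]
  by (simp add: bil_B zmul_qmodz_of_rat flip: qmodz_p_eq_iff)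

lemma B_add_left: "[B (x + y) z = B x z + B y z] (mod int p)"
  using bil_add_left[OF quad, of x y z]
  by (simp add: bil_B add_divide_distrib qmodz_of_rat_add flip: qmodz_p_eq_iff)

lemma bil_eq_0_iff: "bil q x y = 0 \<longleftrightarrow> int p dvd B x y"
  unfolding bil_B qmodz_of_rat_eq_0_iff by (rule int_div_Ints_iff[OF p_pos])

lemma q_eq_0_iff: "q x = 0 \<longleftrightarrow> int p dvd Q x"
  unfolding Q_spec[of x] qmodz_of_rat_eq_0_iff by (rule int_div_Ints_iff[OF p_pos])

lemma sum_shift_group: "(\<Sum>y\<in>UNIV. f (y + z)) = (\<Sum>y\<in>UNIV. f (y::'a))"
  by (rule sum.reindex_bij_witness[of _ "\<lambda>y. y - z" "\<lambda>y. y + z"]) auto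

text \<open>For nonzero x, nondegeneracy makes e((x, y)) a nontrivial character of y, and a shift
  multiplies its sum by a number other than 1.\<close>

lemma sum_ep_B: "(\<Sum>y\<in>UNIV. ep (B x y)) = (if x = 0 then of_nat CARD('a) else 0)"
proof (cases "x = 0")
  case True
  have "bil q x y = 0" for y using True bil_0_left[OF quad] by simp
  then have "ep (B x y) = 1" for y using bil_eq_0_iff ep_eq_1_iff by blast
  then show ?thesis using True by simp
next
  case False
  then obtain z where z: "bil q x z \<noteq> 0" using disc by (auto simp: discriminant_form_def)
  have add: "ep (B x (y + z)) = ep (B x y) * ep (B x z)" for y
    unfolding ep_add[symmetric] using B_add_left[of y z x] by (intro ep_cong) (simp add: B_commute[of x])
  have "(\<Sum>y\<in>UNIV. ep (B x y)) = (\<Sum>y\<in>UNIV. ep (B x (y + z)))" by (rule sum_shift_group[symmetric])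
  also have "\<dots> = (\<Sum>y\<in>UNIV. ep (B x y)) * ep (B x z)" by (simp add: add sum_distrib_right)
  finally have "(\<Sum>y\<in>UNIV. ep (B x y)) * (ep (B x z) - 1) = 0" by (simp add: algebra_simps)
  moreover have "ep (B x z) \<noteq> 1" using z bil_eq_0_iff ep_eq_1_iff by blast
  ultimately show ?thesis using False by simp
qed

text \<open>The character by which matrices with lower left entry divisible by p act on e^0, and
  also the factor acquired by the Gauss sum when q is multiplied by a unit t.\<close>

definition chi :: "int \<Rightarrow> complex" where
  "chi t = of_int (Leg t) ^ n"

definition W :: complex where
  "W = (\<Sum>x\<in>UNIV. ep (Q x))"

lemma chi_mult: "chi (s * t) = chi s * chi t"
  by (simp add: chi_def Leg_mult power_mult_distrib)

lemma chi_1 [simp]: "chi 1 = 1"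
  by (simp add: chi_def)

lemma chi_cong: "[s = t] (mod int p) \<Longrightarrow> chi s = chi t"
  unfolding chi_def using Leg_cong by metis

lemma chi_square: "\<not> int p dvd t \<Longrightarrow> chi t * chi t = 1"
proof -
  assume "\<not> int p dvd t"
  then have "(of_int (Leg t) * of_int (Leg t) :: complex) = 1"
    using Leg_square by (metis of_int_1 of_int_mult)
  then show ?thesis by (simp add: chi_def power_mult_distrib[symmetric])
qed

lemma gauss_prod: "(\<Sum>x\<in>UNIV. ep (t * Q x)) = (\<Prod>i<n. gs (t * a i))"
proof -
  have "(\<Sum>x\<in>UNIV. ep (t * Q x)) = (\<Sum>c\<in>{..<n} \<rightarrow>\<^sub>E R. ep (t * Q (\<Sum>i<n. zmul (c i) (g i))))"
    by (rule sum.reindex_bij_betw[OF g_bij, symmetric])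
  also have "\<dots> = (\<Sum>c\<in>{..<n} \<rightarrow>\<^sub>E R. \<Prod>i<n. ep (t * a i * (c i)\<^sup>2))"
  proof (rule sum.cong)
    fix c
    have "[Q (comb c) = (\<Sum>i<n. (c i)\<^sup>2 * a i)] (mod int p)"
      using q_comb[of c] by (simp only: Q_spec[of "comb c"] qmodz_p_eq_iff)
    then have "ep (t * Q (comb c)) = ep (t * (\<Sum>i<n. (c i)\<^sup>2 * a i))"
      by (intro ep_cong cong_mult) auto
    also have "t * (\<Sum>i<n. (c i)\<^sup>2 * a i) = (\<Sum>i<n. t * a i * (c i)\<^sup>2)"
      by (simp add: sum_distrib_left mult_ac)
    also have "ep \<dots> = (\<Prod>i<n. ep (t * a i * (c i)\<^sup>2))"
      by (simp add: ep_def er_sum[symmetric] sum_divide_distrib)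
    finally show "ep (t * Q (\<Sum>i<n. zmul (c i) (g i))) = (\<Prod>i<n. ep (t * a i * (c i)\<^sup>2))"
      by (simp add: comb_def)
  qed simp
  also have "\<dots> = (\<Prod>i<n. gs (t * a i))"
    unfolding gs_def by (rule prod_sum_PiE[symmetric]) auto
  finally show ?thesis .
qed

lemma W_eq: "W = of_int (\<Prod>i<n. Leg (a i)) * gs 1 ^ n"
proof -
  have "W = (\<Prod>i<n. gs (a i))" using gauss_prod[of 1] by (simp add: W_def)
  also have "\<dots> = (\<Prod>i<n. of_int (Leg (a i)) * gs 1)"
    by (rule prod.cong) (use gs_scale a_ndvd in auto)
  finally show ?thesis by (simp add: prod.distrib)
qed

lemma gauss_scale:
  assumes "\<not> int p dvd t"
  shows "(\<Sum>x\<in>UNIV. ep (t * Q x)) = chi t * W"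
proof -
  have "(\<Sum>x\<in>UNIV. ep (t * Q x)) = (\<Prod>i<n. of_int (Leg t) * of_int (Leg (a i)) * gs 1)"
    unfolding gauss_prod
  proof (rule prod.cong)
    fix i assume "i \<in> {..<n}"
    then have "\<not> int p dvd t * a i" using assms a_ndvd prime_int_p by (simp add: prime_dvd_mult_iff)
    then show "gs (t * a i) = of_int (Leg t) * of_int (Leg (a i)) * gs 1"
      using gs_scale by (simp add: Leg_mult)
  qed simp
  then show ?thesis by (simp add: W_eq chi_def prod.distrib mult_ac)
qed

lemma prod_Leg_square: "(\<Prod>i<n. Leg (a i)) * (\<Prod>i<n. Leg (a i)) = 1"
  unfolding prod.distrib[symmetric] using Leg_square a_ndvd by (intro prod.neutral) auto

lemma W_square: "W * W = chi (-1) * of_nat CARD('a)"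
proof -
  have "W * W = of_int ((\<Prod>i<n. Leg (a i)) * (\<Prod>i<n. Leg (a i))) * (gs 1 * gs 1) ^ n"
    by (simp only: W_eq of_int_mult power_mult_distrib mult_ac)
  also have "\<dots> = (of_int (Leg (-1)) * of_nat p) ^ n"
    by (simp only: prod_Leg_square gs_square of_int_1 mult_1_left)
  finally show ?thesis by (simp add: chi_def card_eq power_mult_distrib)
qed

lemma W_norm: "norm W = sqrt (real CARD('a))"
proof -
  have "norm (W * W) = real CARD('a)"
  proof -
    have "\<bar>Leg (-1)\<bar> = 1" using Leg_values[of "-1"] Leg_eq_0_iff[of "-1"] p_gt_2 by auto
    then have "norm (chi (-1)) = 1" unfolding chi_def norm_power norm_of_int by (metis of_int_1 of_int_abs power_one)
    then show ?thesis unfolding W_square by (simp add: norm_mult)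
  qed
  then have "(norm W)\<^sup>2 = real CARD('a)" by (simp add: norm_mult power2_eq_square)
  then show ?thesis by (metis norm_ge_zero real_sqrt_unique)
qed

definition kappa :: complex where
  "kappa = W / of_nat CARD('a)"

text \<open>The link between the lattice part and the finite computation: the constant of S is now
  expressed by the Gauss sum.\<close>

lemma kappa_exp:
  "exp (2 * of_real pi * \<i> * of_int (disc_sign q) / 8) / of_real (sqrt (real CARD('a))) = kappa"
proof -
  have W: "(\<Sum>d\<in>UNIV. e_qmodz (q d)) = W" by (simp add: W_def e_q)
  have "W = of_real (sqrt (real CARD('a))) * exp (2 * of_real pi * \<i> * of_int (disc_sign q) / 8)"
    using disc_sign_exp[OF lattice_exists] W_norm unfolding W by blast
  moreover have "(of_real (sqrt (real CARD('a))) :: complex) * of_real (sqrt (real CARD('a))) = of_nat CARD('a)"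
    by (simp flip: of_real_mult)
  moreover have "(of_real (sqrt (real CARD('a))) :: complex) \<noteq> 0" by simp
  ultimately show ?thesis unfolding kappa_def by (metis mult_divide_mult_cancel_left)
qed

lemma kappa_W: "kappa * W = chi (-1)"
  using W_square by (simp add: kappa_def)

text \<open>Reducing first makes the inverse a function of the residue class, so that
  \<open>cinv_cong\<close> is an equality.\<close>

definition cinv :: "int \<Rightarrow> int" where
  "cinv r = modular_inverse (int p) (r mod int p)"

lemma cinv_cong: "[r = s] (mod int p) \<Longrightarrow> cinv r = cinv s"
  by (simp add: cinv_def cong_def)

lemma cinv:
  assumes "\<not> int p dvd r"
  shows "[r * cinv r = 1] (mod int p)"
proof -
  have "\<not> int p dvd r mod int p" using assms by (simp add: dvd_mod_iff)
  then have "coprime (r mod int p) (int p)"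
    using prime_imp_coprime[OF prime_int_p] coprime_commute by blast
  then have "[r mod int p * cinv r = 1] (mod int p)"
    unfolding cinv_def by (rule cong_modular_inverse1)
  then show ?thesis by (simp add: cong_def mod_mult_left_eq)
qed

lemma cinv_unique:
  assumes "[r * x = 1] (mod int p)"
  shows "[x = cinv r] (mod int p)"
proof -
  have r: "\<not> int p dvd r" by (rule cong_unit_not_dvd(1)[OF assms])
  have "[x * (r * cinv r) = x * 1] (mod int p)" by (intro cong_mult cinv r) auto
  moreover have "[(r * x) * cinv r = 1 * cinv r] (mod int p)" by (intro cong_mult assms) auto
  ultimately show ?thesis by (simp add: mult_ac) (metis cong_sym cong_trans)
qed

text \<open>The entry in row \<open>\<beta>\<close> and column \<open>\<gamma>\<close> of the operator of a matrix with rows \<open>(k, l)\<close> and \<open>(r, s)\<close>.\<close>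

definition weil_entry :: "int \<Rightarrow> int \<Rightarrow> int \<Rightarrow> int \<Rightarrow> 'a \<Rightarrow> 'a \<Rightarrow> complex" where
  "weil_entry k l r s \<beta> \<gamma> =
     (if int p dvd r then (if \<beta> = zmul s \<gamma> then chi s * ep (- (l * s * Q \<gamma>)) else 0)
      else kappa * chi r * ep (- (cinv r * (k * Q \<beta> - B \<beta> \<gamma> + s * Q \<gamma>))))"

lemma weil_entry_cong:
  assumes "[k = k'] (mod int p)" "[l = l'] (mod int p)" "[r = r'] (mod int p)" "[s = s'] (mod int p)"
  shows "weil_entry k l r s \<beta> \<gamma> = weil_entry k' l' r' s' \<beta> \<gamma>"
proof -
  have 1: "int p dvd r \<longleftrightarrow> int p dvd r'" using assms(3) cong_dvd_iff by blast
  have 2: "ep (- (l * s * Q \<gamma>)) = ep (- (l' * s' * Q \<gamma>))"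
    by (intro ep_cong) (use assms in \<open>intro cong_mult cong_minus_minus_iff[THEN iffD2] cong_refl\<close>)
  have 3: "ep (- (cinv r' * (k * Q \<beta> - B \<beta> \<gamma> + s * Q \<gamma>))) = ep (- (cinv r' * (k' * Q \<beta> - B \<beta> \<gamma> + s' * Q \<gamma>)))"
    by (intro ep_cong) (use assms in \<open>intro cong_mult cong_add cong_diff cong_minus_minus_iff[THEN iffD2] cong_refl\<close>)
  show ?thesis
    unfolding weil_entry_def
    using 1 2 3 chi_cong[OF assms(4)] chi_cong[OF assms(3)] cinv_cong[OF assms(3)] zmul_cong_p[OF assms(4), of \<gamma>]
    by simp
qed

text \<open>Collects the terms in \<beta>: a quadratic phase with coefficient -s/r and a linear one
  given by \<gamma> + r^-1 \<mu>, ready for completing the square.\<close>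

lemma weil_entry_S_aux:
  assumes "\<not> int p dvd r"
  shows "ep (- (cinv r * (k * Q \<mu> - B \<mu> \<beta> + s * Q \<beta>))) * ep (B \<beta> \<gamma>) =
     ep (- (cinv r * k * Q \<mu>)) * ep (- (cinv r * s) * Q \<beta> + B (\<gamma> + zmul (cinv r) \<mu>) \<beta>)"
proof -
  have "[B (\<gamma> + zmul (cinv r) \<mu>) \<beta> = B \<gamma> \<beta> + B (zmul (cinv r) \<mu>) \<beta>] (mod int p)" by (rule B_add_left)
  also have "[B \<gamma> \<beta> + B (zmul (cinv r) \<mu>) \<beta> = B \<gamma> \<beta> + cinv r * B \<mu> \<beta>] (mod int p)"
    by (intro cong_add B_zmul_left) auto
  finally have "ep (- (cinv r * k * Q \<mu>) + (- (cinv r * s) * Q \<beta> + B (\<gamma> + zmul (cinv r) \<mu>) \<beta>)) =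
    ep (- (cinv r * k * Q \<mu>) + (- (cinv r * s) * Q \<beta> + (B \<gamma> \<beta> + cinv r * B \<mu> \<beta>)))"
    by (intro ep_cong cong_add) auto
  also have "- (cinv r * k * Q \<mu>) + (- (cinv r * s) * Q \<beta> + (B \<gamma> \<beta> + cinv r * B \<mu> \<beta>)) =
     - (cinv r * (k * Q \<mu> - B \<mu> \<beta> + s * Q \<beta>)) + B \<beta> \<gamma>"
    by (simp add: algebra_simps B_commute)
  finally show ?thesis by (simp only: ep_add)
qed

text \<open>Translation by a multiple of \<delta> completes the square, and translations permute the
  group.\<close>

lemma gauss_complete_square:
  assumes "[u * u' = 1] (mod int p)" "\<not> int p dvd u"
  shows "(\<Sum>\<beta>\<in>UNIV. ep (- u * Q \<beta> + B \<delta> \<beta>)) = ep (u' * Q \<delta>) * (chi (- u) * W)"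
proof -
  have "ep (- u * Q \<beta> + B \<delta> \<beta>) = ep (u' * Q \<delta>) * ep (- u * Q (\<beta> + zmul (- u') \<delta>))" for \<beta>
  proof -
    have "[Q (\<beta> + zmul (- u') \<delta>) = Q \<beta> + (- u')\<^sup>2 * Q \<delta> + (- u') * B \<delta> \<beta>] (mod int p)"
      unfolding Q_add B_commute[of \<beta>] by (intro cong_add Q_zmul B_zmul_left) auto
    then have "[u' * Q \<delta> + - u * Q (\<beta> + zmul (- u') \<delta>) =
        u' * Q \<delta> + - u * (Q \<beta> + (- u')\<^sup>2 * Q \<delta> + (- u') * B \<delta> \<beta>)] (mod int p)"
      by (intro cong_add cong_mult) auto
    also have "u' * Q \<delta> + - u * (Q \<beta> + (- u')\<^sup>2 * Q \<delta> + (- u') * B \<delta> \<beta>) =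
        u' * Q \<delta> - u * Q \<beta> + (u * u') * (B \<delta> \<beta> - u' * Q \<delta>)"
      by (simp add: power2_eq_square algebra_simps)
    also have "[\<dots> = u' * Q \<delta> - u * Q \<beta> + 1 * (B \<delta> \<beta> - u' * Q \<delta>)] (mod int p)"
      by (intro cong_add cong_mult assms(1)) auto
    finally have "ep (u' * Q \<delta> + - u * Q (\<beta> + zmul (- u') \<delta>)) = ep (- u * Q \<beta> + B \<delta> \<beta>)"
      by (intro ep_cong) simp
    then show ?thesis by (simp only: ep_add)
  qed
  then have "(\<Sum>\<beta>\<in>UNIV. ep (- u * Q \<beta> + B \<delta> \<beta>)) =
      ep (u' * Q \<delta>) * (\<Sum>\<beta>\<in>UNIV. ep (- u * Q (\<beta> + zmul (- u') \<delta>)))"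
    by (simp only: sum_distrib_left)
  also have "(\<Sum>\<beta>\<in>UNIV. ep (- u * Q (\<beta> + zmul (- u') \<delta>))) = (\<Sum>\<beta>\<in>UNIV. ep (- u * Q \<beta>))"
    by (rule sum_shift_group)
  also have "\<dots> = chi (- u) * W" using assms(2) by (intro gauss_scale) simp
  finally show ?thesis .
qed

text \<open>Right multiplication by S is a Fourier transform of each row. If p divides r, a row has
  a single nonzero entry; if p divides s, the quadratic phase disappears and orthogonality leaves
  one entry; otherwise a Gauss sum arises.\<close>

lemma weil_entry_S:
  assumes det: "k * s - l * r = 1"
  shows "(\<Sum>\<beta>\<in>UNIV. weil_entry k l r s \<mu> \<beta> * (kappa * ep (B \<beta> \<gamma>))) = weil_entry l (- k) s (- r) \<mu> \<gamma>"
proof (cases "int p dvd r")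
  case True
  have ks: "[k * s = 1] (mod int p)"
    using True det by (simp add: cong_iff_dvd_diff) (metis add_diff_cancel_left' diff_diff_eq2 dvd_mult diff_add_cancel)
  have s: "\<not> int p dvd s" by (rule cong_unit_not_dvd(2)[OF ks])
  have sk: "[s * k = 1] (mod int p)" using ks by (simp add: mult.commute)
  have inv: "\<mu> = zmul s \<beta> \<longleftrightarrow> \<beta> = zmul k \<mu>" for \<beta>
    using zmul_cong_p[OF ks] zmul_cong_p[OF sk] by (metis zmul_1_left zmul_mult)
  have "(\<Sum>\<beta>\<in>UNIV. weil_entry k l r s \<mu> \<beta> * (kappa * ep (B \<beta> \<gamma>))) =
     (\<Sum>\<beta>\<in>UNIV. if \<beta> = zmul k \<mu> then chi s * ep (- (l * s * Q \<beta>)) * (kappa * ep (B \<beta> \<gamma>)) else 0)"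
    using True by (intro sum.cong) (auto simp: weil_entry_def inv)
  also have "\<dots> = kappa * chi s * (ep (- (l * s * Q (zmul k \<mu>))) * ep (B (zmul k \<mu>) \<gamma>))"
    by simp
  also have "\<dots> = kappa * chi s * ep (- (l * s * Q (zmul k \<mu>)) + B (zmul k \<mu>) \<gamma>)"
    by (simp only: ep_add)
  also have "ep (- (l * s * Q (zmul k \<mu>)) + B (zmul k \<mu>) \<gamma>) = ep (- (cinv s * (l * Q \<mu> - B \<mu> \<gamma> + - r * Q \<gamma>)))"
  proof (rule ep_cong)
    have "[- (l * s * Q (zmul k \<mu>)) + B (zmul k \<mu>) \<gamma> = - (l * s * (k\<^sup>2 * Q \<mu>)) + k * B \<mu> \<gamma>] (mod int p)"
      by (intro cong_add cong_mult Q_zmul B_zmul_left cong_minus_minus_iff[THEN iffD2] cong_refl)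
    also have "- (l * s * (k\<^sup>2 * Q \<mu>)) + k * B \<mu> \<gamma> = - (l * k * Q \<mu>) * (k * s) + k * B \<mu> \<gamma>"
      by (simp add: power2_eq_square algebra_simps)
    also have "[\<dots> = - (l * k * Q \<mu>) * 1 + k * B \<mu> \<gamma>] (mod int p)"
      by (intro cong_add cong_mult ks cong_refl)
    also have "- (l * k * Q \<mu>) * 1 + k * B \<mu> \<gamma> = - (k * (l * Q \<mu> - B \<mu> \<gamma> + 0 * Q \<gamma>))"
      by (simp add: algebra_simps)
    also have "[\<dots> = - (cinv s * (l * Q \<mu> - B \<mu> \<gamma> + - r * Q \<gamma>))] (mod int p)"
    proof -
      have "[0 = - r] (mod int p)" using True by (simp add: cong_iff_dvd_diff)
      then show ?thesis
        using cinv_unique[OF sk] by (intro cong_add cong_mult cong_minus_minus_iff[THEN iffD2] cong_refl)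
    qed
    finally show "[- (l * s * Q (zmul k \<mu>)) + B (zmul k \<mu>) \<gamma> =
        - (cinv s * (l * Q \<mu> - B \<mu> \<gamma> + - r * Q \<gamma>))] (mod int p)" .
  qed
  finally show ?thesis using s by (simp add: weil_entry_def)
next
  case False
  note rr = cinv[OF False]
  define \<delta> where "\<delta> = \<gamma> + zmul (cinv r) \<mu>"
  define E where "E = (\<Sum>\<beta>\<in>UNIV. ep (- (cinv r * s) * Q \<beta> + B \<delta> \<beta>))"
  have "(\<Sum>\<beta>\<in>UNIV. weil_entry k l r s \<mu> \<beta> * (kappa * ep (B \<beta> \<gamma>))) =
     (\<Sum>\<beta>\<in>UNIV. kappa * kappa * chi r * (ep (- (cinv r * (k * Q \<mu> - B \<mu> \<beta> + s * Q \<beta>))) * ep (B \<beta> \<gamma>)))"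
    using False by (simp add: weil_entry_def mult_ac)
  also have "\<dots> = kappa * kappa * chi r * ep (- (cinv r * k * Q \<mu>)) * E"
    unfolding weil_entry_S_aux[OF False] E_def \<delta>_def by (simp add: sum_distrib_left mult.assoc)
  finally have main: "(\<Sum>\<beta>\<in>UNIV. weil_entry k l r s \<mu> \<beta> * (kappa * ep (B \<beta> \<gamma>))) =
     kappa * kappa * chi r * ep (- (cinv r * k * Q \<mu>)) * E" .
  show ?thesis
  proof (cases "int p dvd s")
    case True
    have "E = (\<Sum>\<beta>\<in>UNIV. ep (B \<delta> \<beta>))"
      unfolding E_def using True by (intro sum.cong ep_cong) (auto simp: cong_iff_dvd_diff)
    then have E: "E = (if \<delta> = 0 then of_nat CARD('a) else 0)" by (simp add: sum_ep_B)
    have \<delta>0: "\<delta> = 0 \<longleftrightarrow> \<mu> = zmul (- r) \<gamma>"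
    proof
      assume "\<delta> = 0"
      then have "\<gamma> = - zmul (cinv r) \<mu>" by (simp only: \<delta>_def eq_neg_iff_add_eq_0)
      then have "zmul (- r) \<gamma> = zmul (- r) (- zmul (cinv r) \<mu>)" by simp
      also have "\<dots> = zmul (r * cinv r) \<mu>" by (simp add: zmul_mult zmul_minus_left zmul_minus_right)
      also have "\<dots> = \<mu>" using zmul_cong_p[OF rr] by simp
      finally show "\<mu> = zmul (- r) \<gamma>" ..
    next
      assume "\<mu> = zmul (- r) \<gamma>"
      then have "zmul (cinv r) \<mu> = - zmul (r * cinv r) \<gamma>"
        by (simp add: zmul_minus_left zmul_minus_right zmul_mult[symmetric] mult.commute)
      also have "\<dots> = - \<gamma>" using zmul_cong_p[OF rr] by simp
      finally show "\<delta> = 0" by (simp add: \<delta>_def)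
    qed
    show ?thesis
    proof (cases "\<mu> = zmul (- r) \<gamma>")
      case mu: True
      have "ep (- (cinv r * k * Q \<mu>)) = ep (- (- k * - r * Q \<gamma>))"
      proof (rule ep_cong)
        have "[- (cinv r * k * Q \<mu>) = - (cinv r * k * ((- r)\<^sup>2 * Q \<gamma>))] (mod int p)"
          unfolding mu by (intro cong_mult Q_zmul cong_minus_minus_iff[THEN iffD2] cong_refl)
        also have "- (cinv r * k * ((- r)\<^sup>2 * Q \<gamma>)) = - (k * r * Q \<gamma>) * (r * cinv r)"
          by (simp add: power2_eq_square algebra_simps)
        also have "[\<dots> = - (k * r * Q \<gamma>) * 1] (mod int p)" by (intro cong_mult rr cong_refl)
        finally show "[- (cinv r * k * Q \<mu>) = - (- k * - r * Q \<gamma>)] (mod int p)" by simp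
      qed
      \<comment> \<open>The sign in \<open>chi (- r)\<close> comes from kappa^2 |D| =
        chi(-1).\<close>
      moreover have "kappa * kappa * chi r * of_nat CARD('a) = chi (- r)"
      proof -
        have "kappa * kappa * of_nat CARD('a) = chi (-1)" using kappa_W by (simp add: kappa_def)
        then show ?thesis using chi_mult[of "-1" r] by (simp add: mult_ac)
      qed
      ultimately show ?thesis
        unfolding main using mu E \<delta>0 True by (simp add: weil_entry_def mult_ac)
    next
      case mu: False
      then show ?thesis unfolding main using E \<delta>0 True by (simp add: weil_entry_def)
    qed
  next
    case s: False
    note ss = cinv[OF s]
    have uu: "[(cinv r * s) * (r * cinv s) = 1] (mod int p)"
    proof -
      have "[(r * cinv r) * (s * cinv s) = 1 * 1] (mod int p)" by (intro cong_mult rr ss)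
      then show ?thesis by (simp add: mult_ac)
    qed
    have ri: "\<not> int p dvd cinv r" by (rule cong_unit_not_dvd(2)[OF rr])
    then have u: "\<not> int p dvd cinv r * s" using s prime_int_p by (simp add: prime_dvd_mult_iff)
    have E: "E = ep (r * cinv s * Q \<delta>) * (chi (- (cinv r * s)) * W)"
      unfolding E_def by (rule gauss_complete_square[OF uu u])
    \<comment> \<open>\<open>?X\<close> is the phase after expanding \<open>Q \<delta>\<close>, and
      \<open>?Y\<close> is the one prescribed for the product; \<open>weil_phase_identity\<close>
      shows that they differ by a multiple of p.\<close>
    let ?X = "- (cinv r * k * Q \<mu>) + r * cinv s * (Q \<gamma> + (cinv r)\<^sup>2 * Q \<mu> + cinv r * B \<mu> \<gamma>)"
      and ?Y = "- (cinv s * (l * Q \<mu> - B \<mu> \<gamma> + - r * Q \<gamma>))"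
    have phase: "ep (- (cinv r * k * Q \<mu>)) * ep (r * cinv s * Q \<delta>) = ep ?Y"
      unfolding ep_add[symmetric]
    proof (rule ep_cong)
      obtain x where x: "r * cinv r - 1 = int p * x" using rr unfolding cong_iff_dvd_diff ..
      obtain y where y: "s * cinv s - 1 = int p * y" using ss unfolding cong_iff_dvd_diff ..
      have "[Q \<delta> = Q \<gamma> + (cinv r)\<^sup>2 * Q \<mu> + cinv r * B \<mu> \<gamma>] (mod int p)"
        unfolding \<delta>_def Q_add B_commute[of \<gamma>] by (intro cong_add Q_zmul B_zmul_left cong_refl)
      then have "[- (cinv r * k * Q \<mu>) + r * cinv s * Q \<delta> = ?X] (mod int p)"
        by (intro cong_add cong_mult cong_refl)
      moreover have "[?X = ?Y] (mod int p)"
        unfolding cong_iff_dvd_diff weil_phase_identity[OF x y det] by (rule dvd_triv_left)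
      ultimately show "[- (cinv r * k * Q \<mu>) + r * cinv s * Q \<delta> = ?Y] (mod int p)" by (rule cong_trans)
    qed
    have const: "kappa * kappa * chi r * (chi (- (cinv r * s)) * W) = kappa * chi s"
    proof -
      have "chi (- (cinv r * s)) = chi (-1) * (chi (cinv r) * chi s)"
        using chi_mult[of "-1" "cinv r * s"] by (simp add: chi_mult)
      then have "kappa * kappa * chi r * (chi (- (cinv r * s)) * W) =
          kappa * chi s * (chi r * chi (cinv r)) * (chi (-1) * (kappa * W))"
        by (simp only: mult_ac)
      moreover have "chi r * chi (cinv r) = 1" using chi_cong[OF rr] by (simp add: chi_mult)
      moreover have "chi (-1) * chi (-1) = 1" using p_gt_2 by (intro chi_square) simp
      ultimately show ?thesis by (simp only: kappa_W mult_1_right)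
    qed
    have "kappa * kappa * chi r * ep (- (cinv r * k * Q \<mu>)) * E =
        (kappa * kappa * chi r * (chi (- (cinv r * s)) * W)) * (ep (- (cinv r * k * Q \<mu>)) * ep (r * cinv s * Q \<delta>))"
      unfolding E by (simp only: mult_ac)
    then show ?thesis
      unfolding main const phase using s by (simp only: weil_entry_def if_False)
  qed
qed

text \<open>Column \<gamma> is multiplied by e(-q(\<gamma>)). For r prime to p this is the change of
  s/r to s/r + 1; for p dividing r it is the change of l s by k s, which is 1 modulo p.\<close>

lemma weil_entry_T:
  assumes det: "k * s - l * r = 1"
  shows "weil_entry k l r s \<mu> \<gamma> * ep (- Q \<gamma>) = weil_entry k (k + l) r (r + s) \<mu> \<gamma>"
proof (cases "int p dvd r")
  case True
  obtain x where x: "r = int p * x" using True ..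
  have rs: "[r + s = s] (mod int p)" using True by (simp add: cong_iff_dvd_diff)
  have "ep (- ((k + l) * (r + s) * Q \<gamma>)) = ep (- (l * s * Q \<gamma>) + - Q \<gamma>)"
  proof (rule ep_cong)
    have "- ((k + l) * (r + s) * Q \<gamma>) - (- (l * s * Q \<gamma>) + - Q \<gamma>) = int p * (- (l * x + (k + l) * x) * Q \<gamma>)"
    proof -
      have "- ((k + l) * (r + s) * Q \<gamma>) - (- (l * s * Q \<gamma>) + - Q \<gamma>) =
          - Q \<gamma> * (k * r + (k * s - 1) + l * r)" by (simp add: algebra_simps)
      also have "k * s - 1 = l * r" using det by simp
      finally show ?thesis by (simp add: x algebra_simps)
    qed
    then show "[- ((k + l) * (r + s) * Q \<gamma>) = - (l * s * Q \<gamma>) + - Q \<gamma>] (mod int p)"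
      by (metis cong_iff_dvd_diff dvd_triv_left)
  qed
  then have "ep (- ((k + l) * (r + s) * Q \<gamma>)) = ep (- (l * s * Q \<gamma>)) * ep (- Q \<gamma>)"
    by (simp only: ep_add)
  then show ?thesis
    using True zmul_cong_p[OF rs, of \<gamma>] chi_cong[OF rs] by (simp add: weil_entry_def)
next
  case False
  obtain x where x: "r * cinv r - 1 = int p * x" using cinv[OF False] unfolding cong_iff_dvd_diff ..
  have "ep (- (cinv r * (k * Q \<mu> - B \<mu> \<gamma> + s * Q \<gamma>)) + - Q \<gamma>) =
      ep (- (cinv r * (k * Q \<mu> - B \<mu> \<gamma> + (r + s) * Q \<gamma>)))"
  proof (rule ep_cong)
    have "- (cinv r * (k * Q \<mu> - B \<mu> \<gamma> + s * Q \<gamma>)) + - Q \<gamma> - (- (cinv r * (k * Q \<mu> - B \<mu> \<gamma> + (r + s) * Q \<gamma>)))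
       = (r * cinv r - 1) * Q \<gamma>"
      by (simp add: algebra_simps)
    also have "\<dots> = int p * (x * Q \<gamma>)" unfolding x by simp
    finally have "- (cinv r * (k * Q \<mu> - B \<mu> \<gamma> + s * Q \<gamma>)) + - Q \<gamma> - (- (cinv r * (k * Q \<mu> - B \<mu> \<gamma> + (r + s) * Q \<gamma>)))
       = int p * (x * Q \<gamma>)" .
    then show "[- (cinv r * (k * Q \<mu> - B \<mu> \<gamma> + s * Q \<gamma>)) + - Q \<gamma> =
       - (cinv r * (k * Q \<mu> - B \<mu> \<gamma> + (r + s) * Q \<gamma>))] (mod int p)"
      by (metis cong_iff_dvd_diff dvd_triv_left)
  qed
  then have "ep (- (cinv r * (k * Q \<mu> - B \<mu> \<gamma> + s * Q \<gamma>))) * ep (- Q \<gamma>) =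
      ep (- (cinv r * (k * Q \<mu> - B \<mu> \<gamma> + (r + s) * Q \<gamma>)))"
    by (simp only: ep_add)
  then show ?thesis using False unfolding weil_entry_def by (simp only: if_False mult.assoc)
qed

lemma weil_entry_id: "weil_entry 1 0 0 1 \<beta> \<gamma> = (if \<beta> = \<gamma> then 1 else 0)"
  by (simp add: weil_entry_def)

lemma weil_entry_matS: "weil_entry 0 (-1) 1 0 \<beta> \<gamma> = kappa * ep (B \<beta> \<gamma>)"
proof -
  have 1: "\<not> int p dvd 1" using p_gt_2 by simp
  have "[cinv 1 = 1] (mod int p)" using cinv[OF 1] by simp
  then have "ep (cinv 1 * B \<beta> \<gamma>) = ep (1 * B \<beta> \<gamma>)" by (intro ep_cong cong_mult cong_refl)
  then show ?thesis using 1 by (simp add: weil_entry_def)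
qed

lemma weil_entry_matT: "weil_entry 1 1 0 1 \<beta> \<gamma> = (if \<beta> = \<gamma> then ep (- Q \<gamma>) else 0)"
  by (simp add: weil_entry_def)

end

section \<open>Generators of \<open>SL\<^sub>2(\<int>)\<close>\<close>

definition mat2 :: "int \<Rightarrow> int \<Rightarrow> int \<Rightarrow> int \<Rightarrow> int^2^2" where
  "mat2 k l r s = vector [vector [k, l], vector [r, s]]"

lemma mat2_nth [simp]:
  "mat2 k l r s $ 1 $ 1 = k" "mat2 k l r s $ 1 $ 2 = l" "mat2 k l r s $ 2 $ 1 = r" "mat2 k l r s $ 2 $ 2 = s"
  by (simp_all add: mat2_def)

lemma mat2_eta: "mat2 (M $ 1 $ 1) (M $ 1 $ 2) (M $ 2 $ 1) (M $ 2 $ 2) = M"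
  by (simp add: vec_eq_iff forall_2)

lemma mat2_mult:
  "mat2 k l r s ** mat2 k' l' r' s' =
     mat2 (k * k' + l * r') (k * l' + l * s') (r * k' + s * r') (r * l' + s * s')"
  by (simp add: vec_eq_iff forall_2 matrix_matrix_mult_def sum_2)

lemma det_mat2: "det (mat2 k l r s) = k * s - l * r"
  by (simp add: det_2)

lemma mat2_in_SL2Z: "mat2 k l r s \<in> SL2Z \<longleftrightarrow> k * s - l * r = 1"
  by (simp add: SL2Z_def det_mat2)

lemma SL2Z_det: "M \<in> SL2Z \<Longrightarrow> M $ 1 $ 1 * M $ 2 $ 2 - M $ 1 $ 2 * M $ 2 $ 1 = 1"
  by (simp add: SL2Z_def det_2)

lemma matS_mat2: "matS = mat2 0 (-1) 1 0"
  by (simp add: matS_def mat2_def)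

lemma matT_mat2: "matT = mat2 1 1 0 1"
  by (simp add: matT_def mat2_def)

lemma mat_1_mat2: "mat 1 = mat2 1 0 0 1"
  by (simp add: vec_eq_iff forall_2 mat_def)

lemma SL2Z_mult: "M \<in> SL2Z \<Longrightarrow> N \<in> SL2Z \<Longrightarrow> M ** N \<in> SL2Z"
  by (simp add: SL2Z_def det_mul)

lemma generators_in_SL2Z: "matS \<in> SL2Z" "matT \<in> SL2Z" "mat 1 \<in> SL2Z"
  by (simp_all add: matS_mat2 matT_mat2 mat_1_mat2 mat2_in_SL2Z)

lemma mat2_matS: "mat2 k l r s ** matS = mat2 l (- k) s (- r)"
  by (simp add: matS_mat2 mat2_mult)

lemma mat2_matT: "mat2 k l r s ** matT = mat2 k (k + l) r (r + s)"
  by (simp add: matT_mat2 mat2_mult)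

text \<open>Built by right multiplication, the operation for which the entries were checked.
  Inverses are words as well, since S^4 = 1 and T^-1 is a product of S and T.\<close>

inductive_set ST_words :: "(int^2^2) set" where
  one: "mat 1 \<in> ST_words"
| matS: "M \<in> ST_words \<Longrightarrow> M ** matS \<in> ST_words"
| matT: "M \<in> ST_words \<Longrightarrow> M ** matT \<in> ST_words"

lemma ST_words_subset: "ST_words \<subseteq> SL2Z"
proof
  fix M assume "M \<in> ST_words"
  then show "M \<in> SL2Z" by induction (simp_all add: generators_in_SL2Z SL2Z_mult)
qed

context
  notes words = ST_words.matS[of "mat2 k l r s" for k l r s, unfolded mat2_matS]
    ST_words.matT[of "mat2 k l r s" for k l r s, unfolded mat2_matT]
begin

lemma ST_words_S_inv: "mat2 k l r s \<in> ST_words \<Longrightarrow> mat2 (- l) k (- s) r \<in> ST_words"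
  using words(1)[OF words(1)[OF words(1)], of k l r s] by simp

text \<open>\<open>T\<^sup>-\<^sup>1 = S\<^sup>3 T S T S\<close>.\<close>

lemma ST_words_T_inv: "mat2 k l r s \<in> ST_words \<Longrightarrow> mat2 k (l - k) r (s - r) \<in> ST_words"
  using words(1)[OF words(2)[OF words(1)[OF words(2)[OF ST_words_S_inv]]], of k l r s] by simp

lemma ST_words_T_power: "mat2 k l r s \<in> ST_words \<Longrightarrow> mat2 k (l + j * k) r (s + j * r) \<in> ST_words"
proof (induction j rule: int_induct[where k = 0])
  case base
  then show ?case by simp
next
  case (step1 j)
  then have "mat2 k (k + (l + j * k)) r (r + (s + j * r)) \<in> ST_words" by (intro words(2)) auto
  then show ?case by (simp add: algebra_simps)
next
  case (step2 j)
  then have "mat2 k (l + j * k - k) r (s + j * r - r) \<in> ST_words" by (intro ST_words_T_inv) auto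
  then show ?case by (simp add: algebra_simps)
qed

text \<open>Euclid on the bottom row: multiplication by T^-j with j = s div r and then by S puts s
  mod r in the place of r.\<close>

lemma mat2_in_ST_words: "k * s - l * r = 1 \<Longrightarrow> mat2 k l r s \<in> ST_words"
proof (induction "nat \<bar>r\<bar>" arbitrary: k l r s rule: less_induct)
  case less
  show ?case
  proof (cases "r = 0")
    case True
    then have "k * s = 1" using less.prems by simp
    then consider "k = 1" "s = 1" | "k = -1" "s = -1" by (auto simp: zmult_eq_1_iff)
    then show ?thesis
    proof cases
      case 1
      then show ?thesis
        using ST_words_T_power[of 1 0 0 1 l] ST_words.one True by (simp add: mat_1_mat2)
    next
      case 2
      have "mat2 1 (- l) 0 1 \<in> ST_words"
        using ST_words_T_power[of 1 0 0 1 "- l"] ST_words.one by (simp add: mat_1_mat2)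
      \<comment> \<open>S^2 = -1 supplies the sign.\<close>
      then show ?thesis using words(1)[OF words(1), of 1 "- l" 0 1] 2 True by simp
    qed
  next
    case False
    define j where "j = s div r"
    define s' where "s' = s - j * r"
    define l' where "l' = l - j * k"
    have s': "s' = s mod r" by (simp add: s'_def j_def minus_div_mult_eq_mod)
    have "\<bar>s'\<bar> < \<bar>r\<bar>" unfolding s' using False abs_mod_less by blast
    moreover have "l' * - r - - k * s' = 1"
      using less.prems by (simp add: l'_def s'_def algebra_simps)
    ultimately have "mat2 l' (- k) s' (- r) \<in> ST_words" by (intro less.hyps) auto
    then have "mat2 k l' r s' \<in> ST_words" using ST_words_S_inv by fastforce
    then show ?thesis using ST_words_T_power[of k l' r s' j] by (simp add: l'_def s'_def)
  qed
qed

end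

lemma SL2Z_eq_ST_words: "SL2Z = ST_words"
proof (rule equalityI[OF subsetI ST_words_subset])
  fix M :: "int^2^2" assume "M \<in> SL2Z"
  then have "mat2 (M $ 1 $ 1) (M $ 1 $ 2) (M $ 2 $ 1) (M $ 2 $ 2) \<in> ST_words"
    by (intro mat2_in_ST_words SL2Z_det)
  then show "M \<in> ST_words" by (simp only: mat2_eta)
qed

lemma mult_axis_nth: "(A *v axis j 1) $ i = (A $ i $ j :: complex)"
proof -
  have "(A *v axis j 1) $ i = (\<Sum>k\<in>UNIV. A $ i $ k * (if k = j then 1 else 0))"
    by (simp add: matrix_vector_mult_def axis_def)
  also have "\<dots> = (\<Sum>k\<in>{j}. A $ i $ k * (if k = j then 1 else 0))"
    by (rule sum.mono_neutral_right) auto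
  finally show ?thesis by simp
qed

lemma matrix_eqI_axis:
  fixes A A' :: "complex^'a^'a"
  assumes "\<And>j. A *v axis j 1 = A' *v axis j 1"
  shows "A = A'"
proof -
  have "A $ i $ j = A' $ i $ j" for i j
    using mult_axis_nth[of A j i] mult_axis_nth[of A' j i] assms by metis
  then show ?thesis by (simp add: vec_eq_iff)
qed

text \<open>The conditions prescribe the images of S and T, and multiplicativity carries the
  agreement to all words.\<close>

lemma weil_rep_unique:
  fixes q :: "'a::{finite,ab_group_add} \<Rightarrow> qmodz"
  assumes \<rho>: "is_weil_rep q \<rho>" "is_weil_rep q \<rho>'" and M: "M \<in> SL2Z"
  shows "\<rho> M = \<rho>' M"
proof -
  have S: "\<rho> matS = \<rho>' matS" by (rule matrix_eqI_axis) (use \<rho> in \<open>simp add: is_weil_rep_def\<close>)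
  have T: "\<rho> matT = \<rho>' matT" by (rule matrix_eqI_axis) (use \<rho> in \<open>simp add: is_weil_rep_def\<close>)
  have mult: "\<rho> (M ** N) = \<rho> M ** \<rho> N" "\<rho>' (M ** N) = \<rho>' M ** \<rho>' N"
    if "M \<in> SL2Z" "N \<in> SL2Z" for M N
    using \<rho> that unfolding is_weil_rep_def by blast+
  have "M \<in> ST_words" using M SL2Z_eq_ST_words by simp
  then show ?thesis
  proof induction
    case one
    then show ?case using \<rho> by (simp add: is_weil_rep_def)
  next
    case (matS M)
    then show ?case using mult[of M matS] ST_words_subset generators_in_SL2Z S by auto
  next
    case (matT M)
    then show ?case using mult[of M matT] ST_words_subset generators_in_SL2Z T by auto
  qed
qed

section \<open>The explicit operators form the Weil representation\<close>

context orth_decomp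
begin

definition weil_mat :: "int^2^2 \<Rightarrow> ((complex, 'a) vec, 'a) vec" where
  "weil_mat M = (\<chi> \<beta> \<gamma>. weil_entry (M $ 1 $ 1) (M $ 1 $ 2) (M $ 2 $ 1) (M $ 2 $ 2) \<beta> \<gamma>)"

lemma weil_mat_nth [simp]: "weil_mat (mat2 k l r s) $ \<beta> $ \<gamma> = weil_entry k l r s \<beta> \<gamma>"
  by (simp add: weil_mat_def)

lemma weil_mat_matS:
  assumes "M \<in> SL2Z"
  shows "weil_mat (M ** matS) = weil_mat M ** weil_mat matS"
proof -
  obtain k l r s where M: "M = mat2 k l r s" "k * s - l * r = 1"
    using SL2Z_det[OF assms] mat2_eta[of M] by metis
  have "weil_mat (M ** matS) $ \<mu> $ \<gamma> = (weil_mat M ** weil_mat matS) $ \<mu> $ \<gamma>" for \<mu> \<gamma>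
    unfolding M(1) mat2_matS
    using weil_entry_S[OF M(2), of \<mu> \<gamma>]
    by (simp add: matrix_matrix_mult_def matS_mat2 weil_entry_matS)
  then show ?thesis by (simp add: vec_eq_iff)
qed

lemma weil_mat_matT:
  assumes "M \<in> SL2Z"
  shows "weil_mat (M ** matT) = weil_mat M ** weil_mat matT"
proof -
  obtain k l r s where M: "M = mat2 k l r s" "k * s - l * r = 1"
    using SL2Z_det[OF assms] mat2_eta[of M] by metis
  have "weil_mat (M ** matT) $ \<mu> $ \<gamma> = (weil_mat M ** weil_mat matT) $ \<mu> $ \<gamma>" for \<mu> \<gamma>
  proof -
    have "(weil_mat M ** weil_mat matT) $ \<mu> $ \<gamma> =
        (\<Sum>\<beta>\<in>UNIV. if \<beta> = \<gamma> then weil_entry k l r s \<mu> \<gamma> * ep (- Q \<gamma>) else 0)"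
    proof -
      have "(weil_mat M ** weil_mat matT) $ \<mu> $ \<gamma> =
          (\<Sum>\<beta>\<in>UNIV. weil_entry k l r s \<mu> \<beta> * (if \<beta> = \<gamma> then ep (- Q \<gamma>) else 0))"
        unfolding M(1) by (simp add: matrix_matrix_mult_def matT_mat2 weil_entry_matT)
      also have "\<dots> = (\<Sum>\<beta>\<in>UNIV. if \<beta> = \<gamma> then weil_entry k l r s \<mu> \<gamma> * ep (- Q \<gamma>) else 0)"
        by (rule sum.cong) auto
      finally show ?thesis .
    qed
    then show ?thesis
      unfolding M(1) mat2_matT using weil_entry_T[OF M(2), of \<mu> \<gamma>] by simp
  qed
  then show ?thesis by (simp add: vec_eq_iff)
qed

lemma weil_mat_one: "weil_mat (mat 1) = mat 1"
  unfolding mat_1_mat2 by (simp add: vec_eq_iff weil_entry_id) (simp add: mat_def)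

text \<open>N is a word, so associativity reduces the claim to multiplication by a single
  letter.\<close>

lemma weil_mat_mult:
  assumes M: "M \<in> SL2Z" and N: "N \<in> SL2Z"
  shows "weil_mat (M ** N) = weil_mat M ** weil_mat N"
proof -
  have "N \<in> ST_words" using N SL2Z_eq_ST_words by simp
  then show ?thesis
  proof induction
    case one
    then show ?case by (simp add: weil_mat_one)
  next
    case (matS N)
    then have "N \<in> SL2Z" using ST_words_subset by blast
    then show ?case
      using matS weil_mat_matS[of "M ** N"] weil_mat_matS[of N] SL2Z_mult[OF M]
      by (simp add: matrix_mul_assoc)
  next
    case (matT N)
    then have "N \<in> SL2Z" using ST_words_subset by blast
    then show ?case
      using matT weil_mat_matT[of "M ** N"] weil_mat_matT[of N] SL2Z_mult[OF M]
      by (simp add: matrix_mul_assoc)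
  qed
qed

lemma sum_axis_nth:
  fixes c :: "'b \<Rightarrow> complex" and h :: "'b \<Rightarrow> 'a"
  shows "(\<Sum>x\<in>A. c x *s axis (h x) 1) $ \<mu> = (\<Sum>x\<in>A. if \<mu> = h x then c x else 0)"
  by (auto simp: sum_component axis_def intro!: sum.cong)

lemma is_weil_rep_weil_mat: "is_weil_rep q (restrict weil_mat SL2Z)"
  unfolding is_weil_rep_def
proof (intro conjI allI ballI)
  show "restrict weil_mat SL2Z (mat 1) = mat 1"
    using generators_in_SL2Z by (simp add: weil_mat_one)
  show "restrict weil_mat SL2Z (M ** N) = restrict weil_mat SL2Z M ** restrict weil_mat SL2Z N"
    if "M \<in> SL2Z" "N \<in> SL2Z" for M N
    using that SL2Z_mult weil_mat_mult by simp
  show "restrict weil_mat SL2Z matT *v axis \<gamma> 1 = e_qmodz (- q \<gamma>) *s axis \<gamma> 1" for \<gamma>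
    using generators_in_SL2Z
    by (simp add: vec_eq_iff mult_axis_nth matT_mat2 weil_entry_matT e_minus_q) (simp add: axis_def)
  show "restrict weil_mat SL2Z matS *v axis \<gamma> 1 =
      (exp (2 * of_real pi * \<i> * of_int (disc_sign q) / 8) / of_real (sqrt (real CARD('a)))) *s
        (\<Sum>\<beta>\<in>UNIV. e_qmodz (bil q \<gamma> \<beta>) *s axis \<beta> 1)" for \<gamma>
    unfolding kappa_exp vec_eq_iff
  proof
    fix \<mu>
    have "(\<Sum>\<beta>\<in>UNIV. e_qmodz (bil q \<gamma> \<beta>) *s axis \<beta> 1) $ \<mu> = ep (B \<gamma> \<mu>)"
      unfolding sum_axis_nth by (simp add: e_bil)
    then show "(restrict weil_mat SL2Z matS *v axis \<gamma> 1) $ \<mu> =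
        (kappa *s (\<Sum>\<beta>\<in>UNIV. e_qmodz (bil q \<gamma> \<beta>) *s axis \<beta> 1)) $ \<mu>"
      using generators_in_SL2Z by (simp add: mult_axis_nth matS_mat2 weil_entry_matS B_commute)
  qed
qed

text \<open>Restriction to SL_2(Z) makes the candidate extensional; with uniqueness on SL_2(Z) it is
  the function described by \<open>weil_rep\<close>.\<close>

theorem weil_rep_eq:
  assumes "M \<in> SL2Z"
  shows "weil_rep q M = weil_mat M"
proof -
  have "weil_rep q = restrict weil_mat SL2Z"
    unfolding weil_rep_def
  proof (rule the_equality)
    show "restrict weil_mat SL2Z \<in> extensional SL2Z \<and> is_weil_rep q (restrict weil_mat SL2Z)"
      using is_weil_rep_weil_mat by simp
    fix \<rho> assume \<rho>: "\<rho> \<in> extensional SL2Z \<and> is_weil_rep q \<rho>"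
    show "\<rho> = restrict weil_mat SL2Z"
    proof (rule extensionalityI[of _ SL2Z])
      show "\<rho> M = restrict weil_mat SL2Z M" if "M \<in> SL2Z" for M
        using weil_rep_unique[OF _ is_weil_rep_weil_mat that] \<rho> by blast
    qed (use \<rho> in auto)
  qed
  then show ?thesis using assms by simp
qed

end

section \<open>Averaging over \<open>SL\<^sub>2(\<int>/p\<int>)\<close>\<close>

context odd_prime
begin

abbreviation R' :: "int set" where
  "R' \<equiv> {1..<int p}"

lemma R'_iff: "r \<in> R' \<longleftrightarrow> r \<in> R \<and> \<not> int p dvd r"
  using R_dvd_iff[of r] by auto

definition reduce :: "int^2^2 \<Rightarrow> int \<times> int \<times> int \<times> int" where
  "reduce M = (M $ 1 $ 1 mod int p, M $ 1 $ 2 mod int p, M $ 2 $ 1 mod int p, M $ 2 $ 2 mod int p)"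

lemma reduce_eq_iff:
  "reduce M = reduce N \<longleftrightarrow> (\<forall>i j. [M $ i $ j = N $ i $ j] (mod int p))"
  by (auto simp: reduce_def cong_def forall_2)

text \<open>M^-1 N is congruent to the identity exactly when N is congruent to M; the adjugate
  \<open>M'\<close> serves as the inverse.\<close>

lemma coset_eq:
  assumes "M \<in> SL2Z"
  shows "(\<lambda>K. M ** K) ` principal_congruence p = {N \<in> SL2Z. reduce N = reduce M}"
proof (intro equalityI subsetI)
  fix N assume "N \<in> (\<lambda>K. M ** K) ` principal_congruence p"
  then obtain K where K: "N = M ** K" "K \<in> SL2Z" "\<And>i j. [K $ i $ j = mat 1 $ i $ j] (mod int p)"
    by (auto simp: principal_congruence_def)
  have "[N $ i $ j = M $ i $ j] (mod int p)" for i j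
  proof -
    have "N $ i $ j = (\<Sum>k\<in>UNIV. M $ i $ k * K $ k $ j)" by (simp add: K(1) matrix_matrix_mult_def)
    also have "[\<dots> = (\<Sum>k\<in>UNIV. M $ i $ k * mat 1 $ k $ j)] (mod int p)"
      by (intro cong_sum cong_mult K(3)) auto
    also have "(\<Sum>k\<in>UNIV. M $ i $ k * mat 1 $ k $ j) = (M ** mat 1) $ i $ j"
      by (simp add: matrix_matrix_mult_def)
    finally show ?thesis by simp
  qed
  then show "N \<in> {N \<in> SL2Z. reduce N = reduce M}"
    using K assms by (simp add: reduce_eq_iff SL2Z_mult)
next
  fix N assume N: "N \<in> {N \<in> SL2Z. reduce N = reduce M}"
  define M' where "M' = mat2 (M $ 2 $ 2) (- (M $ 1 $ 2)) (- (M $ 2 $ 1)) (M $ 1 $ 1)"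
  define K where "K = M' ** N"
  have M': "M' \<in> SL2Z" using SL2Z_det[OF assms] by (simp add: M'_def mat2_in_SL2Z algebra_simps)
  have inv: "M' ** M = mat 1" "M ** M' = mat 1"
    using SL2Z_det[OF assms] mat2_mult[of "M $ 2 $ 2" "- (M $ 1 $ 2)" "- (M $ 2 $ 1)" "M $ 1 $ 1" "M $ 1 $ 1" "M $ 1 $ 2" "M $ 2 $ 1" "M $ 2 $ 2"]
      mat2_mult[of "M $ 1 $ 1" "M $ 1 $ 2" "M $ 2 $ 1" "M $ 2 $ 2" "M $ 2 $ 2" "- (M $ 1 $ 2)" "- (M $ 2 $ 1)" "M $ 1 $ 1"]
    by (simp_all add: mat2_eta M'_def mat_1_mat2 algebra_simps)
  have "[K $ i $ j = mat 1 $ i $ j] (mod int p)" for i j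
  proof -
    have "K $ i $ j = (\<Sum>k\<in>UNIV. M' $ i $ k * N $ k $ j)" by (simp add: K_def matrix_matrix_mult_def)
    also have "[\<dots> = (\<Sum>k\<in>UNIV. M' $ i $ k * M $ k $ j)] (mod int p)"
      using N by (intro cong_sum cong_mult) (auto simp: reduce_eq_iff)
    also have "(\<Sum>k\<in>UNIV. M' $ i $ k * M $ k $ j) = (M' ** M) $ i $ j"
      by (simp add: matrix_matrix_mult_def)
    finally show ?thesis by (simp add: inv)
  qed
  moreover have "K \<in> SL2Z" using N M' by (simp add: K_def SL2Z_mult)
  ultimately have "K \<in> principal_congruence p" by (simp add: principal_congruence_def)
  moreover have "M ** K = N" by (simp add: K_def matrix_mul_assoc inv)
  ultimately show "N \<in> (\<lambda>K. M ** K) ` principal_congruence p" by blast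
qed

lemma SL2Z_cosets_bij:
  "bij_betw (\<lambda>t. {N \<in> SL2Z. reduce N = t}) (reduce ` SL2Z) (SL2Z_cosets p)"
proof -
  have "SL2Z_cosets p = (\<lambda>M. {N \<in> SL2Z. reduce N = reduce M}) ` SL2Z"
    unfolding SL2Z_cosets_def by (rule image_cong[OF refl coset_eq])
  then show ?thesis
    unfolding bij_betw_def by (auto simp: inj_on_def image_image)
qed

text \<open>The representative chosen by \<open>SOME\<close> does not matter when \<open>f\<close>
  factors through reduction, so the average runs over residue matrices.\<close>

lemma sum_SL2Z_cosets:
  fixes f :: "int^2^2 \<Rightarrow> 'b::comm_monoid_add"
  assumes "\<And>M. M \<in> SL2Z \<Longrightarrow> f M = F (reduce M)"
  shows "(\<Sum>C\<in>SL2Z_cosets p. f (SOME M. M \<in> C)) = (\<Sum>t\<in>reduce ` SL2Z. F t)"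
proof -
  have "(\<Sum>C\<in>SL2Z_cosets p. f (SOME M. M \<in> C)) =
      (\<Sum>t\<in>reduce ` SL2Z. f (SOME M. M \<in> {N \<in> SL2Z. reduce N = t}))"
    by (rule sum.reindex_bij_betw[OF SL2Z_cosets_bij, symmetric])
  also have "\<dots> = (\<Sum>t\<in>reduce ` SL2Z. F t)"
  proof (rule sum.cong)
    fix t assume "t \<in> reduce ` SL2Z"
    then have "\<exists>M. M \<in> {N \<in> SL2Z. reduce N = t}" by auto
    then have "(SOME M. M \<in> {N \<in> SL2Z. reduce N = t}) \<in> {N \<in> SL2Z. reduce N = t}" by (rule someI_ex)
    then have M: "(SOME M. M \<in> {N \<in> SL2Z. reduce N = t}) \<in> SL2Z"
      "reduce (SOME M. M \<in> {N \<in> SL2Z. reduce N = t}) = t" by blast+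
    show "f (SOME M. M \<in> {N \<in> SL2Z. reduce N = t}) = F t" unfolding assms[OF M(1)] M(2) ..
  qed simp
  finally show ?thesis .
qed

end

section \<open>Cells of the group modulo p\<close>

context orth_decomp
begin

text \<open>Both diagonal entries are chosen congruent to 1 modulo r and to k, s modulo p. Their
  product is then 1 modulo r, which yields the integer l'.\<close>

lemma SL2Z_lift:
  assumes "\<not> int p dvd r"
  shows "\<exists>k' l' s'. k' * s' - l' * r = 1 \<and> [k' = k] (mod int p) \<and> [s' = s] (mod int p)"
proof -
  have c: "[1 + r * cinv r * (t - 1) = t] (mod int p)" for t
  proof -
    have "[1 + r * cinv r * (t - 1) = 1 + 1 * (t - 1)] (mod int p)"
      by (intro cong_add cong_mult cinv[OF assms] cong_refl)
    then show ?thesis by simp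
  qed
  let ?x = "cinv r * (k - 1)" and ?s = "1 + r * cinv r * (s - 1)"
  have "(1 + ?x * r) * ?s - (cinv r * (s - 1) + ?x * ?s) * r = 1" by (simp add: algebra_simps)
  moreover have "[1 + ?x * r = k] (mod int p)" using c[of k] by (simp add: mult_ac)
  ultimately show ?thesis using c[of s] by blast
qed

text \<open>Bruhat decomposition modulo p: for a unit r the entries k, r, s are free and l follows
  from the determinant; for r = 0 the entry l and the unit s are free and k is the inverse of s,
  which is \<open>small_cell\<close>.\<close>

definition big_cell :: "int \<times> int \<times> int \<Rightarrow> int \<times> int \<times> int \<times> int" where
  "big_cell = (\<lambda>(k, r, s). (k, (k * s - 1) * cinv r mod int p, r, s))"

definition small_cell :: "int \<times> int \<Rightarrow> int \<times> int \<times> int \<times> int" where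
  "small_cell = (\<lambda>(l, s). (cinv s mod int p, l, 0, s))"

lemma reduce_mat2_big:
  assumes det: "k * s - l * r = 1" and r: "\<not> int p dvd r"
  shows "reduce (mat2 k l r s) = big_cell (k mod int p, r mod int p, s mod int p)"
proof -
  have "[l * (r * cinv r) = l * 1] (mod int p)" by (intro cong_mult cinv[OF r] cong_refl)
  then have "[l = (k * s - 1) * cinv r] (mod int p)" using det by (simp add: cong_sym_eq algebra_simps)
  moreover have "cinv (r mod int p) = cinv r" by (rule cinv_cong) simp
  moreover have c: "[(k * s - 1) * cinv r = (k mod int p * (s mod int p) - 1) * cinv r] (mod int p)"
    by (intro cong_mult cong_diff cong_refl) (simp_all add: cong_def)
  ultimately show ?thesis
    using c by (simp add: reduce_def big_cell_def cong_def)
qed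

lemma reduce_mat2_small:
  assumes det: "k * s - l * r = 1" and r: "int p dvd r"
  shows "reduce (mat2 k l r s) = small_cell (l mod int p, s mod int p)" "\<not> int p dvd s"
proof -
  have "[k * s - l * r = k * s - 0] (mod int p)" using r by (intro cong_diff) (auto simp: cong_0_iff)
  then have ks: "[s * k = 1] (mod int p)" using det by (simp add: cong_sym_eq mult.commute)
  moreover have "cinv (s mod int p) = cinv s" by (rule cinv_cong) simp
  ultimately show "reduce (mat2 k l r s) = small_cell (l mod int p, s mod int p)"
    using cinv_unique[OF ks] r by (simp add: reduce_def small_cell_def cong_def)
  show "\<not> int p dvd s" by (rule cong_unit_not_dvd(1)[OF ks])
qed

lemma mod_in_R: "x mod int p \<in> R"
  using p_gt_0 by simp

lemma mod_in_R': "\<not> int p dvd x \<Longrightarrow> x mod int p \<in> R'"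
  unfolding R'_iff by (intro conjI mod_in_R) (simp add: dvd_mod_iff)

lemma reduce_image: "reduce ` SL2Z = big_cell ` (R \<times> R' \<times> R) \<union> small_cell ` (R \<times> R')"
proof (intro equalityI subsetI)
  fix t assume "t \<in> reduce ` SL2Z"
  then obtain M where "M \<in> SL2Z" "t = reduce M" by blast
  then obtain k l r s where t: "t = reduce (mat2 k l r s)" and det: "k * s - l * r = 1"
    using SL2Z_det[of M] mat2_eta[of M] by metis
  show "t \<in> big_cell ` (R \<times> R' \<times> R) \<union> small_cell ` (R \<times> R')"
  proof (cases "int p dvd r")
    case True
    have "(l mod int p, s mod int p) \<in> R \<times> R'"
      using reduce_mat2_small(2)[OF det True] mod_in_R mod_in_R' by blast
    then show ?thesis unfolding t reduce_mat2_small(1)[OF det True] by blast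
  next
    case False
    have "(k mod int p, r mod int p, s mod int p) \<in> R \<times> R' \<times> R"
      using False mod_in_R mod_in_R' by blast
    then show ?thesis unfolding t reduce_mat2_big[OF det False] by blast
  qed
next
  fix t assume "t \<in> big_cell ` (R \<times> R' \<times> R) \<union> small_cell ` (R \<times> R')"
  then consider k r s where "t = big_cell (k, r, s)" "k \<in> R" "r \<in> R'" "s \<in> R"
    | l s where "t = small_cell (l, s)" "l \<in> R" "s \<in> R'" by auto
  then show "t \<in> reduce ` SL2Z"
  proof cases
    case 1
    have r: "\<not> int p dvd r" using 1(3) R'_iff by blast
    obtain k' l' s' where lift: "k' * s' - l' * r = 1" "[k' = k] (mod int p)" "[s' = s] (mod int p)"
      using SL2Z_lift[OF r] by blast
    have "reduce (mat2 k' l' r s') = big_cell (k' mod int p, r mod int p, s' mod int p)"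
      by (rule reduce_mat2_big[OF lift(1) r])
    also have "\<dots> = t" using 1 lift(2,3) by (simp add: cong_def)
    finally show ?thesis using lift(1) mat2_in_SL2Z by blast
  next
    case 2
    have s: "\<not> int p dvd - s" using 2(3) R'_iff by simp
    \<comment> \<open>Lift a matrix with lower left entry -s and lower right entry 0 modulo p;
      multiplication by S on the right then gives the required one.\<close>
    obtain k' l' s' where lift: "k' * s' - l' * - s = 1" "[k' = - l] (mod int p)" "[s' = 0] (mod int p)"
      using SL2Z_lift[OF s] by blast
    have det: "l' * s - - k' * s' = 1" using lift(1) by (simp add: algebra_simps)
    have "int p dvd s'" using lift(3) by (simp add: cong_0_iff)
    then have "reduce (mat2 l' (- k') s' s) = small_cell (- k' mod int p, s mod int p)"
      by (rule reduce_mat2_small(1)[OF det])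
    also have "\<dots> = t"
    proof -
      have "[- k' = - (- l)] (mod int p)" using lift(2) by (simp only: cong_minus_minus_iff)
      then show ?thesis using 2 by (simp add: cong_def)
    qed
    finally show ?thesis using det mat2_in_SL2Z by blast
  qed
qed

lemma sum_reduce_image:
  fixes F :: "int \<times> int \<times> int \<times> int \<Rightarrow> 'b::comm_monoid_add"
  shows "(\<Sum>t\<in>reduce ` SL2Z. F t) =
     (\<Sum>(k, r, s)\<in>R \<times> R' \<times> R. F (big_cell (k, r, s))) + (\<Sum>(l, s)\<in>R \<times> R'. F (small_cell (l, s)))"
proof -
  have "inj_on big_cell (R \<times> R' \<times> R)" "inj_on small_cell (R \<times> R')"
    by (auto simp: inj_on_def big_cell_def small_cell_def)
  moreover have "big_cell ` (R \<times> R' \<times> R) \<inter> small_cell ` (R \<times> R') = {}"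
    by (auto simp: big_cell_def small_cell_def)
  ultimately show ?thesis
    unfolding reduce_image by (simp add: sum.union_disjoint sum.reindex case_prod_unfold)
qed

lemma card_SL2Z_cosets: "card (SL2Z_cosets p) = p * (p\<^sup>2 - 1)"
proof -
  have "card (SL2Z_cosets p) = card (reduce ` SL2Z)" using bij_betw_same_card[OF SL2Z_cosets_bij] by simp
  also have "\<dots> = (\<Sum>t\<in>reduce ` SL2Z. 1)" by simp
  also have "\<dots> = card (R \<times> R' \<times> R) + card (R \<times> R')"
    unfolding sum_reduce_image by (simp add: case_prod_unfold)
  also have "\<dots> = p * ((p - 1) * p) + p * (p - 1)" by (simp add: card_cartesian_product nat_diff_distrib')
  also have "\<dots> = p * (p\<^sup>2 - 1)"
  proof -
    obtain m where "p = Suc m" using p_gt_0 gr0_implies_Suc by blast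
    then show ?thesis by (simp add: power2_eq_square algebra_simps)
  qed
  finally show ?thesis .
qed

text \<open>What the big cell leaves once k and s are summed out, with
  \<open>B \<mu> \<gamma>\<close> for x.\<close>

definition chi_sum :: "int \<Rightarrow> complex" where
  "chi_sum x = (\<Sum>r\<in>R'. chi r * ep (cinv r * x))"

text \<open>As p divides \<open>Q \<gamma>\<close>, the phase in the big cell is independent of s,
  so the sum over s gives p; the sum over k gives p if q(\<mu>) = 0 and 0 otherwise. The small cell
  is independent of l, which gives p. One factor p cancels against the group order p(p^2 -
  1).\<close>

lemma inv_D_nth:
  assumes \<gamma>: "q \<gamma> = 0"
  shows "inv_D q p (axis \<gamma> 1) $ \<mu> = 1 / of_nat (p\<^sup>2 - 1) *
     (of_nat p * kappa * (if q \<mu> = 0 then chi_sum (B \<mu> \<gamma>) else 0)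
       + (\<Sum>s\<in>R'. if \<mu> = zmul s \<gamma> then chi s else 0))"
proof -
  define F where "F = (\<lambda>(k, l, r, s). weil_entry k l r s \<mu> \<gamma>)"
  have Q\<gamma>: "int p dvd Q \<gamma>" using \<gamma> q_eq_0_iff by blast
  have f: "(weil_rep q M *v axis \<gamma> 1) $ \<mu> = F (reduce M)" if "M \<in> SL2Z" for M
    using weil_rep_eq[OF that]
    by (simp add: F_def reduce_def mult_axis_nth weil_mat_def) (rule weil_entry_cong; simp add: cong_def)
  have "(\<Sum>C\<in>SL2Z_cosets p. weil_rep q (SOME M. M \<in> C) *v axis \<gamma> 1) $ \<mu> = (\<Sum>t\<in>reduce ` SL2Z. F t)"
    unfolding sum_component by (rule sum_SL2Z_cosets[where f = "\<lambda>M. (weil_rep q M *v axis \<gamma> 1) $ \<mu>"]) (rule f)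
  also have "\<dots> = (\<Sum>(k, r, s)\<in>R \<times> R' \<times> R. F (big_cell (k, r, s))) + (\<Sum>(l, s)\<in>R \<times> R'. F (small_cell (l, s)))"
    by (rule sum_reduce_image)
  also have "(\<Sum>(k, r, s)\<in>R \<times> R' \<times> R. F (big_cell (k, r, s))) =
      (\<Sum>(k, r, s)\<in>R \<times> R' \<times> R. kappa * chi r * ep (cinv r * B \<mu> \<gamma>) * ep (- (cinv r * Q \<mu>) * k))"
  proof (rule sum.cong, simp, clarify)
    fix k r s assume "r \<in> R'"
    then have r: "\<not> int p dvd r" using R'_iff by blast
    have "ep (- (cinv r * (k * Q \<mu> - B \<mu> \<gamma> + s * Q \<gamma>))) = ep (cinv r * B \<mu> \<gamma> + - (cinv r * Q \<mu>) * k)"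
    proof (rule ep_cong)
      have "- (cinv r * (k * Q \<mu> - B \<mu> \<gamma> + s * Q \<gamma>)) - (cinv r * B \<mu> \<gamma> + - (cinv r * Q \<mu>) * k) = - (cinv r * s) * Q \<gamma>"
        by (simp add: algebra_simps)
      then show "[- (cinv r * (k * Q \<mu> - B \<mu> \<gamma> + s * Q \<gamma>)) = cinv r * B \<mu> \<gamma> + - (cinv r * Q \<mu>) * k] (mod int p)"
        unfolding cong_iff_dvd_diff using Q\<gamma> by simp
    qed
    then show "F (big_cell (k, r, s)) = kappa * chi r * ep (cinv r * B \<mu> \<gamma>) * ep (- (cinv r * Q \<mu>) * k)"
      using r by (simp only: F_def big_cell_def weil_entry_def prod.case if_False ep_add mult.assoc)
  qed
  also have "\<dots> = (\<Sum>r\<in>R'. kappa * chi r * ep (cinv r * B \<mu> \<gamma>) * (of_nat p * (\<Sum>k\<in>R. ep (- (cinv r * Q \<mu>) * k))))"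
  proof -
    have "(\<Sum>(k, r, s)\<in>R \<times> R' \<times> R. kappa * chi r * ep (cinv r * B \<mu> \<gamma>) * ep (- (cinv r * Q \<mu>) * k)) =
      (\<Sum>k\<in>R. \<Sum>r\<in>R'. \<Sum>s\<in>R. kappa * chi r * ep (cinv r * B \<mu> \<gamma>) * ep (- (cinv r * Q \<mu>) * k))"
      by (simp only: sum.cartesian_product)
    also have "\<dots> = (\<Sum>r\<in>R'. \<Sum>k\<in>R. kappa * chi r * ep (cinv r * B \<mu> \<gamma>) * (of_nat p * ep (- (cinv r * Q \<mu>) * k)))"
      by (subst sum.swap) (simp add: mult_ac)
    finally show ?thesis by (simp only: sum_distrib_left)
  qed
  also have "\<dots> = of_nat p * (of_nat p * kappa * (if q \<mu> = 0 then chi_sum (B \<mu> \<gamma>) else 0))"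
  proof -
    have "(\<Sum>k\<in>R. ep (- (cinv r * Q \<mu>) * k)) = (if q \<mu> = 0 then of_nat p else 0)" if "r \<in> R'" for r
    proof -
      have "\<not> int p dvd r" using that R'_iff by blast
      then have "\<not> int p dvd cinv r" by (intro cong_unit_not_dvd(2)[OF cinv])
      then have "int p dvd - (cinv r * Q \<mu>) \<longleftrightarrow> q \<mu> = 0"
        using prime_int_p by (simp add: prime_dvd_mult_iff q_eq_0_iff)
      then show ?thesis unfolding sum_ep by simp
    qed
    then show ?thesis by (simp add: chi_sum_def sum_distrib_left mult_ac)
  qed
  also have "(\<Sum>(l, s)\<in>R \<times> R'. F (small_cell (l, s))) = of_nat p * (\<Sum>s\<in>R'. if \<mu> = zmul s \<gamma> then chi s else 0)"
  proof -
    have ep1: "ep (- (l * s * Q \<gamma>)) = 1" for l s using Q\<gamma> by (simp add: ep_eq_1_iff)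
    have "(\<Sum>(l, s)\<in>R \<times> R'. F (small_cell (l, s))) = (\<Sum>(l, s)\<in>R \<times> R'. if \<mu> = zmul s \<gamma> then chi s else 0)"
      by (intro sum.cong) (auto simp: F_def small_cell_def weil_entry_def ep1)
    also have "\<dots> = (\<Sum>l\<in>R. \<Sum>s\<in>R'. if \<mu> = zmul s \<gamma> then chi s else 0)"
      by (simp only: sum.cartesian_product)
    finally show ?thesis by simp
  qed
  finally have "(\<Sum>C\<in>SL2Z_cosets p. weil_rep q (SOME M. M \<in> C) *v axis \<gamma> 1) $ \<mu> =
     of_nat p * (of_nat p * kappa * (if q \<mu> = 0 then chi_sum (B \<mu> \<gamma>) else 0)
       + (\<Sum>s\<in>R'. if \<mu> = zmul s \<gamma> then chi s else 0))" by (simp only: distrib_left)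
  then show ?thesis
    unfolding inv_D_def card_SL2Z_cosets using p_gt_0 by simp
qed

end

section \<open>Evaluation of the character sums and constants\<close>

context orth_decomp
begin

lemma cinv_R': "r \<in> R' \<Longrightarrow> cinv r \<in> R'"
proof -
  assume "r \<in> R'"
  then have "\<not> int p dvd r" using R'_iff by blast
  then have "\<not> int p dvd cinv r" by (intro cong_unit_not_dvd(2)[OF cinv])
  moreover have "cinv r \<in> R"
    unfolding cinv_def using p_gt_0 modular_inverse_int_nonneg modular_inverse_int_less by simp
  ultimately show ?thesis using R'_iff by blast
qed

lemma cinv_cinv: "r \<in> R' \<Longrightarrow> cinv (cinv r) = r"
proof -
  assume r: "r \<in> R'"
  then have "\<not> int p dvd r" using R'_iff by blast
  then have "[r * cinv r = 1] (mod int p)" by (rule cinv)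
  then have "[cinv r * r = 1] (mod int p)" by (simp only: mult.commute)
  then have "[r = cinv (cinv r)] (mod int p)" by (rule cinv_unique)
  moreover have "cinv (cinv r) \<in> R'" using r cinv_R' by blast
  ultimately show ?thesis using r R_cong_eq[of r "cinv (cinv r)"] R'_iff by simp
qed

text \<open>On units chi squares to 1, so chi(r^-1) = chi(r).\<close>

lemma chi_sum_reindex: "chi_sum x = (\<Sum>j\<in>R'. chi j * ep (x * j))"
  unfolding chi_sum_def
proof (rule sum.reindex_bij_witness[of _ cinv cinv])
  fix r assume r: "r \<in> R'"
  then have nd: "\<not> int p dvd r" using R'_iff by blast
  have "chi r * chi (cinv r) = 1" using chi_cong[OF cinv[OF nd]] by (simp add: chi_mult)
  then have "chi (cinv r) = chi r * chi r * chi (cinv r)" using chi_square[OF nd] by simp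
  then have "chi (cinv r) = chi r" using \<open>chi r * chi (cinv r) = 1\<close> by (simp add: mult.assoc)
  then show "chi (cinv r) * ep (x * cinv r) = chi r * ep (cinv r * x)" by (simp add: mult.commute)
qed (auto simp: cinv_cinv cinv_R' simp del: atLeastLessThan_iff)

lemma sum_R_R': "(\<Sum>j\<in>R. f j) = f 0 + (\<Sum>j\<in>R'. f j)"
proof -
  have "R = insert 0 R'" using p_gt_0 by auto
  then show ?thesis by simp
qed

lemma chi_even: "even n \<Longrightarrow> \<not> int p dvd t \<Longrightarrow> chi t = 1"
proof -
  assume "even n" and t: "\<not> int p dvd t"
  then obtain m where "n = 2 * m" by (elim evenE)
  then have "chi t = of_int (Leg t * Leg t) ^ m" unfolding chi_def by (simp add: power_mult power2_eq_square)
  then show ?thesis by (simp only: Leg_square[OF t] of_int_1 power_one)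
qed

lemma chi_odd: "odd n \<Longrightarrow> chi t = of_int (Leg t)"
proof -
  assume "odd n"
  then obtain m where "n = 2 * m + 1" by (elim oddE)
  moreover have "Leg t ^ (2 * m + 1) = Leg t" using Leg_values[of t] by auto
  ultimately show ?thesis unfolding chi_def by (metis of_int_power)
qed

text \<open>On units chi is trivial, which leaves the full sum of phases without its term at
  0.\<close>

lemma chi_sum_even:
  assumes "even n"
  shows "chi_sum x = (if int p dvd x then of_nat p else 0) - 1"
proof -
  have "chi_sum x = (\<Sum>j\<in>R'. ep (x * j))"
    unfolding chi_sum_reindex using chi_even[OF assms] R'_iff by (intro sum.cong) auto
  also have "\<dots> = (\<Sum>j\<in>R. ep (x * j)) - 1" by (simp add: sum_R_R')
  finally show ?thesis by (simp only: sum_ep)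
qed

text \<open>Here chi is the Legendre symbol. It vanishes at 0, so the term j = 0 may be included and
  a scaled quadratic Gauss sum results.\<close>

lemma chi_sum_odd:
  assumes "odd n"
  shows "chi_sum x = of_int (Leg x) * gs 1"
proof -
  have "Leg 0 = 0" using Leg_eq_0_iff by simp
  then have "chi_sum x = leg_sum x"
    unfolding chi_sum_reindex chi_odd[OF assms] leg_sum_def by (simp add: sum_R_R')
  then show ?thesis using leg_sum_scale[of x] gs_1 by simp
qed

lemma Leg_2_square: "Leg 2 * Leg 2 = 1"
proof (rule Leg_square)
  show "\<not> int p dvd 2"
  proof
    assume "int p dvd 2"
    then have "int p dvd 2 * 1" by simp
    then have "int p dvd 1" by (rule prime_dvd_double[OF p])
    then show False using p_gt_2 by simp
  qed
qed

text \<open>For even n the factors (2/p) in \<epsilon> cancel in pairs, and \<open>gs 1 ^ n\<close>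
  is a power of (-1/p) p. The exponent m - 1 is an integer because it is -1 for n = 0.\<close>

lemma kappa_even:
  assumes "n = 2 * m"
  shows "of_nat p * kappa = of_int (\<Prod>i<n. Leg (2 * a i)) * of_int (Leg (-1)) ^ m
     * (1 / of_nat p powi (int m - 1))"
proof -
  have "(\<Prod>i<n. Leg (2 * a i)) = Leg 2 ^ n * (\<Prod>i<n. Leg (a i))"
    by (simp add: Leg_mult prod.distrib)
  also have "Leg 2 ^ n = 1" using Leg_2_square by (simp add: assms power_mult power2_eq_square)
  finally have "W = of_int (\<Prod>i<n. Leg (2 * a i)) * (gs 1 * gs 1) ^ m"
    unfolding W_eq by (simp add: assms power_mult power2_eq_square)
  then have "W = of_int (\<Prod>i<n. Leg (2 * a i)) * of_int (Leg (-1)) ^ m * of_nat p ^ m"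
    unfolding gs_square by (simp add: power_mult_distrib)
  moreover have "of_nat CARD('a) = (of_nat p ^ m * of_nat p ^ m :: complex)"
    by (simp add: card_eq assms power_mult power2_eq_square power_mult_distrib)
  moreover have "of_nat p powi (int m - 1) = (of_nat p ^ m / of_nat p :: complex)"
    using p_gt_0 by (simp add: power_int_diff)
  ultimately show ?thesis using p_gt_0 by (simp add: kappa_def)
qed

text \<open>The additional \<open>gs 1\<close> stems from \<open>chi_sum_odd\<close> and completes
  the odd power to \<open>gs 1 ^ (n + 1)\<close>. As n is odd, \<epsilon> differs from the product
  of the symbols (a_i/p) by one factor (2/p).\<close>

lemma kappa_odd:
  assumes "n = 2 * m + 1"
  shows "of_nat p * kappa * gs 1 = of_int (\<Prod>i<n. Leg (2 * a i)) * of_int (Leg (-1)) ^ (m + 1)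
     * of_int (Leg 2) * (1 / of_nat p powi (int m - 1))"
proof -
  have "(\<Prod>i<n. Leg (2 * a i)) = Leg 2 ^ n * (\<Prod>i<n. Leg (a i))"
    by (simp add: Leg_mult prod.distrib)
  also have "Leg 2 ^ n = Leg 2" using Leg_2_square by (simp add: assms power_mult power2_eq_square)
  finally have "(\<Prod>i<n. Leg (2 * a i)) * Leg 2 = (Leg 2 * Leg 2) * (\<Prod>i<n. Leg (a i))"
    by (simp only: mult_ac)
  then have eps: "(\<Prod>i<n. Leg (a i)) = (\<Prod>i<n. Leg (2 * a i)) * Leg 2"
    by (simp only: Leg_2_square mult_1_left)
  have "W * gs 1 = of_int (\<Prod>i<n. Leg (a i)) * (gs 1 * gs 1) ^ (m + 1)"
    unfolding W_eq assms by (simp add: power_mult power2_eq_square power_mult_distrib power_add mult_ac)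
  then have "W * gs 1 = of_int (\<Prod>i<n. Leg (2 * a i)) * of_int (Leg 2) * of_int (Leg (-1)) ^ (m + 1) * of_nat p ^ (m + 1)"
    unfolding gs_square eps by (simp only: power_mult_distrib of_int_mult mult_ac)
  moreover have "of_nat CARD('a) = (of_nat p ^ m * of_nat p ^ (m + 1) :: complex)"
    by (simp add: card_eq assms power_mult power2_eq_square power_mult_distrib)
  moreover have "of_nat p powi (int m - 1) = (of_nat p ^ m / of_nat p :: complex)"
    using p_gt_0 by (simp add: power_int_diff)
  moreover have "of_nat p * kappa * gs 1 = of_nat p * (W * gs 1) / of_nat CARD('a)"
    by (simp add: kappa_def)
  ultimately show ?thesis using p_gt_0 by simp
qed

lemma p_times_cong: "[p_times p (bil q \<mu> \<gamma>) = B \<mu> \<gamma>] (mod int p)"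
proof -
  have "p_times p (bil q \<mu> \<gamma>) = B \<mu> \<gamma> mod int p"
    unfolding p_times_def
  proof (rule the_equality)
    show "0 \<le> B \<mu> \<gamma> mod int p \<and> B \<mu> \<gamma> mod int p < int p \<and>
        bil q \<mu> \<gamma> = qmodz_of_rat (of_int (B \<mu> \<gamma> mod int p) / of_nat p)"
      using p_gt_0 by (simp add: bil_B qmodz_p_eq_iff cong_def)
    fix k assume k: "0 \<le> k \<and> k < int p \<and> bil q \<mu> \<gamma> = qmodz_of_rat (of_int k / of_nat p)"
    then have "[B \<mu> \<gamma> = k] (mod int p)" by (simp only: bil_B qmodz_p_eq_iff)
    then show "k = B \<mu> \<gamma> mod int p" using k by (simp add: cong_def)
  qed
  then show ?thesis by (simp add: cong_def)
qed

lemma sum_axis_set_nth: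
  fixes c :: "'a \<Rightarrow> complex"
  shows "(\<Sum>\<nu>\<in>A. c \<nu> *s axis \<nu> 1) $ \<mu> = (if \<mu> \<in> A then c \<mu> else 0)"
  unfolding sum_axis_nth by simp

text \<open>At isotropic \<mu> the difference of the two sums has coefficient p - 1 or -1, according
  to whether \<mu> is orthogonal to \<gamma>; this is the value of
  \<open>chi_sum_even\<close>.\<close>

lemma inv_D_even:
  assumes \<gamma>: "q \<gamma> = 0" and n: "n = 2 * m"
  shows "inv_D q p (axis \<gamma> 1) =
    (of_int (\<Prod>i<n. Leg (2 * a i)) * of_int (Leg (-1)) ^ m
       * (1 / (of_nat p ^ 2 - 1)) * (1 / of_nat p powi (int m - 1))) *s
      ((\<Sum>\<mu>\<in>perp q \<gamma> \<inter> isotropic q. of_nat p *s axis \<mu> 1) - (\<Sum>\<mu>\<in>isotropic q. axis \<mu> 1))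
    + (1 / (of_nat p ^ 2 - 1)) *s (\<Sum>s\<in>R'. axis (zmul s \<gamma>) 1)"
    (is "_ = ?rhs")
  unfolding vec_eq_iff
proof
  fix \<mu>
  have ev: "even n" using n by simp
  have p2: "(of_nat (p\<^sup>2 - 1) :: complex) = of_nat p ^ 2 - 1"
    using p_gt_0 by (simp add: of_nat_diff)
  have 1: "((\<Sum>\<mu>\<in>perp q \<gamma> \<inter> isotropic q. of_nat p *s axis \<mu> 1) - (\<Sum>\<mu>\<in>isotropic q. axis \<mu> 1)) $ \<mu> =
      (if q \<mu> = 0 then chi_sum (B \<mu> \<gamma>) else 0)"
    using sum_axis_set_nth[of "\<lambda>_. of_nat p" "perp q \<gamma> \<inter> isotropic q" \<mu>] sum_axis_set_nth[of "\<lambda>_. 1" "isotropic q" \<mu>]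
    by (simp add: chi_sum_even[OF ev] isotropic_def perp_def bil_eq_0_iff)
  have 2: "(\<Sum>s\<in>R'. axis (zmul s \<gamma>) 1) $ \<mu> = (\<Sum>s\<in>R'. if \<mu> = zmul s \<gamma> then chi s else 0)"
  proof -
    have "(\<Sum>s\<in>R'. axis (zmul s \<gamma>) 1) $ \<mu> = (\<Sum>s\<in>R'. if \<mu> = zmul s \<gamma> then 1 else 0 :: complex)"
      using sum_axis_nth[of "\<lambda>_. 1" "\<lambda>s. zmul s \<gamma>" R' \<mu>] by simp
    also have "\<dots> = (\<Sum>s\<in>R'. if \<mu> = zmul s \<gamma> then chi s else 0)"
      using chi_even[OF ev] R'_iff by (intro sum.cong) auto
    finally show ?thesis .
  qed
  show "inv_D q p (axis \<gamma> 1) $ \<mu> = ?rhs $ \<mu>"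
    unfolding inv_D_nth[OF \<gamma>] kappa_even[OF n] p2 vector_add_component vector_smult_component 1 2
    by (simp only: distrib_left mult_ac)
qed

text \<open>\<open>chi_sum_odd\<close> produces the symbol of \<open>B \<mu> \<gamma>\<close>, which
  \<open>p_times_cong\<close> identifies with the one in the formula; its factor \<open>gs 1\<close>
  is absorbed by \<open>kappa_odd\<close>.\<close>

lemma inv_D_odd:
  assumes \<gamma>: "q \<gamma> = 0" and n: "n = 2 * m + 1"
  shows "inv_D q p (axis \<gamma> 1) =
    (of_int (\<Prod>i<n. Leg (2 * a i)) * of_int (Leg (-1)) ^ (m + 1) * of_int (Leg 2)
       * (1 / (of_nat p ^ 2 - 1)) * (1 / of_nat p powi (int m - 1))) *s
      (\<Sum>\<mu>\<in>isotropic q. of_int (Leg (p_times p (bil q \<mu> \<gamma>))) *s axis \<mu> 1)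
    + (1 / (of_nat p ^ 2 - 1)) *s (\<Sum>s\<in>R'. of_int (Leg s) *s axis (zmul s \<gamma>) 1)"
    (is "_ = ?rhs")
  unfolding vec_eq_iff
proof
  fix \<mu>
  have od: "odd n" using n by simp
  have p2: "(of_nat (p\<^sup>2 - 1) :: complex) = of_nat p ^ 2 - 1"
    using p_gt_0 by (simp add: of_nat_diff)
  have 1: "(\<Sum>\<mu>\<in>isotropic q. of_int (Leg (p_times p (bil q \<mu> \<gamma>))) *s axis \<mu> (1 :: complex)) $ \<mu> =
      (if q \<mu> = 0 then of_int (Leg (B \<mu> \<gamma>)) else 0)"
    unfolding sum_axis_set_nth using Leg_cong[OF p_times_cong] by (simp add: isotropic_def)
  have 2: "(\<Sum>s\<in>R'. of_int (Leg s) *s axis (zmul s \<gamma>) (1 :: complex)) $ \<mu> = (\<Sum>s\<in>R'. if \<mu> = zmul s \<gamma> then chi s else 0)"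
    unfolding sum_axis_nth chi_odd[OF od] ..
  have 3: "of_nat p * kappa * (if q \<mu> = 0 then chi_sum (B \<mu> \<gamma>) else 0) =
      (of_nat p * kappa * gs 1) * (if q \<mu> = 0 then of_int (Leg (B \<mu> \<gamma>)) else 0)"
    by (simp add: chi_sum_odd[OF od])
  show "inv_D q p (axis \<gamma> 1) $ \<mu> = ?rhs $ \<mu>"
    unfolding inv_D_nth[OF \<gamma>] 3 kappa_odd[OF n] p2 vector_add_component vector_smult_component 1 2
    by (simp only: distrib_left mult_ac)
qed

end

theorem theorem4p1:
  fixes p n :: nat and \<epsilon> :: int
    and q :: "'a::{finite,ab_group_add} \<Rightarrow> qmodz" and \<gamma> :: 'a
  assumes "prime p" and "odd p"
    and "discriminant_form q" and "disc_type q p \<epsilon> n"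
    and "\<gamma> \<in> isotropic q"
  shows
    "(even n \<longrightarrow>
        inv_D q p (basis_vec \<gamma>) =
          (of_int \<epsilon> * of_int (Legendre (-1) (int p)) ^ (n div 2)
             * (1 / (of_nat p ^ 2 - 1)) * (1 / of_nat p powi ((int n - 2) div 2))) *s
            ((\<Sum>\<mu>\<in>perp q \<gamma> \<inter> isotropic q. of_nat p *s basis_vec \<mu>)
               - (\<Sum>\<mu>\<in>isotropic q. basis_vec \<mu>))
          + (1 / (of_nat p ^ 2 - 1)) *s (\<Sum>a\<in>{1..<int p}. basis_vec (zmul a \<gamma>))) \<and>
     (odd n \<longrightarrow>
        inv_D q p (basis_vec \<gamma>) =
          (of_int \<epsilon> * of_int (Legendre (-1) (int p)) ^ ((n + 1) div 2)
             * of_int (Legendre 2 (int p))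
             * (1 / (of_nat p ^ 2 - 1)) * (1 / of_nat p powi ((int n - 3) div 2))) *s
            (\<Sum>\<mu>\<in>isotropic q.
               of_int (Legendre (p_times p (bil q \<mu> \<gamma>)) (int p)) *s basis_vec \<mu>)
          + (1 / (of_nat p ^ 2 - 1)) *s
              (\<Sum>a\<in>{1..<int p}. of_int (Legendre a (int p)) *s basis_vec (zmul a \<gamma>)))"
proof -
  obtain g :: "nat \<Rightarrow> 'a" and a :: "nat \<Rightarrow> int" where
    g: "\<forall>i<n. zmul (int p) (g i) = 0 \<and> \<not> int p dvd a i \<and> q (g i) = qmodz_of_rat (of_int (a i) / of_nat p)"
    "\<forall>i<n. \<forall>j<n. i \<noteq> j \<longrightarrow> bil q (g i) (g j) = 0"
    "bij_betw (\<lambda>c. \<Sum>i<n. zmul (c i) (g i)) ({..<n} \<rightarrow>\<^sub>E {0..<int p}) UNIV"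
    and \<epsilon>: "\<epsilon> = (\<Prod>i<n. Legendre (2 * a i) (int p))"
    using assms(4) unfolding disc_type_def by blast
  interpret orth_decomp q p n g a
    using assms(1-3) g by unfold_locales (assumption | simp)+
  have \<gamma>: "q \<gamma> = 0" using assms(5) by (simp add: isotropic_def)
  show ?thesis
  proof (cases "even n")
    case True
    then obtain m where m: "n = 2 * m" by (elim evenE)
    \<comment> \<open>The integer division is exact, also for n = 0, where the exponent is
      -1.\<close>
    then have "n div 2 = m" "(int n - 2) div 2 = int m - 1" by auto
    with True show ?thesis
      using inv_D_even[OF \<gamma> m] unfolding \<epsilon> by (simp only: simp_thms)
  next
    case False
    then obtain m where m: "n = 2 * m + 1" by (elim oddE)
    then have "(n + 1) div 2 = m + 1" "(int n - 3) div 2 = int m - 1" by auto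
    with False show ?thesis
      using inv_D_odd[OF \<gamma> m] unfolding \<epsilon> by (simp only: simp_thms)
  qed
qed

end
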